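(* Let $\widehat{\Omega}=\{r_P<0\}\subset\mathbb{C}^{d+1}$ be a limit domain obtained from the scaling construction described in the context, let $\chi_n$ be the dilations at infinity and $\widetilde{\Omega}$ the corresponding homogeneous limit domain defined in the context. Then for any $p,q\in\widetilde{\Omega}$, \[ \lim_{n\to\infty}d_{\chi_n\widehat{\Omega}}(p,q)= d_{\widetilde{\Omega}}(p,q), \] and the convergence is uniform on compact subsets of $\widetilde{\Omega}\times\widetilde{\Omega}$. Here $d_D$ is the Kobayashi distance of a domain $D$.
   Context: Scaling construction. Points of $\mathbb{C}^{d+1}$ are written $z=(z_0,z_1,\ldots,z_d)$, and $(a,{}'0)\in\mathbb{C}\times\mathbb{C}^d$. Let $\Omega\subset\mathbb{C}^{d+1}$ be a bounded pseudoconvex domain of finite type (D'Angelo) with $\mathcal{C}^\infty$ boundary whose Levi form has rank at least $d-1$ at every boundary point. Let $(u_n)\subset\Omega$ converge to $u_\infty\in\partial\Omega$, a point of type $2m$. Coordinates are chosen so that $u_\infty=0$, and $r$ is a smooth defining function of $\Omega$ on a (small) neighbourhood $W$ of $0$ with $\partial r/\partial z_0(0)=1/2$, $|\partial r/\partial z_0|\ge c>0$ on $W$, such that, with $L_0^r=\partial/\partial z_0$ and $L_j^r=\partial/\partial z_j-(\partial r/\partial z_0)^{-1}(\partial r/\partial z_j)\,\partial/\partial z_0$ for $1\le j\le d$, the matrix $(\partial\overline\partial r[L_i^r,\overline{L_j^r}])_{2\le i,j\le d}$ is positive definite on $W$ and equals the identity at $0$. For $x\in W$, $\Phi_x$ is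 Cho's special-coordinate biholomorphism of $\mathbb{C}^{d+1}$: $\Phi_x(x)=0$, $\Phi_x(x+(-\epsilon,{}'0))=(-2\epsilon\,\partial r/\partial\overline z_0(x),{}'0)$, and \[ r\circ\Phi_x^{-1}(\zeta)=r(x)+\operatorname{Re}\zeta_0+\sum_{\alpha=2}^d\sum_{\substack{j+k\le m\\ j,k>0}}\operatorname{Re}\big(b^\alpha_{j,k}(x)\zeta_1^j\overline\zeta_1^k\zeta_\alpha\big)+\sum_{\substack{j+k\le2m\\ j,k>0}}a_{j,k}(x)\zeta_1^j\overline\zeta_1^k+\sum_{\alpha=2}^d|\zeta_\alpha|^2+R(x;\zeta), \] where, with $\zeta_*=(\zeta_2,\ldots,\zeta_d)$, $R(x;\zeta)=O(|\zeta_0||\zeta|+|\zeta_*|^2|\zeta|+|\zeta_*||\zeta_1|^{m+1}+|\zeta_1|^{2m+1})$ uniformly in $x$. Put $A_\ell(x)=\max\{|a_{j,k}(x)|:j+k=\ell\}$ and $\tau(x,\delta)=\min\{(\delta/A_\ell(x))^{1/\ell}:2\le\ell\le2m\}$. For $n$ large choose $\epsilon_n>0$ with $\xi_n:=u_n+(\epsilon_n,{}'0)\in\partial\Omega$ (so $\epsilon_n\to0$), let $\Lambda_n(\zeta)=(\zeta_0/\epsilon_n,\zeta_1/\tau(\xi_n,\epsilon_n),\zeta_2/\sqrt{\epsilon_n},\ldots,\zeta_d/\sqrt{\epsilon_n})$, and set $\psi_n=\Lambda_n\circ\Phi_{\xi_n}$, $\Omega_n=\psi_n(\Omega)$, $r_n=\epsilon_n^{-1}r\circ\psi_n^{-1}$.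 Then $\psi_n(u_n)\to(-1,{}'0)$ and, after passing to a subsequence (done once and for all), $r_n\to r_P$ uniformly on compact subsets of $\mathbb{C}^{d+1}$, where $r_P(\zeta)=\operatorname{Re}\zeta_0+P(\zeta_1,\overline\zeta_1)+\sum_{\alpha=2}^d|\zeta_\alpha|^2$ and $P$ is a nonzero subharmonic real polynomial without harmonic terms, $P(0)=0$, of degree $2m'\le2m$. The limit domain is $\widehat\Omega=\{r_P<0\}$. Scaling at infinity. Let $\chi_n(z)=(n^{-1}z_0,n^{-1/(2m')}z_1,n^{-1/2}z_2,\ldots,n^{-1/2}z_d)$ where $2m'=\deg P$. Then $\chi_n\widehat\Omega=\{\rho_n<0\}$ with $\rho_n=\frac1n r_P\circ\chi_n^{-1}$, and $\rho_n\to\rho$ locally uniformly, where $\rho(z)=\operatorname{Re}z_0+P_{2m'}(z_1,\overline z_1)+\sum_{\alpha=2}^d|z_\alpha|^2$ and $P_{2m'}$ is the homogeneous part of $P$ of degree $2m'$. Set $\widetilde\Omega=\{\rho<0\}$. The Kobayashi distance $d_D$ is the integrated form of the Kobayashi metric $F_D(p;X)=\inf\{|\lambda|: f\colon\Delta\to D\text{ holomorphic},f(0)=p,df_{|0}\lambda=X\}$. *)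

theory Defs
  imports "HOL-Analysis.Analysis" "HOL-Library.Landau_Symbols" "HOL-Library.Poly_Mapping"
begin

text \<open>
  The space of dimension \<open>d + 1\<close> is \<^typ>\<open>complex ^ 'n\<close> with \<open>CARD('n) = d + 1\<close>. Two distinct
  indices \<open>i0\<close> and \<open>i1\<close> label the coordinates \<open>z\<^sub>0\<close> and \<open>z\<^sub>1\<close>; the remaining indices, the set
  \<open>- {i0, i1}\<close>, play the role of \<open>2, \<dots>, d\<close>. This covers every \<open>d \<ge> 1\<close>, including \<open>d = 1\<close>.
\<close>

section \<open>Holomorphic maps and the Kobayashi distance\<close>

definition holomorphic_curve_on :: "(complex \<Rightarrow> complex ^ 'n) \<Rightarrow> complex set \<Rightarrow> bool" where
  "holomorphic_curve_on f S \<longleftrightarrow> (\<forall>i. (\<lambda>t. f t $ i) holomorphic_on S)"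

definition curve_deriv :: "(complex \<Rightarrow> complex ^ 'n) \<Rightarrow> complex \<Rightarrow> complex ^ 'n" where
  "curve_deriv f t = (\<chi> i. deriv (\<lambda>s. f s $ i) t)"

definition kobayashi_metric :: "(complex ^ 'n) set \<Rightarrow> complex ^ 'n \<Rightarrow> complex ^ 'n \<Rightarrow> real" where
  "kobayashi_metric D p X =
     Inf {cmod l | l f. holomorphic_curve_on f (ball 0 1) \<and> f ` ball 0 1 \<subseteq> D \<and> f 0 = p
                        \<and> l *s curve_deriv f 0 = X}"

text \<open>
  The length integral is taken over piecewise continuously differentiable curves and has values in
  \<^typ>\<open>ennreal\<close>; since the Kobayashi metric of an open set is upper semicontinuous, the integrand
  is measurable. On a domain the distance is finite, so the passage to \<^typ>\<open>real\<close> loses nothing;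
  for \<open>p\<close> or \<open>q\<close> outside \<open>D\<close> there is no admissible curve and the value is \<open>0\<close> by convention.
\<close>

definition kobayashi_length :: "(complex ^ 'n) set \<Rightarrow> (real \<Rightarrow> complex ^ 'n) \<Rightarrow> ennreal" where
  "kobayashi_length D g =
     (\<integral>\<^sup>+t\<in>{0..1}. ennreal (kobayashi_metric D (g t) (vector_derivative g (at t))) \<partial>lborel)"

definition kobayashi_dist :: "(complex ^ 'n) set \<Rightarrow> complex ^ 'n \<Rightarrow> complex ^ 'n \<Rightarrow> real" where
  "kobayashi_dist D p q =
     enn2real (INF g \<in> {g. valid_path g \<and> path_image g \<subseteq> D \<and> pathstart g = p \<and> pathfinish g = q}.
       kobayashi_length D g)"

definition holomorphic_map_on :: "(complex ^ 'n \<Rightarrow> complex ^ 'n) \<Rightarrow> (complex ^ 'n) set \<Rightarrow> bool" where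
  "holomorphic_map_on F S \<longleftrightarrow>
     (\<forall>z\<in>S. \<exists>D. (F has_derivative D) (at z) \<and> Vector_Spaces.linear (*s) (*s) D)"

definition global_biholomorphism :: "(complex ^ 'n \<Rightarrow> complex ^ 'n) \<Rightarrow> bool" where
  "global_biholomorphism F \<longleftrightarrow>
     bij F \<and> holomorphic_map_on F UNIV \<and> holomorphic_map_on (inv F) UNIV"

section \<open>Smooth boundaries and the Levi form\<close>

primrec iterated_deriv :: "'a list \<Rightarrow> ('a::real_normed_vector \<Rightarrow> 'b::real_normed_vector) \<Rightarrow> 'a \<Rightarrow> 'b" where
  "iterated_deriv [] f = f"
| "iterated_deriv (v # vs) f = (\<lambda>x. frechet_derivative (iterated_deriv vs f) (at x) v)"

text \<open>For open \<open>S\<close> in a Euclidean space this is \<open>C\<^sup>\<infinity>\<close>: all iterated directional derivatives exist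
  and are differentiable, hence continuous.\<close>

definition smooth_on :: "'a::real_normed_vector set \<Rightarrow> ('a \<Rightarrow> 'b::real_normed_vector) \<Rightarrow> bool" where
  "smooth_on S f \<longleftrightarrow> (\<forall>vs. \<forall>x\<in>S. iterated_deriv vs f differentiable (at x))"

definition wirtinger :: "'n \<Rightarrow> (complex ^ 'n \<Rightarrow> complex) \<Rightarrow> complex ^ 'n \<Rightarrow> complex" where
  "wirtinger j f p =
     (frechet_derivative f (at p) (axis j 1) - \<i> * frechet_derivative f (at p) (axis j \<i>)) / 2"

definition wirtinger_bar :: "'n \<Rightarrow> (complex ^ 'n \<Rightarrow> complex) \<Rightarrow> complex ^ 'n \<Rightarrow> complex" where
  "wirtinger_bar j f p =
     (frechet_derivative f (at p) (axis j 1) + \<i> * frechet_derivative f (at p) (axis j \<i>)) / 2"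

abbreviation d_dz :: "'n \<Rightarrow> (complex ^ 'n \<Rightarrow> real) \<Rightarrow> complex ^ 'n \<Rightarrow> complex" where
  "d_dz j r \<equiv> wirtinger j (\<lambda>z. complex_of_real (r z))"

text \<open>\<open>\<partial>\<partial>\<bar> r[v, w\<bar>]\<close> for tangent vectors \<open>v\<close>, \<open>w\<close> of type (1,0) at \<open>p\<close>.\<close>

definition levi_form ::
    "(complex ^ 'n \<Rightarrow> real) \<Rightarrow> complex ^ 'n \<Rightarrow> complex ^ 'n \<Rightarrow> complex ^ 'n \<Rightarrow> complex" where
  "levi_form r p v w =
     (\<Sum>k\<in>UNIV. \<Sum>l\<in>UNIV.
        wirtinger k (wirtinger_bar l (\<lambda>z. complex_of_real (r z))) p * v $ k * cnj (w $ l))"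

definition complex_tangent :: "(complex ^ 'n \<Rightarrow> real) \<Rightarrow> complex ^ 'n \<Rightarrow> (complex ^ 'n) set" where
  "complex_tangent r p = {v. (\<Sum>k\<in>UNIV. d_dz k r p * v $ k) = 0}"

text \<open>Rank of the Levi form restricted to the complex tangent space: the codimension of its radical.\<close>

definition levi_rank :: "(complex ^ 'n \<Rightarrow> real) \<Rightarrow> complex ^ 'n \<Rightarrow> nat" where
  "levi_rank r p =
     vec.dim (complex_tangent r p)
     - vec.dim {v \<in> complex_tangent r p. \<forall>w \<in> complex_tangent r p. levi_form r p v w = 0}"

definition local_defining_function ::
    "(complex ^ 'n) set \<Rightarrow> (complex ^ 'n) set \<Rightarrow> (complex ^ 'n \<Rightarrow> real) \<Rightarrow> bool" where
  "local_defining_function \<Omega> U r \<longleftrightarrow>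
     open U \<and> smooth_on U r \<and> (\<forall>z\<in>U. z \<in> \<Omega> \<longleftrightarrow> r z < 0)
     \<and> (\<forall>z\<in>U. r z = 0 \<longrightarrow> frechet_derivative r (at z) \<noteq> (\<lambda>_. 0))"

definition smooth_boundary :: "(complex ^ 'n) set \<Rightarrow> bool" where
  "smooth_boundary \<Omega> \<longleftrightarrow> (\<forall>p\<in>frontier \<Omega>. \<exists>U r. p \<in> U \<and> local_defining_function \<Omega> U r)"

text \<open>The next three notions do not depend on the choice of the local defining function.\<close>

definition pseudoconvex :: "(complex ^ 'n) set \<Rightarrow> bool" where
  "pseudoconvex \<Omega> \<longleftrightarrow>
     (\<forall>p\<in>frontier \<Omega>. \<forall>U r. p \<in> U \<and> local_defining_function \<Omega> U r \<longrightarrow>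
        (\<forall>v\<in>complex_tangent r p. 0 \<le> Re (levi_form r p v v)))"

definition levi_rank_at_least :: "(complex ^ 'n) set \<Rightarrow> nat \<Rightarrow> bool" where
  "levi_rank_at_least \<Omega> k \<longleftrightarrow>
     (\<forall>p\<in>frontier \<Omega>. \<forall>U r. p \<in> U \<and> local_defining_function \<Omega> U r \<longrightarrow> k \<le> levi_rank r p)"

text \<open>D'Angelo type: the supremum of \<open>\<nu>(r \<circ> f) / \<nu>(f - p)\<close> over the germs at \<open>0\<close> of nonconstant
  holomorphic curves \<open>f\<close> with \<open>f 0 = p\<close>, where \<open>\<nu>\<close> is the order of vanishing at \<open>0\<close>.\<close>

definition vanishing_order :: "(complex \<Rightarrow> real) \<Rightarrow> enat" where
  "vanishing_order g = Sup {enat k | k. g \<in> O[at 0](\<lambda>t. cmod t ^ k)}"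

definition nonconstant_germs :: "complex ^ 'n \<Rightarrow> (complex \<Rightarrow> complex ^ 'n) set" where
  "nonconstant_germs p =
     {f. f 0 = p \<and> (\<exists>e>0. holomorphic_curve_on f (ball 0 e) \<and> (\<exists>t\<in>ball 0 e. f t \<noteq> p))}"

definition dangelo_type :: "(complex ^ 'n \<Rightarrow> real) \<Rightarrow> complex ^ 'n \<Rightarrow> ereal" where
  "dangelo_type r p =
     (SUP f \<in> nonconstant_germs p.
        ereal_of_enat (vanishing_order (\<lambda>t. r (f t)))
        / ereal_of_enat (vanishing_order (\<lambda>t. norm (f t - p))))"

definition finite_type :: "(complex ^ 'n) set \<Rightarrow> bool" where
  "finite_type \<Omega> \<longleftrightarrow>
     (\<forall>p\<in>frontier \<Omega>. \<forall>U r. p \<in> U \<and> local_defining_function \<Omega> U r \<longrightarrow> dangelo_type r p < \<infinity>)"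

section \<open>Cho's special coordinates\<close>

definition tangential_field ::
    "'n \<Rightarrow> (complex ^ 'n \<Rightarrow> real) \<Rightarrow> 'n \<Rightarrow> complex ^ 'n \<Rightarrow> complex ^ 'n" where
  "tangential_field i0 r j x = axis j 1 - axis i0 (d_dz j r x / d_dz i0 r x)"

definition adapted_coordinates ::
    "'n \<Rightarrow> 'n \<Rightarrow> (complex ^ 'n \<Rightarrow> real) \<Rightarrow> (complex ^ 'n) set \<Rightarrow> bool" where
  "adapted_coordinates i0 i1 r W \<longleftrightarrow>
     d_dz i0 r 0 = 1 / 2
     \<and> (\<exists>c>0. \<forall>x\<in>W. c \<le> cmod (d_dz i0 r x))
     \<and> (\<forall>x\<in>W. \<forall>c :: 'n \<Rightarrow> complex. (\<exists>j\<in>- {i0, i1}. c j \<noteq> 0) \<longrightarrow>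
          0 < Re (\<Sum>j\<in>- {i0, i1}. \<Sum>k\<in>- {i0, i1}.
                    levi_form r x (tangential_field i0 r j x) (tangential_field i0 r k x)
                    * c j * cnj (c k)))
     \<and> (\<forall>j\<in>- {i0, i1}. \<forall>k\<in>- {i0, i1}.
          levi_form r 0 (tangential_field i0 r j 0) (tangential_field i0 r k 0)
          = (if j = k then 1 else 0))"

definition mixed_exponents :: "nat \<Rightarrow> (nat \<times> nat) set" where
  "mixed_exponents N = {(j, k). 0 < j \<and> 0 < k \<and> j + k \<le> N}"

definition star_norm :: "'n \<Rightarrow> 'n \<Rightarrow> complex ^ 'n \<Rightarrow> real" where
  "star_norm i0 i1 z = sqrt (\<Sum>\<alpha>\<in>- {i0, i1}. (cmod (z $ \<alpha>))\<^sup>2)"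

text \<open>The part of the expansion of \<open>r \<circ> \<Phi>\<^sub>x\<^sup>-\<^sup>1\<close> that precedes the remainder. The sum over the
  coefficients \<open>a\<close> is not written with a real part; that it is real is a consequence of the
  remainder estimate in \<open>cho_coordinates\<close>.\<close>

definition cho_expansion ::
    "'n \<Rightarrow> 'n \<Rightarrow> nat \<Rightarrow> real \<Rightarrow> (nat \<Rightarrow> nat \<Rightarrow> complex) \<Rightarrow> ('n \<Rightarrow> nat \<Rightarrow> nat \<Rightarrow> complex)
     \<Rightarrow> complex ^ 'n \<Rightarrow> complex" where
  "cho_expansion i0 i1 m r0 a b \<zeta> =
     of_real r0 + of_real (Re (\<zeta> $ i0))
     + of_real (\<Sum>\<alpha>\<in>- {i0, i1}. \<Sum>(j, k)\<in>mixed_exponents m.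
         Re (b \<alpha> j k * (\<zeta> $ i1) ^ j * cnj (\<zeta> $ i1) ^ k * \<zeta> $ \<alpha>))
     + (\<Sum>(j, k)\<in>mixed_exponents (2 * m). a j k * (\<zeta> $ i1) ^ j * cnj (\<zeta> $ i1) ^ k)
     + of_real (\<Sum>\<alpha>\<in>- {i0, i1}. (cmod (\<zeta> $ \<alpha>))\<^sup>2)"

definition cho_error :: "'n \<Rightarrow> 'n \<Rightarrow> nat \<Rightarrow> complex ^ 'n \<Rightarrow> real" where
  "cho_error i0 i1 m \<zeta> =
     cmod (\<zeta> $ i0) * norm \<zeta> + (star_norm i0 i1 \<zeta>)\<^sup>2 * norm \<zeta>
     + star_norm i0 i1 \<zeta> * cmod (\<zeta> $ i1) ^ (m + 1) + cmod (\<zeta> $ i1) ^ (2 * m + 1)"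

text \<open>Differentiating the expansion below in the direction of \<open>z\<^sub>0\<close> at \<open>x\<close> shows that the
  holomorphic map \<open>\<Phi> x\<close> must send \<open>x - \<epsilon> e\<^sub>0\<close> to \<open>-2 \<epsilon> (\<partial>r/\<partial>z\<^sub>0)(x) e\<^sub>0\<close> to first order. The
  variant of this condition with \<open>\<partial>r/\<partial>z\<^sub>0\<bar>\<close>, found in the literature, is consistent with the
  expansion only where \<open>\<partial>r/\<partial>z\<^sub>0\<close> is real, and there the two agree.\<close>

definition cho_coordinates ::
    "'n \<Rightarrow> 'n \<Rightarrow> nat \<Rightarrow> (complex ^ 'n \<Rightarrow> real) \<Rightarrow> (complex ^ 'n) set
     \<Rightarrow> (complex ^ 'n \<Rightarrow> complex ^ 'n \<Rightarrow> complex ^ 'n)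
     \<Rightarrow> (complex ^ 'n \<Rightarrow> nat \<Rightarrow> nat \<Rightarrow> complex)
     \<Rightarrow> (complex ^ 'n \<Rightarrow> 'n \<Rightarrow> nat \<Rightarrow> nat \<Rightarrow> complex) \<Rightarrow> bool" where
  "cho_coordinates i0 i1 m r W \<Phi> a b \<longleftrightarrow>
     (\<forall>x\<in>W. global_biholomorphism (\<Phi> x) \<and> \<Phi> x x = 0
        \<and> (\<forall>\<epsilon>>0. \<Phi> x (x + axis i0 (- complex_of_real \<epsilon>))
                    = axis i0 (- 2 * complex_of_real \<epsilon> * d_dz i0 r x)))
     \<and> (\<exists>C>0. \<exists>\<rho>>0. \<forall>x\<in>W. \<forall>\<zeta> \<in> \<Phi> x ` W \<inter> ball 0 \<rho>.
          cmod (of_real (r (inv (\<Phi> x) \<zeta>)) - cho_expansion i0 i1 m (r x) (a x) (b x) \<zeta>)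
          \<le> C * cho_error i0 i1 m \<zeta>)"

section \<open>The scaling\<close>

definition A_coeff :: "(nat \<Rightarrow> nat \<Rightarrow> complex) \<Rightarrow> nat \<Rightarrow> real" where
  "A_coeff a l = Max ((\<lambda>(j, k). cmod (a j k)) ` {(j, k). 0 < j \<and> 0 < k \<and> j + k = l})"

text \<open>Indices with \<open>A_coeff a l = 0\<close> contribute \<open>+\<infinity>\<close> to the minimum and are left out, as division
  by zero would contribute \<open>0\<close>.\<close>

definition tau :: "nat \<Rightarrow> (nat \<Rightarrow> nat \<Rightarrow> complex) \<Rightarrow> real \<Rightarrow> real" where
  "tau m a \<delta> = Min ((\<lambda>l. root l (\<delta> / A_coeff a l)) ` {l \<in> {2..2 * m}. A_coeff a l \<noteq> 0})"

definition anisotropic_dilation :: "'n \<Rightarrow> 'n \<Rightarrow> real \<Rightarrow> real \<Rightarrow> real \<Rightarrow> complex ^ 'n \<Rightarrow> complex ^ 'n" where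
  "anisotropic_dilation i0 i1 s0 s1 s z =
     (\<chi> i. complex_of_real (if i = i0 then s0 else if i = i1 then s1 else s) * z $ i)"

definition scaling_point :: "'n \<Rightarrow> (nat \<Rightarrow> complex ^ 'n) \<Rightarrow> (nat \<Rightarrow> real) \<Rightarrow> nat \<Rightarrow> complex ^ 'n" where
  "scaling_point i0 u \<epsilon> n = u n + axis i0 (complex_of_real (\<epsilon> n))"

definition scaling_map ::
    "'n \<Rightarrow> 'n \<Rightarrow> nat \<Rightarrow> (complex ^ 'n \<Rightarrow> complex ^ 'n \<Rightarrow> complex ^ 'n)
     \<Rightarrow> (complex ^ 'n \<Rightarrow> nat \<Rightarrow> nat \<Rightarrow> complex) \<Rightarrow> (nat \<Rightarrow> complex ^ 'n) \<Rightarrow> (nat \<Rightarrow> real)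
     \<Rightarrow> nat \<Rightarrow> complex ^ 'n \<Rightarrow> complex ^ 'n" where
  "scaling_map i0 i1 m \<Phi> a u \<epsilon> n =
     (let \<xi> = scaling_point i0 u \<epsilon> n
      in anisotropic_dilation i0 i1 (1 / \<epsilon> n) (1 / tau m (a \<xi>) (\<epsilon> n)) (1 / sqrt (\<epsilon> n)) \<circ> \<Phi> \<xi>)"

definition scaled_function ::
    "'n \<Rightarrow> 'n \<Rightarrow> nat \<Rightarrow> (complex ^ 'n \<Rightarrow> real) \<Rightarrow> (complex ^ 'n \<Rightarrow> complex ^ 'n \<Rightarrow> complex ^ 'n)
     \<Rightarrow> (complex ^ 'n \<Rightarrow> nat \<Rightarrow> nat \<Rightarrow> complex) \<Rightarrow> (nat \<Rightarrow> complex ^ 'n) \<Rightarrow> (nat \<Rightarrow> real)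
     \<Rightarrow> nat \<Rightarrow> complex ^ 'n \<Rightarrow> real" where
  "scaled_function i0 i1 m r \<Phi> a u \<epsilon> n \<zeta> = r (inv (scaling_map i0 i1 m \<Phi> a u \<epsilon> n) \<zeta>) / \<epsilon> n"

text \<open>A polynomial in \<open>z\<close> and its conjugate is given by its finitely supported coefficients:
  the key \<open>(j, k)\<close> stands for the monomial \<open>z\<^sup>j cnj z\<^sup>k\<close>.\<close>

type_synonym zzbar_poly = "nat \<times> nat \<Rightarrow>\<^sub>0 complex"

definition zzbar_eval :: "zzbar_poly \<Rightarrow> complex \<Rightarrow> complex" where
  "zzbar_eval P z =
     (\<Sum>(j, k)\<in>Poly_Mapping.keys P. Poly_Mapping.lookup P (j, k) * z ^ j * cnj z ^ k)"

definition zzbar_degree :: "zzbar_poly \<Rightarrow> nat" where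
  "zzbar_degree P = Max ((\<lambda>(j, k). j + k) ` Poly_Mapping.keys P)"

definition homogeneous_part :: "nat \<Rightarrow> zzbar_poly \<Rightarrow> zzbar_poly" where
  "homogeneous_part D P =
     (\<Sum>jk \<in> {(j, k) \<in> Poly_Mapping.keys P. j + k = D}.
        Poly_Mapping.single jk (Poly_Mapping.lookup P jk))"

definition real_polynomial :: "zzbar_poly \<Rightarrow> bool" where
  "real_polynomial P \<longleftrightarrow> (\<forall>z. zzbar_eval P z \<in> \<real>)"

definition no_harmonic_terms :: "zzbar_poly \<Rightarrow> bool" where
  "no_harmonic_terms P \<longleftrightarrow> (\<forall>(j, k) \<in> Poly_Mapping.keys P. 0 < j \<and> 0 < k)"

text \<open>The definition is for continuous functions on the plane, which suffices for polynomials.\<close>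

definition subharmonic :: "(complex \<Rightarrow> real) \<Rightarrow> bool" where
  "subharmonic h \<longleftrightarrow>
     continuous_on UNIV h
     \<and> (\<forall>c. \<forall>s>0. h c \<le> (1 / (2 * pi)) * integral {0..2 * pi} (\<lambda>t. h (c + of_real s * cis t)))"

definition model_function :: "'n \<Rightarrow> 'n \<Rightarrow> zzbar_poly \<Rightarrow> complex ^ 'n \<Rightarrow> real" where
  "model_function i0 i1 P z =
     Re (z $ i0) + Re (zzbar_eval P (z $ i1)) + (\<Sum>\<alpha>\<in>- {i0, i1}. (cmod (z $ \<alpha>))\<^sup>2)"

definition model_domain :: "'n \<Rightarrow> 'n \<Rightarrow> zzbar_poly \<Rightarrow> (complex ^ 'n) set" where
  "model_domain i0 i1 P = {z. model_function i0 i1 P z < 0}"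

text \<open>Locally uniform convergence of functions \<open>f n\<close> that are defined on \<open>V n\<close> only: every compact
  set is eventually contained in \<open>V n\<close>.\<close>

definition exhausting_uniform_limit ::
    "(nat \<Rightarrow> 'a::topological_space set) \<Rightarrow> (nat \<Rightarrow> 'a \<Rightarrow> real) \<Rightarrow> ('a \<Rightarrow> real) \<Rightarrow> bool" where
  "exhausting_uniform_limit V f h \<longleftrightarrow>
     (\<forall>K. compact K \<longrightarrow> (\<forall>\<^sub>F n in sequentially. K \<subseteq> V n) \<and> uniform_limit K f h sequentially)"

definition dilation_at_infinity :: "'n \<Rightarrow> 'n \<Rightarrow> nat \<Rightarrow> nat \<Rightarrow> complex ^ 'n \<Rightarrow> complex ^ 'n" where
  "dilation_at_infinity i0 i1 m' n =
     anisotropic_dilation i0 i1 (1 / real n) (real n powr (- 1 / (2 * real m'))) (real n powr (- 1 / 2))"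

end

theory Submission
  imports Defs "HOL-Complex_Analysis.Complex_Analysis"
begin

text \<open>
  Write a model domain as \<open>r < 0\<close> with \<open>r = Re z\<^sub>0 + P(z\<^sub>1) + |z\<^sub>*|\<^sup>2\<close>. At a point \<open>p\<close> with
  \<open>r p = - \<delta>\<close>, translations, a polynomial shear in \<open>z\<^sub>0\<close> and a dilation carry the domain to one
  whose polynomial \<open>Q\<close> has no harmonic terms and largest coefficient of modulus 1, and \<open>p\<close> to
  \<open>(-1, 0, 0)\<close>. Such \<open>Q\<close> form a compact family, so \<open>\<Delta>Q\<close> is bounded below on a disc of fixed size;
  splitting off from \<open>Q\<close> a subharmonic function of logarithmic growth and applying Harnack's
  inequality bounds every holomorphic disc through \<open>(-1, 0, 0)\<close> on compact subsets of the unit disc,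
  uniformly over the family. Undoing the dilation shows that \<open>log \<delta>\<close>, \<open>z\<^sub>1\<close> and \<open>z\<^sub>*\<close> vary along
  a curve at most by a multiple of its Kobayashi length, with constants that depend on \<open>P\<close> only
  through its degree and a lower bound for one top coefficient, neither of which the dilations
  change. Hence curves of bounded length in the dilated domains stay in one compact subset of the
  limit domain. On compact sets the Kobayashi metrics converge uniformly, by Montel's theorem in one
  direction and by perturbing discs in the other, and the distances follow by comparing the lengths
  of nearly minimal curves.
\<close>

section \<open>Subharmonicity by local minorants\<close>

text \<open>The dilated domains need not be nested, so the limit does not follow from monotonicity
  of the distance, and they are unbounded, so normal families must be earned by a disc estimate
  uniform over all of them. Harnack alone does not give it: \<open>P\<close> may take negative
  values, so \<open>Re f\<^sub>0\<close> has no upper bound in advance. Splitting off a logarithmic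
  function leaves a subharmonic function of \<open>f\<^sub>1\<close>, bounded below, underneath a
  superharmonic one whose value at the centre is controlled; and a bound on a logarithm still bounds
  the modulus. The normalization is uniform because recentring a polynomial keeps its coefficients
  of top degree: at depth \<open>\<delta>\<close> the scale in \<open>z\<^sub>1\<close> is at most
  \<open>(\<delta> / \<kappa>)^(1/N)\<close>, whatever the point. In the normal direction the bound
  is linear in \<open>\<delta>\<close>, hence \<open>log \<delta>\<close> is Lipschitz for the
  length and no curve of bounded length comes close to the boundary. Metrics are compared by ratios,
  which homogeneity in the vector reduces to the unit sphere.\<close>

text \<open>Subharmonicity at \<open>z\<close> in a viscosity sense: up to \<open>o(|w|\<^sup>2)\<close> there is a harmonic minorant
  that touches at \<open>z\<close>. It asks for no smoothness, passes trivially through composition with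
  holomorphic maps, and still gives the maximum principle.\<close>

definition sub_at :: "(complex \<Rightarrow> real) \<Rightarrow> complex \<Rightarrow> bool" where
  "sub_at u z \<longleftrightarrow> (\<exists>F d. 0 < d \<and> F holomorphic_on ball 0 d \<and> F 0 = 0 \<and>
     (\<forall>e>0. \<forall>\<^sub>F w in nhds 0. u z + Re (F w) - e * (cmod w)\<^sup>2 \<le> u (z + w)))"

lemma sub_atI:
  assumes "0 < d" "F holomorphic_on ball 0 d" "F 0 = 0"
    "\<And>e. e > 0 \<Longrightarrow> \<forall>\<^sub>F w in nhds 0. u z + Re (F w) - e * (cmod w)\<^sup>2 \<le> u (z + w)"
  shows "sub_at u z"
  using assms unfolding sub_at_def by blast

text \<open>Otherwise \<open>exp F\<close> would have its maximal modulus at 0 and be constant, so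
  \<open>Re F\<close> would vanish also away from 0. This contradiction drives the maximum principle
  below.\<close>

lemma holomorphic_not_below_cone:
  assumes "0 < d" "F holomorphic_on ball 0 d" "F 0 = 0" "0 < k"
  shows "\<not> (\<forall>\<^sub>F w in nhds 0. Re (F w) \<le> - k * (cmod w)\<^sup>2)"
proof
  assume "\<forall>\<^sub>F w in nhds 0. Re (F w) \<le> - k * (cmod w)\<^sup>2"
  then obtain e where e: "e > 0" "\<And>w. cmod w < e \<Longrightarrow> Re (F w) \<le> - k * (cmod w)\<^sup>2"
    by (auto simp: eventually_nhds_metric dist_norm)
  define r where "r = min d e"
  have r: "r > 0" "r \<le> d" "r \<le> e" using assms e by (auto simp: r_def)
  have "(\<lambda>w. exp (F w)) constant_on ball 0 r"
  proof (rule maximum_modulus_principle[of _ _ "ball 0 r" 0])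
    show "(\<lambda>w. exp (F w)) holomorphic_on ball 0 r"
      using assms(2) r by (intro holomorphic_intros) (auto elim!: holomorphic_on_subset)
    fix z :: complex assume z: "z \<in> ball 0 r"
    have "Re (F z) \<le> - k * (cmod z)\<^sup>2" using e(2)[of z] z r by auto
    also have "\<dots> \<le> 0" using assms by simp
    finally show "cmod (exp (F z)) \<le> cmod (exp (F 0))" using assms by simp
  qed (use r in auto)
  then obtain c where c: "\<And>w. w \<in> ball 0 r \<Longrightarrow> exp (F w) = c" unfolding constant_on_def by blast
  have "c = 1" using c[of 0] r assms by auto
  let ?w = "complex_of_real (r/2)"
  have w: "?w \<in> ball 0 r" using r by auto
  have "cmod (exp (F ?w)) = 1" using c[OF w] \<open>c = 1\<close> by simp
  then have "Re (F ?w) = 0" by simp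
  moreover have "Re (F ?w) \<le> - k * (cmod ?w)\<^sup>2" using e(2)[of ?w] w r by auto
  moreover have "k * (cmod ?w)\<^sup>2 > 0" using assms r by simp
  ultimately show False by linarith
qed

lemma sub_at_add:
  assumes "sub_at u z" "sub_at v z"
  shows "sub_at (\<lambda>x. u x + v x) z"
proof -
  from assms(1) obtain F d where F: "0 < d" "F holomorphic_on ball 0 d" "F 0 = 0"
    "\<And>e. e > 0 \<Longrightarrow> \<forall>\<^sub>F w in nhds 0. u z + Re (F w) - e * (cmod w)\<^sup>2 \<le> u (z + w)"
    unfolding sub_at_def by blast
  from assms(2) obtain G r where G: "0 < r" "G holomorphic_on ball 0 r" "G 0 = 0"
    "\<And>e. e > 0 \<Longrightarrow> \<forall>\<^sub>F w in nhds 0. v z + Re (G w) - e * (cmod w)\<^sup>2 \<le> v (z + w)"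
    unfolding sub_at_def by blast
  show ?thesis
  proof (rule sub_atI[of "min d r" "\<lambda>w. F w + G w"])
    show "(\<lambda>w. F w + G w) holomorphic_on ball 0 (min d r)"
      using F G by (intro holomorphic_intros) (auto elim!: holomorphic_on_subset)
    fix e :: real assume "e > 0"
    then have "e / 2 > 0" by simp
    from F(4)[OF this] G(4)[OF this]
    show "\<forall>\<^sub>F w in nhds 0. u z + v z + Re (F w + G w) - e * (cmod w)\<^sup>2 \<le> u (z + w) + v (z + w)"
      by eventually_elim (simp add: field_simps)
  qed (use F G in auto)
qed

lemma sub_at_cmult:
  assumes "sub_at u z" "c \<ge> 0"
  shows "sub_at (\<lambda>x. c * u x) z"
proof -
  from assms(1) obtain F d where F: "0 < d" "F holomorphic_on ball 0 d" "F 0 = 0"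
    "\<And>e. e > 0 \<Longrightarrow> \<forall>\<^sub>F w in nhds 0. u z + Re (F w) - e * (cmod w)\<^sup>2 \<le> u (z + w)"
    unfolding sub_at_def by blast
  show ?thesis
  proof (rule sub_atI[of d "\<lambda>w. of_real c * F w"])
    fix e :: real assume "e > 0"
    \<comment> \<open>The divisor is \<open>c + 1\<close> because \<open>c\<close> may be 0.\<close>
    then have "e / (c + 1) > 0" using assms by simp
    from F(4)[OF this]
    show "\<forall>\<^sub>F w in nhds 0. c * u z + Re (of_real c * F w) - e * (cmod w)\<^sup>2 \<le> c * u (z + w)"
    proof eventually_elim
      case (elim w)
      have "c * (u z + Re (F w) - e / (c + 1) * (cmod w)\<^sup>2) \<le> c * u (z + w)"
        using elim assms by (intro mult_left_mono) auto
      moreover have "c * (e / (c + 1) * (cmod w)\<^sup>2) \<le> e * (cmod w)\<^sup>2"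
      proof -
        have "c / (c + 1) * (e * (cmod w)\<^sup>2) \<le> 1 * (e * (cmod w)\<^sup>2)"
          using assms \<open>e > 0\<close> by (intro mult_right_mono) auto
        then show ?thesis by (simp add: field_simps)
      qed
      ultimately show ?case by (simp add: algebra_simps)
    qed
  qed (use F in \<open>auto intro!: holomorphic_intros\<close>)
qed

lemma eventually_nhds_translate:
  fixes z :: complex
  assumes "\<forall>\<^sub>F x in nhds z. P x"
  shows "\<forall>\<^sub>F w in nhds 0. P (z + w)"
proof -
  have "filterlim (\<lambda>w. z + w) (nhds z) (nhds 0)"
    by (rule tendsto_eq_rhs, rule tendsto_intros, rule tendsto_const, rule filterlim_ident) simp
  then show ?thesis using eventually_compose_filterlim[OF assms] by blast
qed

lemma sub_at_cong:
  assumes "sub_at u z" "\<forall>\<^sub>F x in nhds z. u x = v x"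
  shows "sub_at v z"
proof -
  have z: "u z = v z" using assms(2) by (rule eventually_nhds_x_imp_x)
  have ev: "\<forall>\<^sub>F w in nhds 0. u (z + w) = v (z + w)" by (rule eventually_nhds_translate[OF assms(2)])
  from assms(1) obtain F d where F: "0 < d" "F holomorphic_on ball 0 d" "F 0 = 0"
    "\<And>e. e > 0 \<Longrightarrow> \<forall>\<^sub>F w in nhds 0. u z + Re (F w) - e * (cmod w)\<^sup>2 \<le> u (z + w)"
    unfolding sub_at_def by blast
  show ?thesis
  proof (rule sub_atI[OF F(1-3)])
    fix e :: real assume "e > 0"
    from F(4)[OF this] ev
    show "\<forall>\<^sub>F w in nhds 0. v z + Re (F w) - e * (cmod w)\<^sup>2 \<le> v (z + w)"
      by eventually_elim (simp add: z)
  qed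
qed

text \<open>A function \<open>v\<close> that touches \<open>u\<close> from below at \<open>z\<close>
  lends its minorant to \<open>u\<close>; this handles functions defined piecewise at the points
  where the pieces meet.\<close>

lemma sub_at_mono:
  assumes "sub_at v z" "v z = u z" "\<forall>\<^sub>F w in nhds 0. v (z + w) \<le> u (z + w)"
  shows "sub_at u z"
proof -
  from assms(1) obtain F d where F: "0 < d" "F holomorphic_on ball 0 d" "F 0 = 0"
    "\<And>e. e > 0 \<Longrightarrow> \<forall>\<^sub>F w in nhds 0. v z + Re (F w) - e * (cmod w)\<^sup>2 \<le> v (z + w)"
    unfolding sub_at_def by blast
  show ?thesis
  proof (rule sub_atI[OF F(1-3)])
    fix e :: real assume "e > 0"
    from F(4)[OF this] assms(3)
    show "\<forall>\<^sub>F w in nhds 0. u z + Re (F w) - e * (cmod w)\<^sup>2 \<le> u (z + w)"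
      by eventually_elim (simp add: assms(2))
  qed
qed

lemma sub_at_const: "sub_at (\<lambda>_. c) z"
  by (rule sub_atI[of 1 "\<lambda>_. 0"]) auto

lemma sub_at_Re:
  assumes "f holomorphic_on S" "open S" "z \<in> S"
  shows "sub_at (\<lambda>x. Re (f x)) z"
proof -
  obtain d where d: "d > 0" "ball z d \<subseteq> S" using assms open_contains_ball by blast
  show ?thesis
  proof (rule sub_atI[of d "\<lambda>w. f (z + w) - f z"])
    have "f holomorphic_on ball z d" using assms d by (meson holomorphic_on_subset)
    then have "f holomorphic_on (\<lambda>w. z + w) ` ball 0 d"
      by (simp add: image_add_ball)
    then have "(f \<circ> (\<lambda>w. z + w)) holomorphic_on ball 0 d"
      by (intro holomorphic_on_compose holomorphic_intros)
    then show "(\<lambda>w. f (z + w) - f z) holomorphic_on ball 0 d"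
      by (intro holomorphic_intros) (simp add: o_def)
  qed (use d in auto)
qed

lemma sub_at_minus_Re:
  assumes "f holomorphic_on S" "open S" "z \<in> S"
  shows "sub_at (\<lambda>x. - Re (f x)) z"
  using sub_at_Re[of "\<lambda>x. - f x" S z] assms by (auto intro: holomorphic_intros)

text \<open>The new minorant is \<open>F\<close> composed with the increment \<open>G\<close> of
  \<open>g\<close>. Since \<open>|G|\<close> is at most a multiple of \<open>|w|\<close>, an error
  \<open>o(|G|^2)\<close> is also \<open>o(|w|^2)\<close>; critical points of \<open>g\<close> need
  no separate treatment.\<close>

lemma sub_at_compose:
  assumes k: "sub_at k (g z)" and g: "g holomorphic_on S" "open S" "z \<in> S"
  shows "sub_at (\<lambda>x. k (g x)) z"
proof -
  from k obtain F d where F: "0 < d" "F holomorphic_on ball 0 d" "F 0 = 0"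
    "\<And>e. e > 0 \<Longrightarrow> \<forall>\<^sub>F w in nhds 0. k (g z) + Re (F w) - e * (cmod w)\<^sup>2 \<le> k (g z + w)"
    unfolding sub_at_def by blast
  define G where "G w = g (z + w) - g z" for w
  obtain r0 where r0: "r0 > 0" "ball z r0 \<subseteq> S" using g open_contains_ball by blast
  have holG0: "G holomorphic_on ball 0 r0"
  proof -
    have "g holomorphic_on (\<lambda>w. z + w) ` ball 0 r0"
      using g r0 by (simp add: image_add_ball) (meson holomorphic_on_subset)
    then have "(g \<circ> (\<lambda>w. z + w)) holomorphic_on ball 0 r0"
      by (intro holomorphic_on_compose holomorphic_intros)
    then show ?thesis unfolding G_def by (intro holomorphic_intros) (simp add: o_def)
  qed
  have contG: "isCont G 0"
    using holG0 r0 by (metis centre_in_ball continuous_on_eq_continuous_at holomorphic_on_imp_continuous_on open_ball)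
  have "G 0 = 0" by (simp add: G_def)
  have "(G has_field_derivative deriv G 0) (at 0)"
    using holG0 r0 by (simp add: holomorphic_derivI)
  then have "((\<lambda>w. G w / w) \<longlongrightarrow> deriv G 0) (at 0)"
    using \<open>G 0 = 0\<close> by (simp add: has_field_derivative_iff)
  then have "((\<lambda>w. cmod (G w / w)) \<longlongrightarrow> cmod (deriv G 0)) (at 0)" by (rule tendsto_norm)
  then have "\<forall>\<^sub>F w in at 0. cmod (G w / w) < cmod (deriv G 0) + 1"
    by (rule order_tendstoD) simp
  then have bnd: "\<forall>\<^sub>F w in nhds 0. cmod (G w) \<le> (cmod (deriv G 0) + 1) * cmod w"
    unfolding eventually_at_filter
    by eventually_elim (use \<open>G 0 = 0\<close> in \<open>auto simp: norm_divide field_simps split: if_splits\<close>)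
  have limG: "filterlim G (nhds 0) (nhds 0)"
    using contG \<open>G 0 = 0\<close> unfolding isCont_def by (metis tendsto_at_iff_tendsto_nhds)
  have "\<forall>\<^sub>F w in nhds 0. cmod (G w) < d"
    using order_tendstoD(2)[OF tendsto_norm[OF limG], of d] F(1) by simp
  then obtain r1 where r1: "r1 > 0" "\<And>w. cmod w < r1 \<Longrightarrow> cmod (G w) < d"
    by (auto simp: eventually_nhds_metric dist_norm)
  define r where "r = min r0 r1"
  have r: "r > 0" "r \<le> r0" "r \<le> r1" using r0 r1 by (auto simp: r_def)
  show ?thesis
  proof (rule sub_atI[of r "F \<circ> G"])
    show "F \<circ> G holomorphic_on ball 0 r"
      using holG0 F(2) r r1(2)
      by (intro holomorphic_on_compose_gen[of G _ F "ball 0 d"]) (auto elim!: holomorphic_on_subset)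
    show "(F \<circ> G) 0 = 0" using F \<open>G 0 = 0\<close> by simp
    fix e :: real assume "e > 0"
    define M where "M = cmod (deriv G 0) + 1"
    have M: "M > 0" by (simp add: M_def add_nonneg_pos)
    have "e / M\<^sup>2 > 0" using \<open>e > 0\<close> M by simp
    from F(4)[OF this] have "\<forall>\<^sub>F w in nhds 0. k (g z) + Re (F (G w)) - e / M\<^sup>2 * (cmod (G w))\<^sup>2 \<le> k (g z + G w)"
      using eventually_compose_filterlim[OF _ limG] by blast
    with bnd show "\<forall>\<^sub>F w in nhds 0. k (g z) + Re ((F \<circ> G) w) - e * (cmod w)\<^sup>2 \<le> k (g (z + w))"
    proof eventually_elim
      case (elim w)
      have "(cmod (G w))\<^sup>2 \<le> (M * cmod w)\<^sup>2"
        using elim(1) unfolding M_def by (intro power_mono) auto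
      then have "e / M\<^sup>2 * (cmod (G w))\<^sup>2 \<le> e / M\<^sup>2 * (M * cmod w)\<^sup>2"
        using \<open>e > 0\<close> by (intro mult_left_mono) auto
      also have "\<dots> = e * (cmod w)\<^sup>2" using M by (simp add: power_mult_distrib)
      finally show ?case using elim(2) by (simp add: G_def)
    qed
  qed (use r in auto)
qed

text \<open>A quadratic drop beats the error \<open>o(|w|^2)\<close>, so the holomorphic minorant
  itself would drop quadratically.\<close>

lemma sub_at_no_strict_max:
  assumes "sub_at u z" "0 < k" "\<forall>\<^sub>F w in nhds 0. u (z + w) + k * (cmod w)\<^sup>2 \<le> u z"
  shows False
proof -
  from assms(1) obtain F d where F: "0 < d" "F holomorphic_on ball 0 d" "F 0 = 0"
    "\<And>e. e > 0 \<Longrightarrow> \<forall>\<^sub>F w in nhds 0. u z + Re (F w) - e * (cmod w)\<^sup>2 \<le> u (z + w)"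
    unfolding sub_at_def by blast
  have "k / 2 > 0" using assms by simp
  from F(4)[OF this] assms(3) have "\<forall>\<^sub>F w in nhds 0. Re (F w) \<le> - (k/2) * (cmod w)\<^sup>2"
    by eventually_elim (simp add: field_simps)
  with holomorphic_not_below_cone[OF F(1-3) \<open>k/2 > 0\<close>] show False by blast
qed

text \<open>The two squares have the same Laplacian, so their difference is harmonic; it moves the
  centre of a quadratic term without cost.\<close>

lemma sub_at_cmod_sq:
  shows "sub_at (\<lambda>x. (cmod (x - a))\<^sup>2 - (cmod (x - b))\<^sup>2) z"
proof -
  have "(\<lambda>x. (cmod (x - a))\<^sup>2 - (cmod (x - b))\<^sup>2) =
     (\<lambda>x. Re (2 * cnj (b - a) * x + of_real ((cmod a)\<^sup>2 - (cmod b)\<^sup>2)))"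
    by (rule ext) (simp only: cmod_power2, simp add: algebra_simps power2_eq_square)
  moreover have "sub_at (\<lambda>x. Re (2 * cnj (b - a) * x + of_real ((cmod a)\<^sup>2 - (cmod b)\<^sup>2))) z"
    by (rule sub_at_Re[of _ UNIV]) (auto intro!: holomorphic_intros)
  ultimately show ?thesis by simp
qed

section \<open>Trigonometric polynomials on the unit circle\<close>

text \<open>\<open>Re x * Re y\<close> is half of \<open>Re (x * y) + Re (x * cnj y)\<close>. On the
  circle \<open>cnj z\<close> is the inverse of \<open>z\<close>, so the second product is again a
  monomial; the case split conjugates the factor with the smaller exponent.\<close>

lemma harmonic_poly_circle_mult:
  fixes a b :: complex
  shows "\<exists>c d k l. \<forall>z. cmod z = 1 \<longrightarrow> Re (a * z ^ i) * Re (b * z ^ j) = Re (c * z ^ k) + Re (d * z ^ l)"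
proof -
  have *: "Re x * Re y = Re (x * y / 2) + Re (x * cnj y / 2)" for x y :: complex
    by (simp add: field_simps)
  have inv: "cnj z * z = 1" if "cmod z = 1" for z
    using that by (metis complex_norm_square mult.commute of_real_1 power_one)
  show ?thesis
  proof (cases "j \<le> i")
    case True
    have "Re (a * z ^ i) * Re (b * z ^ j) = Re (a * b / 2 * z ^ (i + j)) + Re (a * cnj b / 2 * z ^ (i - j))"
      if "cmod z = 1" for z
    proof -
      have "z ^ i * cnj z ^ j = z ^ (i - j) * (cnj z * z) ^ j"
        using True by (simp add: power_mult_distrib mult.commute mult.left_commute flip: power_add)
      then have e: "z ^ i * cnj z ^ j = z ^ (i - j)" using inv[OF that] by simp
      have "a * z ^ i * cnj (b * z ^ j) / 2 = a * cnj b / 2 * (z ^ i * cnj z ^ j)" by simp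
      moreover have "a * z ^ i * (b * z ^ j) / 2 = a * b / 2 * z ^ (i + j)" by (simp add: power_add)
      ultimately show ?thesis by (simp only: * e)
    qed
    then show ?thesis by blast
  next
    case False
    have "Re (a * z ^ i) * Re (b * z ^ j) = Re (a * b / 2 * z ^ (i + j)) + Re (b * cnj a / 2 * z ^ (j - i))"
      if "cmod z = 1" for z
    proof -
      have "z ^ j * cnj z ^ i = z ^ (j - i) * (cnj z * z) ^ i"
        using False by (simp add: power_mult_distrib mult.commute mult.left_commute flip: power_add)
      then have e: "z ^ j * cnj z ^ i = z ^ (j - i)" using inv[OF that] by simp
      have "b * z ^ j * cnj (a * z ^ i) / 2 = b * cnj a / 2 * (z ^ j * cnj z ^ i)" by simp
      moreover have "b * z ^ j * (a * z ^ i) / 2 = a * b / 2 * z ^ (i + j)" by (simp add: power_add)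
      moreover have "Re (a * z ^ i) * Re (b * z ^ j) = Re (b * z ^ j) * Re (a * z ^ i)" by (rule mult.commute)
      ultimately show ?thesis by (simp only: * e)
    qed
    then show ?thesis by blast
  qed
qed

text \<open>Real parts of holomorphic polynomials. They are harmonic on the plane, and their
  restrictions to the unit circle are the real trigonometric polynomials; products can be matched on
  the circle only.\<close>

inductive trig_poly :: "(complex \<Rightarrow> real) \<Rightarrow> bool" where
  monom: "trig_poly (\<lambda>z. Re (a * z ^ i))"
| add: "trig_poly u \<Longrightarrow> trig_poly v \<Longrightarrow> trig_poly (\<lambda>z. u z + v z)"

lemma trig_poly_Re_entire: "trig_poly u \<Longrightarrow> \<exists>q. q holomorphic_on UNIV \<and> (\<forall>z. u z = Re (q z))"
proof (induction rule: trig_poly.induct)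
  case (monom a i)
  show ?case by (rule exI[of _ "\<lambda>z. a * z ^ i"]) (auto intro!: holomorphic_intros)
next
  case (add u v)
  then obtain p q where "p holomorphic_on UNIV" "\<forall>z. u z = Re (p z)"
    "q holomorphic_on UNIV" "\<forall>z. v z = Re (q z)" by blast
  then show ?case by (intro exI[of _ "\<lambda>z. p z + q z"]) (auto intro!: holomorphic_intros)
qed

lemma trig_poly_mult:
  assumes "trig_poly u" "trig_poly v"
  shows "\<exists>t. trig_poly t \<and> (\<forall>z. cmod z = 1 \<longrightarrow> u z * v z = t z)"
  using assms
proof (induction rule: trig_poly.induct)
  case (monom a i)
  show ?case using \<open>trig_poly v\<close>
  proof (induction rule: trig_poly.induct)
    case (monom b j)
    obtain c d k l where e: "\<forall>z. cmod z = 1 \<longrightarrow> Re (a * z ^ i) * Re (b * z ^ j) = Re (c * z ^ k) + Re (d * z ^ l)"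
      using harmonic_poly_circle_mult by meson
    have "trig_poly (\<lambda>z. Re (c * z ^ k) + Re (d * z ^ l))" by (intro trig_poly.intros)
    with e show ?case by blast
  next
    case (add v1 v2)
    then obtain t1 t2 where t: "trig_poly t1" "\<forall>z. cmod z = 1 \<longrightarrow> Re (a * z ^ i) * v1 z = t1 z"
      "trig_poly t2" "\<forall>z. cmod z = 1 \<longrightarrow> Re (a * z ^ i) * v2 z = t2 z" by blast
    have "trig_poly (\<lambda>z. t1 z + t2 z)" using t by (intro trig_poly.intros)
    moreover have "\<forall>z. cmod z = 1 \<longrightarrow> Re (a * z ^ i) * (v1 z + v2 z) = t1 z + t2 z"
      using t by (simp add: distrib_left)
    ultimately show ?case by (intro exI conjI)
  qed
next
  case (add u1 u2)
  then obtain t1 t2 where t: "trig_poly t1" "\<forall>z. cmod z = 1 \<longrightarrow> u1 z * v z = t1 z"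
      "trig_poly t2" "\<forall>z. cmod z = 1 \<longrightarrow> u2 z * v z = t2 z" by blast
  have "trig_poly (\<lambda>z. t1 z + t2 z)" using t by (intro trig_poly.intros)
  moreover have "\<forall>z. cmod z = 1 \<longrightarrow> (u1 z + u2 z) * v z = t1 z + t2 z"
    using t by (simp add: distrib_right)
  ultimately show ?case by (intro exI conjI)
qed

lemma real_polynomial_trig_poly:
  fixes p :: "complex \<Rightarrow> real"
  assumes "real_polynomial_function p"
  shows "\<exists>t. trig_poly t \<and> (\<forall>z. cmod z = 1 \<longrightarrow> p z = t z)"
  using assms
proof (induction rule: real_polynomial_function.induct)
  case (linear f)
  then interpret bounded_linear f .
  \<comment> \<open>A real linear form is the real part of a complex linear one, with coefficient
    \<open>f 1 - \<i> * f \<i>\<close>.\<close>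
  have "f z = Re (Complex (f 1) (- f \<i>) * z ^ 1)" for z
  proof -
    have "z = Re z *\<^sub>R 1 + Im z *\<^sub>R \<i>" by (simp add: complex_eq_iff)
    then have "f z = Re z * f 1 + Im z * f \<i>" by (metis add scaleR real_scaleR_def)
    then show ?thesis by simp
  qed
  then have "f = (\<lambda>z. Re (Complex (f 1) (- f \<i>) * z ^ 1))" by (rule ext)
  then have "trig_poly f" using trig_poly.monom[of "Complex (f 1) (- f \<i>)" 1] by simp
  then show ?case by blast
next
  case (const c)
  have "trig_poly (\<lambda>z. c)" using trig_poly.monom[of "of_real c" 0] by simp
  then show ?case by blast
next
  case (add f g)
  then obtain t1 t2 where t: "trig_poly t1" "\<forall>z. cmod z = 1 \<longrightarrow> f z = t1 z"
      "trig_poly t2" "\<forall>z. cmod z = 1 \<longrightarrow> g z = t2 z" by blast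
  have "trig_poly (\<lambda>z. t1 z + t2 z)" using t by (intro trig_poly.intros)
  with t show ?case by (intro exI[of _ "\<lambda>z. t1 z + t2 z"]) auto
next
  case (mult f g)
  then obtain t1 t2 where t: "trig_poly t1" "\<forall>z. cmod z = 1 \<longrightarrow> f z = t1 z"
      "trig_poly t2" "\<forall>z. cmod z = 1 \<longrightarrow> g z = t2 z" by blast
  obtain t3 where "trig_poly t3" "\<forall>z. cmod z = 1 \<longrightarrow> t1 z * t2 z = t3 z"
    using trig_poly_mult t by blast
  with t show ?case by (intro exI[of _ t3]) auto
qed

text \<open>The real part of \<open>q\<close> is an approximate solution of the Dirichlet problem
  with boundary values \<open>u\<close>.\<close>

lemma continuous_circle_approx:
  fixes u :: "complex \<Rightarrow> real"
  assumes "continuous_on (sphere 0 1) u" "0 < e"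
  obtains q where "q holomorphic_on UNIV" "\<And>z. cmod z = 1 \<Longrightarrow> \<bar>u z - Re (q z)\<bar> < e"
proof -
  obtain p where p: "real_polynomial_function p" "\<And>z. z \<in> sphere 0 1 \<Longrightarrow> \<bar>u z - p z\<bar> < e"
    using Stone_Weierstrass_real_polynomial_function[of "sphere 0 1" u e] assms by auto
  obtain t where t: "trig_poly t" "\<forall>z. cmod z = 1 \<longrightarrow> p z = t z"
    using real_polynomial_trig_poly[OF p(1)] by blast
  obtain q where "q holomorphic_on UNIV" "\<forall>z. t z = Re (q z)"
    using trig_poly_Re_entire[OF t(1)] by blast
  with that p t show thesis by auto
qed

section \<open>Maximum principle and Harnack inequality\<close>

text \<open>With \<open>e\<close> half of the supposed excess over \<open>B\<close>, the
  perturbation \<open>u + e * |x|^2\<close> still exceeds its boundary values somewhere inside, so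
  its maximum is interior; there \<open>u\<close>, up to a harmonic term, has a quadratically strict
  maximum.\<close>

lemma sub_max_principle:
  assumes cont: "continuous_on (cball 0 1) u"
    and sub: "\<And>z. cmod z < 1 \<Longrightarrow> sub_at u z"
    and bd: "\<And>z. cmod z = 1 \<Longrightarrow> u z \<le> B"
    and z: "cmod z \<le> 1"
  shows "u z \<le> B"
proof (rule ccontr)
  assume "\<not> u z \<le> B"
  then have gt: "u z > B" by simp
  define e where "e = (u z - B) / 2"
  have e: "e > 0" using gt by (simp add: e_def)
  define v where "v x = u x + e * (cmod x)\<^sup>2" for x
  have "continuous_on (cball 0 1) v" unfolding v_def by (intro continuous_intros cont)
  then obtain x where x: "x \<in> cball 0 1" "\<And>y. y \<in> cball 0 1 \<Longrightarrow> v y \<le> v x"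
    using continuous_attains_sup[of "cball (0::complex) 1" v] by auto
  have "u z \<le> v z" using e by (simp add: v_def)
  also have "v z \<le> v x" using x z by simp
  finally have uz: "u z \<le> v x" .
  show False
  proof (cases "cmod x = 1")
    case True
    then have "v x \<le> B + e" using bd by (simp add: v_def)
    then show False using uz e gt by (simp add: e_def field_simps)
  next
    case False
    then have x1: "cmod x < 1" using x by simp
    have "\<forall>\<^sub>F w in nhds 0. cmod w < 1 - cmod x"
      unfolding eventually_nhds_metric using x1 by (intro exI[of _ "1 - cmod x"]) (auto simp: dist_norm)
    then have ev: "\<forall>\<^sub>F w in nhds 0. v (x + w) \<le> v x"
    proof eventually_elim
      case (elim w)
      have "cmod (x + w) \<le> 1" using norm_triangle_ineq[of x w] elim by linarith
      then show ?case using x by simp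
    qed
    \<comment> \<open>\<open>U\<close> is \<open>v\<close> minus \<open>e * |y - x|^2\<close>, which
      makes the maximum at \<open>x\<close> strict, and it differs from \<open>u\<close> by a
      harmonic function.\<close>
    define U where "U y = u y + e * ((cmod (y - 0))\<^sup>2 - (cmod (y - x))\<^sup>2)" for y
    have "sub_at U x"
      unfolding U_def using sub[OF x1] e
      by (intro sub_at_add sub_at_cmult sub_at_cmod_sq) auto
    moreover have "\<forall>\<^sub>F w in nhds 0. U (x + w) + e * (cmod w)\<^sup>2 \<le> U x"
      using ev by eventually_elim (simp add: U_def v_def algebra_simps)
    ultimately show False using sub_at_no_strict_max e by blast
  qed
qed

lemma cayley_norm_less_one:
  fixes x :: complex
  assumes "0 < a" "Re x > 0"
  shows "cmod ((x - of_real a) / (x + of_real a)) < 1"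
proof -
  have "(cmod (x - of_real a))\<^sup>2 < (cmod (x + of_real a))\<^sup>2"
    using assms by (simp only: cmod_power2) (simp add: power2_eq_square algebra_simps)
  then have "cmod (x - of_real a) < cmod (x + of_real a)"
    by (rule power2_less_imp_less) simp
  then show ?thesis by (simp add: norm_divide divide_less_eq)
qed

text \<open>The Cayley transform based at \<open>f 0\<close> reduces the claim to the Schwarz lemma:
  \<open>|f - a| \<le> r * |f + a|\<close>, which is solved for \<open>|f|\<close>. The modulus, not
  merely the real part, is bounded because the coordinate \<open>z\<^sub>0\<close> needs it
  later.\<close>

lemma harnack_norm:
  assumes f: "f holomorphic_on ball 0 1" and pos: "\<And>z. cmod z < 1 \<Longrightarrow> Re (f z) > 0"
    and z: "cmod z \<le> r" "r < 1" and im: "Im (f 0) = 0"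
  shows "cmod (f z) \<le> (1 + r) / (1 - r) * Re (f 0)"
proof -
  define a where "a = Re (f 0)"
  have a: "a > 0" "f 0 = of_real a" using pos[of 0] im by (auto simp: a_def complex_eq_iff)
  define g where "g w = (f w - of_real a) / (f w + of_real a)" for w
  have nz: "f w + of_real a \<noteq> 0" if "cmod w < 1" for w
    using pos[OF that] a by (metis add_pos_pos Re_complex_of_real plus_complex.sel(1) zero_complex.sel(1) less_irrefl)
  have "g holomorphic_on ball 0 1" unfolding g_def using nz by (intro holomorphic_intros f) auto
  moreover have "g 0 = 0" by (simp add: g_def a)
  moreover have "cmod (g w) < 1" if "cmod w < 1" for w
    unfolding g_def using cayley_norm_less_one[OF a(1) pos[OF that]] .
  moreover have zz: "cmod z < 1" using z by simp
  ultimately have "cmod (g z) \<le> cmod z" by (rule Schwarz_Lemma(1))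
  then have gz: "cmod (g z) \<le> r" using z by simp
  have "cmod (f z - of_real a) \<le> r * cmod (f z + of_real a)"
    using gz nz[OF zz] by (simp add: g_def norm_divide divide_le_eq)
  also have "cmod (f z + of_real a) \<le> cmod (f z) + a"
    using norm_triangle_ineq[of "f z" "of_real a"] a by simp
  moreover have "r \<ge> 0" using z(1) norm_ge_zero[of z] by linarith
  ultimately have "cmod (f z - of_real a) \<le> r * (cmod (f z) + a)"
    by (meson mult_left_mono order_trans)
  moreover have "cmod (f z) - a \<le> cmod (f z - of_real a)"
    using norm_triangle_ineq2[of "f z" "of_real a"] a by simp
  ultimately have "cmod (f z) * (1 - r) \<le> (1 + r) * a" by (simp add: algebra_simps)
  then show ?thesis using z by (simp add: a_def field_simps)
qed

lemma harnack_norm_ball: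
  assumes f: "f holomorphic_on ball 0 R" and pos: "\<And>z. cmod z < R \<Longrightarrow> Re (f z) > 0"
    and z: "cmod z \<le> r * R" "r < 1" "R > 0" and im: "Im (f 0) = 0"
  shows "cmod (f z) \<le> (1 + r) / (1 - r) * Re (f 0)"
proof -
  have "cmod (f (of_real R * (z / of_real R))) \<le> (1 + r) / (1 - r) * Re (f (of_real R * 0))"
  proof (rule harnack_norm[where f = "\<lambda>w. f (of_real R * w)"])
    have "(\<lambda>w. complex_of_real R * w) ` ball 0 1 \<subseteq> ball 0 R" using z by (auto simp: norm_mult dist_norm)
    then show "(\<lambda>w. f (of_real R * w)) holomorphic_on ball 0 1"
      using holomorphic_on_compose_gen[of "\<lambda>w. of_real R * w" "ball 0 1" f "ball 0 R"] f
      by (auto simp: o_def intro!: holomorphic_intros)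
    show "Re (f (of_real R * w)) > 0" if "cmod w < 1" for w
      using that z by (intro pos) (simp add: norm_mult)
  qed (use z im in \<open>auto simp: norm_divide divide_le_eq\<close>)
  then show ?thesis using z by simp
qed

text \<open>A Stone--Weierstrass approximation of \<open>w\<close> on the circle by the real part of an entire function
  takes the place of the Poisson integral; the additive constants absorb its error.\<close>

lemma sub_harnack:
  assumes w: "continuous_on (cball 0 1) w" "\<And>z. cmod z < 1 \<Longrightarrow> sub_at w z" "\<And>z. cmod z \<le> 1 \<Longrightarrow> 0 \<le> w z"
    and S: "continuous_on (cball 0 1) S" "\<And>z. cmod z < 1 \<Longrightarrow> sub_at (\<lambda>x. - S x) z"
    and le: "\<And>z. cmod z \<le> 1 \<Longrightarrow> w z \<le> S z"
    and z: "cmod z \<le> r" "r < 1"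
  shows "w z \<le> (1 + r) / (1 - r) * (S 0 + 3) + 1"
proof -
  have "continuous_on (sphere 0 1) w" using w(1) by (rule continuous_on_subset) auto
  then obtain q where q: "q holomorphic_on UNIV" "\<And>z. cmod z = 1 \<Longrightarrow> \<bar>w z - Re (q z)\<bar> < 1"
    using continuous_circle_approx[of w 1] by auto
  have contq: "continuous_on A q" for A
    using q(1) by (meson holomorphic_on_imp_continuous_on continuous_on_subset subset_UNIV)
  have 1: "w x - Re (q x) \<le> 1" if "cmod x \<le> 1" for x
  proof (rule sub_max_principle[where u = "\<lambda>x. w x - Re (q x)"])
    show "continuous_on (cball 0 1) (\<lambda>x. w x - Re (q x))" by (intro continuous_intros w contq)
    show "sub_at (\<lambda>x. w x - Re (q x)) x" if "cmod x < 1" for x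
      using sub_at_add[OF w(2)[OF that] sub_at_minus_Re[OF q(1), of x]] by simp
    show "w x - Re (q x) \<le> 1" if "cmod x = 1" for x using q(2)[OF that] by linarith
  qed (rule that)
  have 2: "- Re (q x) \<le> 1" if "cmod x \<le> 1" for x
  proof (rule sub_max_principle[where u = "\<lambda>x. - Re (q x)"])
    show "continuous_on (cball 0 1) (\<lambda>x. - Re (q x))" by (intro continuous_intros contq)
    show "sub_at (\<lambda>x. - Re (q x)) x" for x
      using sub_at_minus_Re[OF q(1), of x] by simp
    show "- Re (q x) \<le> 1" if "cmod x = 1" for x using q(2)[OF that] w(3)[of x] that by linarith
  qed (rule that)
  have 3: "Re (q x) + - S x \<le> 1" if "cmod x \<le> 1" for x
  proof (rule sub_max_principle[where u = "\<lambda>x. Re (q x) + - S x"])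
    show "continuous_on (cball 0 1) (\<lambda>x. Re (q x) + - S x)" by (intro continuous_intros S contq)
    show "sub_at (\<lambda>x. Re (q x) + - S x) x" if "cmod x < 1" for x
      using sub_at_add[OF sub_at_Re[OF q(1), of x] S(2)[OF that]] by simp
    show "Re (q x) + - S x \<le> 1" if "cmod x = 1" for x using q(2)[OF that] le[of x] that by linarith
  qed (rule that)
  \<comment> \<open>By the bounds \<open>2\<close> and \<open>3\<close> the shift by 2 yields real
    part at least 1 and \<open>Re (f 0) \<le> S 0 + 3\<close>; removing \<open>Im (q 0)\<close>
    makes \<open>f 0\<close> real.\<close>
  define f where "f x = q x + (2 - \<i> * of_real (Im (q 0)))" for x
  have "cmod (f z) \<le> (1 + r) / (1 - r) * Re (f 0)"
  proof (rule harnack_norm[OF _ _ z])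
    show "f holomorphic_on ball 0 1" unfolding f_def
      using q(1) by (intro holomorphic_intros) (auto elim: holomorphic_on_subset)
    show "Re (f x) > 0" if "cmod x < 1" for x using 2[of x] that by (simp add: f_def)
    show "Im (f 0) = 0" by (simp add: f_def)
  qed
  moreover have "Re (f 0) \<le> S 0 + 3" using 3[of 0] by (simp add: f_def)
  moreover have "(1 + r) / (1 - r) \<ge> 0" using z norm_ge_zero[of z] by (intro divide_nonneg_nonneg) linarith+
  ultimately have "cmod (f z) \<le> (1 + r) / (1 - r) * (S 0 + 3)"
    by (meson mult_left_mono order_trans)
  moreover have "w z \<le> Re (q z) + 1" using 1[of z] z by linarith
  moreover have "Re (q z) \<le> Re (f z)" by (simp add: f_def)
  moreover have "Re (f z) \<le> cmod (f z)" by (rule complex_Re_le_cmod)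
  ultimately show ?thesis by linarith
qed

section \<open>Polynomials in a complex variable and its conjugate\<close>

text \<open>Coefficients are plain functions on a square of exponents rather than finitely supported
  maps: the product topology then makes families of coefficients compact, and the square is
  preserved by recentring.\<close>

definition pev :: "nat \<Rightarrow> (nat \<times> nat \<Rightarrow> complex) \<Rightarrow> complex \<Rightarrow> complex" where
  "pev N c z = (\<Sum>j\<le>N. \<Sum>k\<le>N. c (j, k) * z ^ j * cnj z ^ k)"

text \<open>The Taylor coefficients at \<open>p\<close>. Truncated subtraction in the exponents is
  harmless, as the binomial coefficient is 0 whenever it would occur.\<close>

definition shift :: "nat \<Rightarrow> complex \<Rightarrow> (nat \<times> nat \<Rightarrow> complex) \<Rightarrow> nat \<times> nat \<Rightarrow> complex" where
  "shift N p c = (\<lambda>(a, b). \<Sum>j\<le>N. \<Sum>k\<le>N. c (j, k) * of_nat (j choose a) * of_nat (k choose b)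
      * p ^ (j - a) * cnj p ^ (k - b))"

text \<open>The derivative \<open>\<partial>\<partial>\<bar>\<close> of \<open>Re (pev N c)\<close>, a quarter of its Laplacian.\<close>

definition levi :: "nat \<Rightarrow> (nat \<times> nat \<Rightarrow> complex) \<Rightarrow> complex \<Rightarrow> real" where
  "levi N c z = Re (shift N z c (1, 1))"

lemma power_add_atMost:
  fixes p w :: complex
  assumes "j \<le> N"
  shows "(p + w) ^ j = (\<Sum>a\<le>N. of_nat (j choose a) * p ^ (j - a) * w ^ a)"
proof -
  have "(p + w) ^ j = (\<Sum>a\<le>j. of_nat (j choose a) * w ^ a * p ^ (j - a))"
    by (metis add.commute binomial_ring)
  also have "\<dots> = (\<Sum>a\<le>N. of_nat (j choose a) * w ^ a * p ^ (j - a))"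
    by (rule sum.mono_neutral_left) (use assms in auto)
  finally show ?thesis by (simp add: mult_ac)
qed

lemma pev_shift: "pev N c (p + w) = pev N (shift N p c) w"
proof -
  define T where "T j k a b = c (j, k) * of_nat (j choose a) * of_nat (k choose b)
      * p ^ (j - a) * cnj p ^ (k - b) * w ^ a * cnj w ^ b" for j k a b
  have "pev N c (p + w) = (\<Sum>j\<le>N. \<Sum>k\<le>N. \<Sum>a\<le>N. \<Sum>b\<le>N. T j k a b)"
    unfolding pev_def
  proof (intro sum.cong refl)
    fix j k assume jk: "j \<in> {..N}" "k \<in> {..N}"
    have "c (j, k) * (p + w) ^ j * cnj (p + w) ^ k = c (j, k) * ((\<Sum>a\<le>N. of_nat (j choose a) * p ^ (j - a) * w ^ a)
       * (\<Sum>b\<le>N. of_nat (k choose b) * cnj p ^ (k - b) * cnj w ^ b))"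
      using jk by (simp add: power_add_atMost[of j N] power_add_atMost[of k N])
    also have "\<dots> = (\<Sum>a\<le>N. \<Sum>b\<le>N. T j k a b)"
      unfolding sum_product unfolding sum_distrib_left T_def by (intro sum.cong refl) (simp add: mult_ac)
    finally show "c (j, k) * (p + w) ^ j * cnj (p + w) ^ k = (\<Sum>a\<le>N. \<Sum>b\<le>N. T j k a b)" .
  qed
  also have "\<dots> = (\<Sum>j\<le>N. \<Sum>a\<le>N. \<Sum>k\<le>N. \<Sum>b\<le>N. T j k a b)"
    by (intro sum.cong refl sum.swap)
  also have "\<dots> = (\<Sum>a\<le>N. \<Sum>j\<le>N. \<Sum>k\<le>N. \<Sum>b\<le>N. T j k a b)"
    by (rule sum.swap)
  also have "\<dots> = (\<Sum>a\<le>N. \<Sum>j\<le>N. \<Sum>b\<le>N. \<Sum>k\<le>N. T j k a b)"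
    by (intro sum.cong refl sum.swap)
  also have "\<dots> = (\<Sum>a\<le>N. \<Sum>b\<le>N. \<Sum>j\<le>N. \<Sum>k\<le>N. T j k a b)"
    by (intro sum.cong refl sum.swap)
  also have "\<dots> = pev N (shift N p c) w"
    unfolding pev_def shift_def T_def by (simp add: sum_distrib_right)
  finally show ?thesis .
qed

text \<open>On the circle \<open>|z| = t\<close> one has \<open>cnj z = t\<^sup>2 / z\<close>, so that \<open>z\<^sup>N\<close> times the sum is a polynomial in \<open>z\<close>,
  whose coefficients are in turn polynomials in \<open>t\<close>.\<close>

lemma pev_eq_0_imp:
  assumes z: "\<And>z. cmod z \<le> 1 \<Longrightarrow> pev N c z = 0" and jk: "j0 \<le> N" "k0 \<le> N"
  shows "c (j0, k0) = 0"
proof -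
  \<comment> \<open>The exponent of \<open>z\<close> that \<open>(j0, k0)\<close> acquires once
    \<open>cnj z\<close> is eliminated; it selects the diagonal
    \<open>j - k = j0 - k0\<close>.\<close>
  define i where "i = N + j0 - k0"
  have *: "(\<Sum>j\<le>N. \<Sum>k\<le>N. if N + j - k = i then c (j, k) * of_real t ^ (2 * k) else 0) = 0"
    if t: "0 < t" "t \<le> 1" for t
  proof -
    define R where "R = (\<Sum>j\<le>N. \<Sum>k\<le>N. monom (c (j, k) * of_real t ^ (2 * k)) (N + j - k))"
    have "poly R x = 0" if x: "cmod x = t" for x
    proof -
      have xx: "x * cnj x = of_real t ^ 2" using x by (simp add: complex_norm_square[symmetric])
      have "poly R x = (\<Sum>j\<le>N. \<Sum>k\<le>N. x ^ N * (c (j, k) * x ^ j * cnj x ^ k))"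
        unfolding R_def poly_sum poly_monom
      proof (intro sum.cong refl)
        fix j k assume "j \<in> {..N}" "k \<in> {..N}"
        then have e: "x ^ N * x ^ j = x ^ (N + j - k) * x ^ k" by (simp flip: power_add)
        have "x ^ N * (c (j, k) * x ^ j * cnj x ^ k) = c (j, k) * (x ^ N * x ^ j) * cnj x ^ k" by (simp add: mult_ac)
        also have "\<dots> = c (j, k) * x ^ (N + j - k) * (x * cnj x) ^ k" unfolding e by (simp add: power_mult_distrib mult_ac)
        finally have "x ^ N * (c (j, k) * x ^ j * cnj x ^ k) = c (j, k) * x ^ (N + j - k) * (of_real t ^ 2) ^ k"
          unfolding xx .
        moreover have "(of_real t :: complex) ^ (2 * k) = (of_real t ^ 2) ^ k" by (rule power_mult)
        ultimately show "c (j, k) * of_real t ^ (2 * k) * x ^ (N + j - k) = x ^ N * (c (j, k) * x ^ j * cnj x ^ k)"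
          by (simp only: mult_ac)
      qed
      also have "\<dots> = x ^ N * pev N c x" unfolding pev_def by (simp add: sum_distrib_left)
      also have "\<dots> = 0" using z[of x] x t by simp
      finally show ?thesis .
    qed
    then have "sphere 0 t \<subseteq> {x. poly R x = 0}" by auto
    moreover have "infinite (sphere (0::complex) t)"
    proof -
      have "connected (sphere (0::complex) t)" by (rule connected_sphere) simp
      moreover have "of_real t \<in> sphere (0::complex) t" "- of_real t \<in> sphere (0::complex) t" using t by auto
      moreover have "of_real t \<noteq> (- of_real t :: complex)" using t by (simp add: complex_eq_iff)
      ultimately show ?thesis using connected_finite_iff_sing by (metis empty_iff singletonD)
    qed
    ultimately have "R = 0" using poly_roots_finite[of R] finite_subset by blast
    then have "coeff R i = 0" by simp
    then show ?thesis unfolding R_def coeff_sum coeff_monom .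
  qed
  \<comment> \<open>On that diagonal the exponent \<open>2 * k\<close> determines the pair, so the
    wanted coefficient is the one of \<open>S\<close> at \<open>2 * k0\<close>.\<close>
  define S where "S = (\<Sum>j\<le>N. \<Sum>k\<le>N. if N + j - k = i then monom (c (j, k)) (2 * k) else 0)"
  have "poly S (of_real t) = 0" if t: "0 < t" "t \<le> 1" for t
  proof -
    have "poly S (of_real t) = (\<Sum>j\<le>N. \<Sum>k\<le>N. if N + j - k = i then c (j, k) * of_real t ^ (2 * k) else 0)"
      unfolding S_def poly_sum by (intro sum.cong refl) (simp add: poly_monom)
    then show ?thesis using *[OF t] by simp
  qed
  then have "complex_of_real ` {0<..1} \<subseteq> {x. poly S x = 0}" by auto
  moreover have "infinite (complex_of_real ` {0<..1})"
    by (simp add: finite_image_iff inj_on_def)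
  ultimately have "S = 0" using poly_roots_finite[of S] finite_subset by blast
  then have "0 = coeff S (2 * k0)" by simp
  also have "\<dots> = (\<Sum>j\<le>N. \<Sum>k\<le>N. if N + j - k = i \<and> k = k0 then c (j, k) else 0)"
    unfolding S_def coeff_sum by (intro sum.cong refl) (auto simp: coeff_monom)
  also have "\<dots> = (\<Sum>j\<le>N. \<Sum>k\<le>N. if j = j0 then if k = k0 then c (j, k) else 0 else 0)"
    using jk by (intro sum.cong refl) (auto simp: i_def)
  also have "\<dots> = (\<Sum>j\<le>N. if j = j0 then c (j, k0) else 0)"
    using jk by (intro sum.cong refl) (simp add: sum.delta)
  also have "\<dots> = c (j0, k0)" using jk by (simp add: sum.delta)
  finally show ?thesis by simp
qed

lemma pev_diff: "pev N (\<lambda>x. c x - d x) z = pev N c z - pev N d z"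
  unfolding pev_def by (simp add: sum_subtractf algebra_simps)

lemma pev_cnj: "cnj (pev N c z) = pev N (\<lambda>(j, k). cnj (c (k, j))) z"
proof -
  have "cnj (pev N c z) = (\<Sum>j\<le>N. \<Sum>k\<le>N. cnj (c (j, k)) * cnj z ^ j * z ^ k)"
    unfolding pev_def by simp
  also have "\<dots> = (\<Sum>k\<le>N. \<Sum>j\<le>N. cnj (c (j, k)) * cnj z ^ j * z ^ k)" by (rule sum.swap)
  finally show ?thesis unfolding pev_def by (simp add: mult_ac)
qed

lemma pev_real_imp_hermitian:
  assumes "\<And>z. pev N c z \<in> \<real>" "j \<le> N" "k \<le> N"
  shows "c (k, j) = cnj (c (j, k))"
proof -
  have "pev N (\<lambda>x. c x - (case x of (j, k) \<Rightarrow> cnj (c (k, j)))) z = 0" for z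
    unfolding pev_diff pev_cnj[symmetric] using assms(1)[of z] by (simp add: Reals_cnj_iff)
  from pev_eq_0_imp[OF this assms(3,2)] show ?thesis by simp
qed

section \<open>Second-order expansion and the sign of the Laplacian\<close>

lemma pev_taylor0:
  assumes "2 \<le> N"
  obtains C where "C \<ge> 0" "\<And>w. cmod w \<le> 1 \<Longrightarrow>
    cmod (pev N c w - (c (0,0) + c (1,0) * w + c (0,1) * cnj w + c (2,0) * w\<^sup>2 + c (0,2) * (cnj w)\<^sup>2
       + c (1,1) * of_real ((cmod w)\<^sup>2))) \<le> C * cmod w ^ 3"
proof -
  define A :: "(nat \<times> nat) set" where "A = {(0,0),(1,0),(0,1),(2,0),(0,2),(1,1)}"
  define B where "B = ({..N} \<times> {..N}) - A"
  define C where "C = (\<Sum>x\<in>B. cmod (c x))"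
  have AB: "A \<subseteq> {..N} \<times> {..N}" using assms by (auto simp: A_def)
  have B3: "3 \<le> j + k" if "(j, k) \<in> B" for j k
  proof (rule ccontr)
    assume "\<not> 3 \<le> j + k"
    then have "j \<le> 2" "k \<le> 2" "j + k \<le> 2" by auto
    then have "j \<in> {0,1,2}" "k \<in> {0,1,2}" by auto
    then have "(j, k) \<in> A" using \<open>j + k \<le> 2\<close> by (auto simp: A_def)
    then show False using that by (simp add: B_def)
  qed
  show thesis
  proof (rule that[of C])
    show "C \<ge> 0" unfolding C_def by (intro sum_nonneg) auto
    fix w :: complex assume w: "cmod w \<le> 1"
    define f where "f = (\<lambda>(j, k). c (j, k) * w ^ j * cnj w ^ k)"
    have "pev N c w = sum f ({..N} \<times> {..N})"
      unfolding pev_def f_def by (simp add: sum.cartesian_product)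
    also have "\<dots> = sum f A + sum f B"
      unfolding B_def using AB by (subst sum.subset_diff[OF AB]) auto
    finally have e: "pev N c w = sum f A + sum f B" .
    have fA: "sum f A = c (0,0) + c (1,0) * w + c (0,1) * cnj w + c (2,0) * w\<^sup>2 + c (0,2) * (cnj w)\<^sup>2
       + c (1,1) * of_real ((cmod w)\<^sup>2)"
      unfolding A_def complex_norm_square by (simp add: f_def mult_ac power2_eq_square)
    have "cmod (sum f B) \<le> (\<Sum>x\<in>B. cmod (c x) * cmod w ^ 3)"
    proof (rule sum_norm_le, clarify)
      fix j k assume "(j, k) \<in> B"
      then have "3 \<le> j + k" by (rule B3)
      then have "cmod w ^ (j + k) \<le> cmod w ^ 3" using w by (intro power_decreasing) auto
      then show "cmod (f (j, k)) \<le> cmod (c (j, k)) * cmod w ^ 3"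
        by (simp add: f_def norm_mult norm_power mult_left_mono mult.assoc flip: power_add)
    qed
    also have "\<dots> = C * cmod w ^ 3" unfolding C_def by (simp add: sum_distrib_right)
    finally show "cmod (pev N c w - (c (0,0) + c (1,0) * w + c (0,1) * cnj w + c (2,0) * w\<^sup>2 + c (0,2) * (cnj w)\<^sup>2
       + c (1,1) * of_real ((cmod w)\<^sup>2))) \<le> C * cmod w ^ 3" unfolding e fA by simp
  qed
qed

text \<open>Twice the derivative \<open>\<partial>\<close> of \<open>Re (pev N c)\<close>.\<close>

definition pev_dz :: "nat \<Rightarrow> (nat \<times> nat \<Rightarrow> complex) \<Rightarrow> complex \<Rightarrow> complex" where
  "pev_dz N c z = shift N z c (1, 0) + cnj (shift N z c (0, 1))"

lemma shift_00: "shift N z c (0, 0) = pev N c z"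
  by (simp add: shift_def pev_def)

text \<open>Under the real part the powers of \<open>cnj w\<close> become holomorphic by
  conjugation, so up to second order the term with \<open>levi N c z\<close> is the only one that is
  not harmonic.\<close>

lemma pev_taylor:
  assumes "2 \<le> N"
  obtains \<beta> C where "C \<ge> 0" "\<And>w. cmod w \<le> 1 \<Longrightarrow>
    \<bar>Re (pev N c (z + w)) - (Re (pev N c z) + Re (pev_dz N c z * w + \<beta> * w\<^sup>2) + levi N c z * (cmod w)\<^sup>2)\<bar>
     \<le> C * cmod w ^ 3"
proof -
  let ?s = "shift N z c"
  obtain C where C: "C \<ge> 0" "\<And>w. cmod w \<le> 1 \<Longrightarrow>
    cmod (pev N ?s w - (?s (0,0) + ?s (1,0) * w + ?s (0,1) * cnj w + ?s (2,0) * w\<^sup>2 + ?s (0,2) * (cnj w)\<^sup>2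
       + ?s (1,1) * of_real ((cmod w)\<^sup>2))) \<le> C * cmod w ^ 3"
    using pev_taylor0[OF assms, of ?s] by blast
  show thesis
  proof (rule that[of C "?s (2,0) + cnj (?s (0,2))"])
    fix w :: complex assume w: "cmod w \<le> 1"
    let ?D = "pev N ?s w - (?s (0,0) + ?s (1,0) * w + ?s (0,1) * cnj w + ?s (2,0) * w\<^sup>2 + ?s (0,2) * (cnj w)\<^sup>2
       + ?s (1,1) * of_real ((cmod w)\<^sup>2))"
    have 1: "Re (a * cnj b) = Re (cnj a * b)" for a b by simp
    have 2: "Re (?s (0,2) * (cnj w)\<^sup>2) = Re (cnj (?s (0,2)) * w\<^sup>2)" using 1[of "?s (0,2)" "w\<^sup>2"] by simp
    have 3: "Re (a * of_real b) = Re a * b" for a b by simp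
    have 4: "Re (pev N c z) = Re (?s (0, 0))" by (simp add: shift_00)
    have "Re (pev N c (z + w)) - (Re (pev N c z) + Re (pev_dz N c z * w + (?s (2,0) + cnj (?s (0,2))) * w\<^sup>2) + levi N c z * (cmod w)\<^sup>2) = Re ?D"
      unfolding pev_shift levi_def pev_dz_def 4 distrib_right plus_complex.sel minus_complex.sel 2 1[of "?s (0,1)"] 3
      by linarith
    also have "\<bar>\<dots>\<bar> \<le> cmod ?D" by (rule abs_Re_le_cmod)
    finally show "\<bar>Re (pev N c (z + w)) - (Re (pev N c z) + Re (pev_dz N c z * w + (?s (2,0) + cnj (?s (0,2))) * w\<^sup>2) + levi N c z * (cmod w)\<^sup>2)\<bar> \<le> C * cmod w ^ 3"
      using C(2)[OF w] by linarith
  qed (rule C(1))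
qed

lemma pev_taylor_eventually:
  assumes "2 \<le> N"
  obtains \<beta> where "\<And>e. e > 0 \<Longrightarrow> \<forall>\<^sub>F w in nhds 0.
    \<bar>Re (pev N c (z + w)) - (Re (pev N c z) + Re (pev_dz N c z * w + \<beta> * w\<^sup>2) + levi N c z * (cmod w)\<^sup>2)\<bar>
     \<le> e * (cmod w)\<^sup>2"
proof -
  obtain \<beta> C where C: "C \<ge> 0" "\<And>w. cmod w \<le> 1 \<Longrightarrow>
    \<bar>Re (pev N c (z + w)) - (Re (pev N c z) + Re (pev_dz N c z * w + \<beta> * w\<^sup>2) + levi N c z * (cmod w)\<^sup>2)\<bar>
     \<le> C * cmod w ^ 3" by (rule pev_taylor[OF assms, where c=c and z=z]) (rule that)
  show thesis
  proof (rule that[of \<beta>])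
    fix e :: real assume e: "e > 0"
    have "min 1 (e / (C + 1)) > 0" using e C by simp
    then have "\<forall>\<^sub>F w::complex in nhds 0. cmod w < min 1 (e / (C + 1))"
      unfolding eventually_nhds_metric by (intro exI[of _ "min 1 (e / (C + 1))"]) (auto simp: dist_norm)
    then show "\<forall>\<^sub>F w in nhds 0.
    \<bar>Re (pev N c (z + w)) - (Re (pev N c z) + Re (pev_dz N c z * w + \<beta> * w\<^sup>2) + levi N c z * (cmod w)\<^sup>2)\<bar>
     \<le> e * (cmod w)\<^sup>2"
    proof eventually_elim
      case (elim w)
      have "C * cmod w \<le> (C + 1) * cmod w" by (simp add: mult_right_mono)
      also have "\<dots> \<le> e" using elim C by (simp add: field_simps)
      finally have "C * cmod w * (cmod w)\<^sup>2 \<le> e * (cmod w)\<^sup>2" by (rule mult_right_mono) simp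
      then show ?case using C(2)[of w] elim by (simp add: power2_eq_square power3_eq_cube mult_ac)
    qed
  qed
qed

text \<open>Up to second order everything is harmonic except the term in \<open>|w|^2\<close>, whose
  coefficient \<open>levi N c z - k\<close> is nonnegative. The freedom in \<open>a\<close> affects
  only the linear term in \<open>w\<close>.\<close>

lemma sub_at_pev_minus_sq:
  assumes "2 \<le> N" "k \<le> levi N c z"
  shows "sub_at (\<lambda>x. Re (pev N c x) - k * (cmod (x - a))\<^sup>2) z"
proof -
  obtain \<beta> where b: "\<And>e. e > 0 \<Longrightarrow> \<forall>\<^sub>F w in nhds 0.
    \<bar>Re (pev N c (z + w)) - (Re (pev N c z) + Re (pev_dz N c z * w + \<beta> * w\<^sup>2) + levi N c z * (cmod w)\<^sup>2)\<bar>
     \<le> e * (cmod w)\<^sup>2" by (rule pev_taylor_eventually[OF assms(1), where c=c and z=z]) (rule that)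
  show ?thesis
  proof (rule sub_atI[of 1 "\<lambda>w. pev_dz N c z * w + \<beta> * w\<^sup>2 - 2 * of_real k * cnj (z - a) * w"])
    fix e :: real assume "e > 0"
    from b[OF this]
    show "\<forall>\<^sub>F w in nhds 0. Re (pev N c z) - k * (cmod (z - a))\<^sup>2
       + Re (pev_dz N c z * w + \<beta> * w\<^sup>2 - 2 * of_real k * cnj (z - a) * w) - e * (cmod w)\<^sup>2
       \<le> Re (pev N c (z + w)) - k * (cmod (z + w - a))\<^sup>2"
    proof eventually_elim
      case (elim w)
      have "(cmod (z + w - a))\<^sup>2 = (cmod (z - a))\<^sup>2 + 2 * Re (cnj (z - a) * w) + (cmod w)\<^sup>2"
        by (simp only: cmod_power2) (simp add: power2_eq_square algebra_simps)
      moreover have "Re (2 * of_real k * cnj (z - a) * w) = k * (2 * Re (cnj (z - a) * w))"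
        by (simp add: algebra_simps)
      ultimately have "k * (cmod (z + w - a))\<^sup>2 = k * (cmod (z - a))\<^sup>2 + Re (2 * of_real k * cnj (z - a) * w) + k * (cmod w)\<^sup>2"
        by (simp only: distrib_left)
      moreover have "k * (cmod w)\<^sup>2 \<le> levi N c z * (cmod w)\<^sup>2" using assms by (intro mult_right_mono) auto
      ultimately show ?case using elim by (simp only: minus_complex.sel abs_le_iff) linarith
    qed
  qed (auto intro!: holomorphic_intros)
qed

text \<open>If \<open>levi N c z\<close> were negative, removing the harmonic part of the expansion
  would leave a strict quadratic maximum at \<open>z\<close>.\<close>

lemma sub_at_pev_iff:
  assumes "2 \<le> N"
  shows "sub_at (\<lambda>x. Re (pev N c x)) z \<longleftrightarrow> 0 \<le> levi N c z"
proof
  assume "0 \<le> levi N c z"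
  then show "sub_at (\<lambda>x. Re (pev N c x)) z"
    using sub_at_pev_minus_sq[OF assms, of 0 c z] by simp
next
  assume s: "sub_at (\<lambda>x. Re (pev N c x)) z"
  obtain \<beta> where b: "\<And>e. e > 0 \<Longrightarrow> \<forall>\<^sub>F w in nhds 0.
    \<bar>Re (pev N c (z + w)) - (Re (pev N c z) + Re (pev_dz N c z * w + \<beta> * w\<^sup>2) + levi N c z * (cmod w)\<^sup>2)\<bar>
     \<le> e * (cmod w)\<^sup>2" by (rule pev_taylor_eventually[OF assms(1), where c=c and z=z]) (rule that)
  show "0 \<le> levi N c z"
  proof (rule ccontr)
    assume "\<not> 0 \<le> levi N c z"
    then have k: "- levi N c z / 2 > 0" by simp
    define G where "G x = pev_dz N c z * (x - z) + \<beta> * (x - z)\<^sup>2" for x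
    have "sub_at (\<lambda>x. - Re (G x)) z"
      by (rule sub_at_minus_Re[of _ UNIV]) (auto simp: G_def intro!: holomorphic_intros)
    from sub_at_add[OF s this] have "sub_at (\<lambda>x. Re (pev N c x) + - Re (G x)) z" .
    moreover have "\<forall>\<^sub>F w in nhds 0. Re (pev N c (z + w)) + - Re (G (z + w)) + (- levi N c z / 2) * (cmod w)\<^sup>2
        \<le> Re (pev N c z) + - Re (G z)"
      using b[OF k] by eventually_elim (simp add: G_def abs_le_iff)
    ultimately show False using sub_at_no_strict_max k by blast
  qed
qed

lemma integral_cis_multiples:
  "integral {0..2 * pi} (\<lambda>t. Re (a * cis t + b * cis (2 * t)) + k) = 2 * pi * k"
proof -
  have "((\<lambda>t. Re (a * cis t + b * cis (2 * t)) + k) has_integral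
     (Re (a * cis (2 * pi) / \<i> + b * cis (2 * (2 * pi)) / (2 * \<i>)) + k * (2 * pi)
     - (Re (a * cis 0 / \<i> + b * cis (2 * 0) / (2 * \<i>)) + k * 0))) {0..2 * pi}"
  proof (rule fundamental_theorem_of_calculus)
    fix t :: real
    have "((\<lambda>t. Re a * sin t + Im a * cos t + Re b * sin (2*t) / 2 + Im b * cos (2*t) / 2 + k * t)
       has_real_derivative (Re a * cos t - Im a * sin t + (Re b * cos (2*t) - Im b * sin (2 * t)) + k)) (at t within {0..2*pi})"
      by (auto intro!: derivative_eq_intros)
    moreover have "(\<lambda>t. Re (a * cis t / \<i> + b * cis (2 * t) / (2 * \<i>)) + k * t) =
       (\<lambda>t. Re a * sin t + Im a * cos t + Re b * sin (2*t) / 2 + Im b * cos (2*t) / 2 + k * t)"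
      by (rule ext) (simp add: Re_divide Im_divide power2_eq_square field_simps)
    ultimately show "((\<lambda>t. Re (a * cis t / \<i> + b * cis (2 * t) / (2 * \<i>)) + k * t)
        has_vector_derivative Re (a * cis t + b * cis (2 * t)) + k) (at t within {0..2*pi})"
      by (simp add: has_real_derivative_iff_has_vector_derivative)
  qed simp
  then show ?thesis by (simp add: integral_unique cis_2pi flip: cis_mult)
qed

text \<open>Averaging the expansion over a small circle removes its harmonic terms. This converts
  the mean value definition into the pointwise condition that the estimates use.\<close>

lemma subharmonic_levi_nonneg:
  assumes "2 \<le> N" "subharmonic (\<lambda>z. Re (pev N c z))"
  shows "0 \<le> levi N c z"
proof (rule ccontr)
  assume "\<not> 0 \<le> levi N c z"
  then have k: "- levi N c z / 2 > 0" by simp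
  obtain \<beta> where b: "\<And>e. e > 0 \<Longrightarrow> \<forall>\<^sub>F w in nhds 0.
    \<bar>Re (pev N c (z + w)) - (Re (pev N c z) + Re (pev_dz N c z * w + \<beta> * w\<^sup>2) + levi N c z * (cmod w)\<^sup>2)\<bar>
     \<le> e * (cmod w)\<^sup>2" by (rule pev_taylor_eventually[OF assms(1), where c=c and z=z]) (rule that)
  obtain d where d: "d > 0" and dd: "\<And>w. cmod w < d \<Longrightarrow>
    \<bar>Re (pev N c (z + w)) - (Re (pev N c z) + Re (pev_dz N c z * w + \<beta> * w\<^sup>2) + levi N c z * (cmod w)\<^sup>2)\<bar>
     \<le> - levi N c z / 2 * (cmod w)\<^sup>2"
    using b[OF k] by (auto simp: eventually_nhds_metric dist_norm)
  define s where "s = d / 2"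
  have s: "s > 0" "s < d" using d by (auto simp: s_def)
  \<comment> \<open>An upper bound for the mean: one half of the negative term
    \<open>levi N c z * s^2\<close> absorbs the remainder.\<close>
  define K where "K = Re (pev N c z) + levi N c z / 2 * s\<^sup>2"
  have cont: "continuous_on A (\<lambda>t. Re (pev N c (z + of_real s * cis t)))" for A
    unfolding pev_def by (intro continuous_intros)
  have "integral {0..2*pi} (\<lambda>t. Re (pev N c (z + of_real s * cis t)))
     \<le> integral {0..2*pi} (\<lambda>t. Re (pev_dz N c z * of_real s * cis t + \<beta> * (of_real s)\<^sup>2 * cis (2 * t)) + K)"
  proof (rule integral_le)
    fix t :: real
    have n: "cmod (of_real s * cis t) = s" using s by (simp add: norm_mult)
    have "(of_real s * cis t)\<^sup>2 = (of_real s)\<^sup>2 * cis (2 * t)"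
      by (simp add: power_mult_distrib power2_eq_square[of "cis t"] cis_mult)
    then show "Re (pev N c (z + of_real s * cis t))
      \<le> Re (pev_dz N c z * of_real s * cis t + \<beta> * (of_real s)\<^sup>2 * cis (2 * t)) + K"
      using dd[of "of_real s * cis t"] s unfolding n K_def by (simp add: mult.assoc abs_le_iff)
  qed (intro integrable_continuous_interval cont continuous_intros)+
  also have "\<dots> = 2 * pi * K" by (rule integral_cis_multiples)
  finally have "1 / (2 * pi) * integral {0..2*pi} (\<lambda>t. Re (pev N c (z + of_real s * cis t))) \<le> K"
    by (simp add: field_simps)
  moreover have "Re (pev N c z) \<le> 1 / (2 * pi) * integral {0..2*pi} (\<lambda>t. Re (pev N c (z + of_real s * cis t)))"
    using assms(2) s unfolding subharmonic_def by blast
  ultimately have "0 \<le> levi N c z / 2 * s\<^sup>2" unfolding K_def by linarith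
  then show False using k s by (simp add: zero_le_mult_iff)
qed

section \<open>The Laplacian over the compact family of normalized polynomials\<close>

lemma continuous_on_levi: "continuous_on A (\<lambda>x. levi N (fst x) (snd x))"
proof -
  have [continuous_intros]: "continuous_on A (\<lambda>x. (fst x :: nat \<times> nat \<Rightarrow> complex) i)" for A :: "((nat \<times> nat \<Rightarrow> complex) \<times> complex) set" and i
    by (rule continuous_on_compose2[OF continuous_on_product_coordinates]) (auto intro: continuous_intros)
  show ?thesis unfolding levi_def shift_def by (auto intro!: continuous_intros)
qed

text \<open>Exhibits the Laplacian as a \<open>pev\<close> of its own, so that uniqueness of
  coefficients applies to it.\<close>

lemma levi_Suc:
  "levi (Suc M) q w = Re (pev M (\<lambda>(a, b). q (Suc a, Suc b) * of_nat (Suc a) * of_nat (Suc b)) w)"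
proof -
  have "shift (Suc M) w q (1, 1) = pev M (\<lambda>(a, b). q (Suc a, Suc b) * of_nat (Suc a) * of_nat (Suc b)) w"
    unfolding shift_def pev_def by (simp add: sum.atMost_Suc_shift del: of_nat_Suc sum.atMost_Suc)
  then show ?thesis by (simp add: levi_def)
qed

text \<open>The last condition says that the polynomial is real valued.\<close>

definition normal_coeffs :: "nat \<Rightarrow> (nat \<times> nat \<Rightarrow> complex) set" where
  "normal_coeffs N = {q. (\<forall>j k. q (j, k) \<noteq> 0 \<longrightarrow> 1 \<le> j \<and> 1 \<le> k \<and> j \<le> N \<and> k \<le> N) \<and> (\<forall>x. cmod (q x) \<le> 1)
     \<and> (\<exists>x. cmod (q x) = 1) \<and> (\<forall>x. cnj (q (prod.swap x)) = q x)}"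

text \<open>Passing to the Laplacian multiplies the coefficient at \<open>(j, k)\<close> by
  \<open>j * k\<close>, which is nonzero because pure powers are excluded; a Laplacian that vanishes
  on the disc would kill the coefficient of modulus 1.\<close>

lemma normal_coeffs_levi_nonzero:
  assumes "q \<in> normal_coeffs N"
  shows "\<exists>w. cmod w \<le> 1 \<and> levi N q w \<noteq> 0"
proof (rule ccontr)
  assume "\<not> ?thesis"
  then have 0: "levi N q w = 0" if "cmod w \<le> 1" for w using that by auto
  obtain j k where jk: "cmod (q (j, k)) = 1" using assms by (auto simp: normal_coeffs_def)
  then have "q (j, k) \<noteq> 0" by auto
  then have jk': "1 \<le> j" "1 \<le> k" "j \<le> N" "k \<le> N" using assms by (auto simp: normal_coeffs_def)
  then obtain M where N: "N = Suc M" by (cases N) auto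
  define q' where "q' = (\<lambda>(a, b). q (Suc a, Suc b) * of_nat (Suc a) * of_nat (Suc b))"
  have "\<forall>x. cnj (q (prod.swap x)) = q x" using assms by (simp add: normal_coeffs_def)
  then have herm: "cnj (q (k, j)) = q (j, k)" for j k by (metis swap_simp)
  have "(\<lambda>(j, k). cnj (q' (k, j))) = q'"
    by (rule ext) (simp add: q'_def herm mult_ac split_beta)
  then have re: "pev M q' w \<in> \<real>" for w using pev_cnj[of M q' w] by (simp add: Reals_cnj_iff)
  then have "pev M q' w = 0" if "cmod w \<le> 1" for w
    using 0[OF that] re[of w] unfolding N levi_Suc q'_def[symmetric]
    by (simp add: complex_eq_iff complex_is_Real_iff)
  then have "q' (j - 1, k - 1) = 0" using jk' N by (intro pev_eq_0_imp[of M q']) auto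
  moreover have "q' (j - 1, k - 1) = q (j, k) * of_nat j * of_nat k" using jk' by (auto simp: q'_def)
  ultimately show False using jk jk' by simp
qed

text \<open>Tychonoff, with trivial factors outside the square of exponents. Having some coefficient
  of modulus 1 is a closed condition because the union runs over the finite square.\<close>

lemma compact_normal_coeffs: "compact (normal_coeffs N)"
proof -
  define I where "I = {1..N} \<times> {1..N}"
  define X where "X = Pi\<^sub>E UNIV (\<lambda>x::nat \<times> nat. if x \<in> I then cball (0::complex) 1 else {0})"
  have "compactin (product_topology (\<lambda>_. euclidean) UNIV) X"
    unfolding X_def by (subst compactin_PiE) auto
  then have "compact X" by (simp add: euclidean_product_topology)
  have [continuous_intros]: "continuous_on UNIV (\<lambda>q::nat \<times> nat \<Rightarrow> complex. q i)" for i
    by (rule continuous_on_product_coordinates)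
  have "closed (\<Union>x\<in>I. {q. cmod (q x) = 1})"
  proof (rule closed_UN)
    show "\<forall>x\<in>I. closed {q. cmod (q x :: complex) = 1}"
      by (intro ballI closed_Collect_eq continuous_intros)
  qed (simp add: I_def)
  moreover have "closed {q. \<forall>x. cnj (q (prod.swap x)) = (q x :: complex)}"
    by (intro closed_Collect_all closed_Collect_eq continuous_on_cnj continuous_on_product_coordinates)
  ultimately have "closed ((\<Union>x\<in>I. {q. cmod (q x) = 1}) \<inter> {q. \<forall>x. cnj (q (prod.swap x)) = q x})"
    by (rule closed_Int)
  then have "compact (X \<inter> ((\<Union>x\<in>I. {q. cmod (q x) = 1}) \<inter> {q. \<forall>x. cnj (q (prod.swap x)) = q x}))"
    by (rule compact_Int_closed[OF \<open>compact X\<close>])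
  also have "X \<inter> ((\<Union>x\<in>I. {q. cmod (q x) = 1}) \<inter> {q. \<forall>x. cnj (q (prod.swap x)) = q x}) = normal_coeffs N"
  proof (intro equalityI subsetI)
    fix q assume "q \<in> X \<inter> ((\<Union>x\<in>I. {q. cmod (q x) = 1}) \<inter> {q. \<forall>x. cnj (q (prod.swap x)) = q x})"
    then have q: "q \<in> X" "\<exists>x\<in>I. cmod (q x) = 1" "\<forall>x. cnj (q (prod.swap x)) = q x" by blast+
    have *: "q x \<in> (if x \<in> I then cball 0 1 else {0})" for x using q(1) unfolding X_def by (rule PiE_mem) simp
    have "cmod (q x) \<le> 1" for x using *[of x] by (auto split: if_splits)
    moreover have "1 \<le> j \<and> 1 \<le> k \<and> j \<le> N \<and> k \<le> N" if "q (j, k) \<noteq> 0" for j k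
      using *[of "(j, k)"] that by (auto simp: I_def split: if_splits)
    ultimately show "q \<in> normal_coeffs N" using q unfolding normal_coeffs_def by blast
  next
    fix q assume q: "q \<in> normal_coeffs N"
    obtain x where x: "cmod (q x) = 1" using q by (auto simp: normal_coeffs_def)
    then have "q x \<noteq> 0" by auto
    then have "x \<in> I" using q by (cases x) (auto simp: normal_coeffs_def I_def)
    moreover have "q \<in> X"
    proof -
      have "q x \<in> (if x \<in> I then cball 0 1 else {0})" for x
        using q unfolding normal_coeffs_def I_def by (cases x) force
      then show ?thesis unfolding X_def by (intro PiE_I) auto
    qed
    moreover have "\<forall>x. cnj (q (prod.swap x)) = q x" using q unfolding normal_coeffs_def by blast
    ultimately show "q \<in> X \<inter> ((\<Union>x\<in>I. {q. cmod (q x) = 1}) \<inter> {q. \<forall>x. cnj (q (prod.swap x)) = q x})"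
      using x by blast
  qed
  finally show ?thesis .
qed

text \<open>For each \<open>q\<close> the Laplacian exceeds some \<open>1 / (n + 1)\<close> in
  modulus at some point of the disc. These conditions are open in \<open>q\<close>, so finitely many
  of them cover the family and give one bound; uniform continuity spreads it over discs of fixed
  radius.\<close>

lemma levi_uniform_lower_bound:
  "\<exists>\<kappa>>0. \<exists>s>0. \<forall>q\<in>normal_coeffs N. (\<forall>w. 0 \<le> levi N q w) \<longrightarrow>
        (\<exists>w0. cmod w0 \<le> 1 \<and> (\<forall>w. cmod (w - w0) \<le> s \<longrightarrow> \<kappa> \<le> levi N q w))"
proof -
  define K where "K = normal_coeffs N"
  have K: "compact K" unfolding K_def by (rule compact_normal_coeffs)
  define U where "U x = {q. 1 / real (Suc (snd x)) < \<bar>levi N q (fst x)\<bar>}" for x :: "complex \<times> nat"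
  have cl: "continuous_on UNIV (\<lambda>q. levi N q w)" for w
  proof -
    have "continuous_on UNIV (\<lambda>q::nat \<times> nat \<Rightarrow> complex. (q, w))"
      by (intro continuous_on_Pair continuous_on_id continuous_on_const)
    from continuous_on_compose2[OF continuous_on_levi[of UNIV N] this] show ?thesis by simp
  qed
  have openU: "open (U x)" for x
    unfolding U_def by (intro open_Collect_less continuous_intros cl)
  have "K \<subseteq> (\<Union>x\<in>cball 0 1 \<times> UNIV. U x)"
  proof
    fix q assume "q \<in> K"
    then obtain w where w: "cmod w \<le> 1" "levi N q w \<noteq> 0"
      using normal_coeffs_levi_nonzero unfolding K_def by blast
    then obtain n where "inverse (real (Suc n)) < \<bar>levi N q w\<bar>" using reals_Archimedean[of "\<bar>levi N q w\<bar>"] by auto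
    then have "q \<in> U (w, n)" by (simp add: U_def inverse_eq_divide)
    with w show "q \<in> (\<Union>x\<in>cball 0 1 \<times> UNIV. U x)" by (intro UN_I[of "(w, n)"]) auto
  qed
  then obtain T where T: "T \<subseteq> cball 0 1 \<times> UNIV" "finite T" "K \<subseteq> (\<Union>x\<in>T. U x)"
    using compactE_image[OF K, of "cball 0 1 \<times> UNIV" U] openU by blast
  define n where "n = Max (insert 0 (snd ` T))"
  define k where "k = 1 / real (Suc n)"
  have k: "k > 0" by (simp add: k_def)
  have low: "\<exists>w. cmod w \<le> 1 \<and> k < \<bar>levi N q w\<bar>" if qK: "q \<in> K" for q
  proof -
    obtain x where "x \<in> T" "q \<in> U x" using T(3) qK by blast
    then obtain w i where wi: "(w, i) \<in> T" "q \<in> U (w, i)" by (cases x) auto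
    have "i \<le> n" unfolding n_def using T(2) wi(1) by (intro Max_ge) (auto simp: image_iff intro!: bexI[of _ "(w,i)"])
    then have "k \<le> 1 / real (Suc i)" unfolding k_def by (simp add: frac_le)
    with wi T(1) show ?thesis by (intro exI[of _ w]) (auto simp: U_def)
  qed
  \<comment> \<open>The centres lie in the unit disc and the radii will be at most 1, hence the disc
    of radius 2.\<close>
  have "uniformly_continuous_on (K \<times> cball 0 2) (\<lambda>x. levi N (fst x) (snd x))"
    by (intro compact_uniformly_continuous continuous_on_levi compact_Times K compact_cball)
  then obtain s where s: "s > 0" "\<And>x y. x \<in> K \<times> cball 0 2 \<Longrightarrow> y \<in> K \<times> cball 0 2 \<Longrightarrow> dist y x < s \<Longrightarrow>
     dist (levi N (fst y) (snd y)) (levi N (fst x) (snd x)) < k / 2"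
    unfolding uniformly_continuous_on_def using k by (metis half_gt_zero)
  show ?thesis
  proof (rule exI[of _ "k / 2"], rule conjI, simp add: k, rule exI[of _ "min (s / 2) 1"], rule conjI, simp add: s(1), intro ballI impI)
    fix q assume q: "q \<in> normal_coeffs N" and "\<forall>w. 0 \<le> levi N q w"
    then have lamq: "0 \<le> levi N q w" for w by blast
    obtain w0 where w0: "cmod w0 \<le> 1" "k < \<bar>levi N q w0\<bar>" using low q K_def by blast
    have "k / 2 \<le> levi N q w" if w: "cmod (w - w0) \<le> min (s / 2) 1" for w
    proof -
      have "cmod w \<le> cmod (w - w0) + cmod w0" using norm_triangle_ineq[of "w - w0" w0] by simp
      then have "cmod w \<le> 2" using w w0 by simp
      then have "dist (levi N (fst (q, w)) (snd (q, w))) (levi N (fst (q, w0)) (snd (q, w0))) < k / 2"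
        using q w w0 s(1) unfolding K_def[symmetric] by (intro s(2)) (auto simp: dist_Pair_Pair dist_norm K_def)
      then show ?thesis using w0 lamq[of w0] lamq[of w] by (simp add: dist_real_def abs_if split: if_splits)
    qed
    with w0 show "\<exists>w0. cmod w0 \<le> 1 \<and> (\<forall>w. cmod (w - w0) \<le> min (s / 2) 1 \<longrightarrow> k / 2 \<le> levi N q w)" by blast
  qed
qed

section \<open>Discs in normalized model domains\<close>

text \<open>The function \<open>|x|\<^sup>2 - 1\<close> for \<open>|x| \<le> 1\<close> and \<open>ln |x|\<^sup>2\<close> for \<open>|x| \<ge> 1\<close>: subharmonic of logarithmic
  growth, with Laplacian supported in the unit disc. It lies between these two
  functions, so minorants at points of the circle come without second derivatives.\<close>

definition logcap :: "complex \<Rightarrow> real" where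
  "logcap x = min ((cmod x)\<^sup>2) 1 - 1 + ln (max ((cmod x)\<^sup>2) 1)"

lemma continuous_on_logcap [continuous_intros]: "continuous_on A f \<Longrightarrow> continuous_on A (\<lambda>x. logcap (f x))"
  unfolding logcap_def by (intro continuous_intros) auto

lemma logcap_ge: "- 1 \<le> logcap x"
  unfolding logcap_def by (smt (verit) ln_ge_zero max.cobounded2 min_def zero_le_power2)

lemma logcap_inside: "cmod x \<le> 1 \<Longrightarrow> logcap x = (cmod x)\<^sup>2 - 1"
  by (simp add: logcap_def power_le_one)

lemma logcap_outside: "1 \<le> cmod x \<Longrightarrow> logcap x = ln ((cmod x)\<^sup>2)"
  by (simp add: logcap_def one_le_power)

lemma logcap_le: "logcap x \<le> (cmod x)\<^sup>2 - 1"
proof (cases "cmod x \<le> 1")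
  case True then show ?thesis by (simp add: logcap_inside)
next
  case False
  then have "0 < (cmod x)\<^sup>2" by (intro zero_less_power) linarith
  then show ?thesis using False ln_le_minus_one[of "(cmod x)\<^sup>2"] by (simp add: logcap_outside)
qed

lemma logcap_ge_ln: "x \<noteq> 0 \<Longrightarrow> ln ((cmod x)\<^sup>2) \<le> logcap x"
proof (cases "cmod x \<le> 1")
  assume "x \<noteq> 0" "cmod x \<le> 1"
  then show ?thesis using ln_le_minus_one[of "(cmod x)\<^sup>2"] by (simp add: logcap_inside)
qed (simp add: logcap_outside)

text \<open>On the disc about \<open>z\<close> that reaches to \<open>a\<close> the quotient
  \<open>(x - a) / (z - a)\<close> has positive real part, so the principal logarithm shows the
  function to be harmonic.\<close>

lemma sub_at_ln_cmod:
  assumes "z \<noteq> a" "s > 0"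
  shows "sub_at (\<lambda>x. ln ((cmod ((x - a) / of_real s))\<^sup>2)) z" "sub_at (\<lambda>x. - ln ((cmod ((x - a) / of_real s))\<^sup>2)) z"
proof -
  define G where "G x = 2 * Ln ((x - a) / (z - a)) + of_real (ln ((cmod ((z - a) / of_real s))\<^sup>2))" for x
  define S where "S = ball z (cmod (z - a))"
  have S: "open S" "z \<in> S" using assms by (auto simp: S_def)
  have re: "0 < Re ((x - a) / (z - a))" if "x \<in> S" for x
  proof -
    have "(x - a) / (z - a) - 1 = (x - z) / (z - a)" using assms by (simp add: field_simps)
    then have "cmod ((x - a) / (z - a) - 1) = cmod (x - z) / cmod (z - a)" by (simp only: norm_divide)
    also have "\<dots> < 1" using that assms by (simp add: S_def dist_norm norm_minus_commute)
    finally have "cmod ((x - a) / (z - a) - 1) < 1" .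
    moreover have "\<bar>Re ((x - a) / (z - a) - 1)\<bar> \<le> cmod ((x - a) / (z - a) - 1)" by (rule abs_Re_le_cmod)
    ultimately show ?thesis by simp
  qed
  have nn: "(x - a) / (z - a) \<notin> \<real>\<^sub>\<le>\<^sub>0" if "x \<in> S" for x
    using re[OF that] by (auto simp: complex_nonpos_Reals_iff)
  have hol: "G holomorphic_on S" unfolding G_def
    using assms nn by (intro holomorphic_intros) auto
  have eq: "Re (G x) = ln ((cmod ((x - a) / of_real s))\<^sup>2)" if "x \<in> S" for x
  proof -
    have xa: "x - a \<noteq> 0" "z - a \<noteq> 0" using re[OF that] assms by auto
    then have "Re (Ln ((x - a) / (z - a))) = ln (cmod (x - a) / cmod (z - a))"
      by (simp add: norm_divide)
    then show ?thesis using xa assms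
      by (simp add: G_def norm_divide ln_div ln_realpow power_divide)
  qed
  have ev: "\<forall>\<^sub>F x in nhds z. x \<in> S" using S by (simp add: eventually_nhds_in_open)
  show "sub_at (\<lambda>x. ln ((cmod ((x - a) / of_real s))\<^sup>2)) z"
    by (rule sub_at_cong[OF sub_at_Re[OF hol S]]) (rule eventually_mono[OF ev], simp add: eq)
  show "sub_at (\<lambda>x. - ln ((cmod ((x - a) / of_real s))\<^sup>2)) z"
    by (rule sub_at_cong[OF sub_at_minus_Re[OF hol S]]) (rule eventually_mono[OF ev], simp add: eq)
qed

lemma sub_at_sq: "sub_at (\<lambda>x. (cmod (x - a))\<^sup>2) z"
proof (rule sub_atI[of 1 "\<lambda>w. 2 * cnj (z - a) * w"])
  fix e :: real assume "e > 0"
  have "(cmod (z + w - a))\<^sup>2 = (cmod (z - a))\<^sup>2 + Re (2 * cnj (z - a) * w) + (cmod w)\<^sup>2" for w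
    by (simp only: cmod_power2) (simp add: power2_eq_square algebra_simps)
  then show "\<forall>\<^sub>F w in nhds 0. (cmod (z - a))\<^sup>2 + Re (2 * cnj (z - a) * w) - e * (cmod w)\<^sup>2 \<le> (cmod (z + w - a))\<^sup>2"
    using \<open>e > 0\<close> by (simp add: always_eventually add_increasing2)
qed (auto intro!: holomorphic_intros)

lemma sub_at_logcap:
  assumes "s > 0"
  shows "sub_at (\<lambda>x. logcap ((x - a) / of_real s)) z"
proof (cases "cmod (z - a) < s")
  case True
  have "open {x. cmod (x - a) < s}" by (intro open_Collect_less continuous_intros)
  then have ev: "\<forall>\<^sub>F x in nhds z. x \<in> {x. cmod (x - a) < s}" using True by (intro eventually_nhds_in_open) auto
  have "sub_at (\<lambda>x. 1 / s\<^sup>2 * (cmod (x - a))\<^sup>2 + - 1) z"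
    by (intro sub_at_add sub_at_cmult sub_at_sq sub_at_const) simp
  then show ?thesis
    by (rule sub_at_cong) (rule eventually_mono[OF ev], use assms in \<open>simp add: logcap_inside norm_divide power_divide\<close>)
next
  case False
  then have "z \<noteq> a" using assms by auto
  have "open {x. x \<noteq> a}" by (intro open_Collect_neq continuous_intros)
  then have ev: "\<forall>\<^sub>F x in nhds z. x \<in> {x. x \<noteq> a}" using \<open>z \<noteq> a\<close> by (intro eventually_nhds_in_open) auto
  show ?thesis
  proof (rule sub_at_mono[OF sub_at_ln_cmod(1)[OF \<open>z \<noteq> a\<close> assms]])
    show "ln ((cmod ((z - a) / of_real s))\<^sup>2) = logcap ((z - a) / of_real s)"
      using False assms by (simp add: logcap_outside norm_divide)
    show "\<forall>\<^sub>F w in nhds 0. ln ((cmod ((z + w - a) / of_real s))\<^sup>2) \<le> logcap ((z + w - a) / of_real s)"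
      using eventually_nhds_translate[OF ev] by eventually_elim (use assms in \<open>auto intro!: logcap_ge_ln\<close>)
  qed
qed

text \<open>Subtraction calls for a majorant of \<open>logcap\<close>. In the closed disc this is
  the quadratic piece, whose Laplacian is covered by the bound \<open>\<kappa>\<close>; outside,
  \<open>logcap\<close> is a harmonic logarithm and \<open>levi \<ge> 0\<close> suffices.\<close>

lemma sub_at_pev_minus_logcap:
  assumes "2 \<le> N" "\<And>w. 0 \<le> levi N q w" "\<And>w. cmod (w - a) \<le> s \<Longrightarrow> \<kappa> \<le> levi N q w" "s > 0" "\<kappa> > 0"
  shows "sub_at (\<lambda>x. Re (pev N q x) - \<kappa> * s\<^sup>2 * logcap ((x - a) / of_real s)) z"
proof (cases "cmod (z - a) \<le> s")
  case True
  have "sub_at (\<lambda>x. Re (pev N q x) - \<kappa> * (cmod (x - a))\<^sup>2 + \<kappa> * s\<^sup>2) z"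
    by (intro sub_at_add sub_at_pev_minus_sq sub_at_const assms True)
  then show ?thesis
  proof (rule sub_at_mono)
    show "Re (pev N q z) - \<kappa> * (cmod (z - a))\<^sup>2 + \<kappa> * s\<^sup>2 = Re (pev N q z) - \<kappa> * s\<^sup>2 * logcap ((z - a) / of_real s)"
      using True assms by (simp add: logcap_inside norm_divide power_divide field_simps)
    have le: "\<kappa> * s\<^sup>2 * logcap ((x - a) / of_real s) \<le> \<kappa> * s\<^sup>2 * ((cmod ((x - a) / of_real s))\<^sup>2 - 1)" for x
      using assms by (intro mult_left_mono logcap_le) auto
    have eq: "\<kappa> * s\<^sup>2 * ((cmod ((x - a) / of_real s))\<^sup>2 - 1) = \<kappa> * (cmod (x - a))\<^sup>2 - \<kappa> * s\<^sup>2" for x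
      using assms by (simp add: norm_divide power_divide field_simps)
    show "\<forall>\<^sub>F w in nhds 0. Re (pev N q (z + w)) - \<kappa> * (cmod (z + w - a))\<^sup>2 + \<kappa> * s\<^sup>2
        \<le> Re (pev N q (z + w)) - \<kappa> * s\<^sup>2 * logcap ((z + w - a) / of_real s)"
    proof (intro always_eventually allI)
      fix w
      show "Re (pev N q (z + w)) - \<kappa> * (cmod (z + w - a))\<^sup>2 + \<kappa> * s\<^sup>2
        \<le> Re (pev N q (z + w)) - \<kappa> * s\<^sup>2 * logcap ((z + w - a) / of_real s)"
        using le[of "z + w"] eq[of "z + w"] by linarith
    qed
  qed
next
  case False
  then have "z \<noteq> a" using assms by auto
  have "open {x. s < cmod (x - a)}" by (intro open_Collect_less continuous_intros)
  then have ev: "\<forall>\<^sub>F x in nhds z. x \<in> {x. s < cmod (x - a)}" using False by (intro eventually_nhds_in_open) auto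
  have "sub_at (\<lambda>x. Re (pev N q x) + \<kappa> * s\<^sup>2 * - ln ((cmod ((x - a) / of_real s))\<^sup>2)) z"
    using assms \<open>z \<noteq> a\<close> by (intro sub_at_add sub_at_cmult sub_at_ln_cmod) (auto simp: sub_at_pev_iff)
  then show ?thesis
    by (rule sub_at_cong) (rule eventually_mono[OF ev], use assms in \<open>simp add: logcap_outside norm_divide\<close>)
qed

lemma pev_mixed_0:
  assumes "q \<in> normal_coeffs N"
  shows "pev N q 0 = 0"
proof -
  have "q (j, k) * 0 ^ j * cnj 0 ^ k = 0" for j k
  proof -
    have "q (j, k) = 0 \<or> 1 \<le> j" using assms by (auto simp: normal_coeffs_def)
    then show ?thesis by (auto simp: power_0_left)
  qed
  then show ?thesis unfolding pev_def by (simp only: sum.neutral_const)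
qed

lemma holomorphic_scaled_ball:
  assumes "f holomorphic_on ball 0 1" "0 < R" "R < 1"
  shows "(\<lambda>w. f (of_real R * w)) holomorphic_on ball 0 (1 / R)"
proof -
  have "f \<circ> (\<lambda>w. of_real R * w) holomorphic_on ball 0 (1 / R)"
    using assms by (intro holomorphic_on_compose_gen[of _ _ f "ball 0 1"] holomorphic_intros)
      (auto simp: norm_mult field_simps)
  then show ?thesis by (simp add: o_def)
qed

text \<open>With \<open>V\<close> a multiple of \<open>logcap\<close> around the point where \<open>\<Delta>Q\<close> is large, both \<open>V\<close> and \<open>Q - V\<close> are
  subharmonic, and \<open>V \<circ> g \<le> - Re f0 - (Q - V) \<circ> g\<close>, where the right-hand side is superharmonic and
  bounded at \<open>0\<close>.\<close>

lemma normalized_disc_bound: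
  assumes N: "2 \<le> N" and rho: "0 < \<rho>" "\<rho> < 1"
  shows "\<exists>C>0. \<forall>q g f0 \<zeta>. q \<in> normal_coeffs N \<longrightarrow> (\<forall>w. 0 \<le> levi N q w) \<longrightarrow> g holomorphic_on ball 0 1 \<longrightarrow>
       f0 holomorphic_on ball 0 1 \<longrightarrow> g 0 = 0 \<longrightarrow> f0 0 = - 1 \<longrightarrow>
       (\<forall>z. cmod z < 1 \<longrightarrow> Re (f0 z) + Re (pev N q (g z)) \<le> 0) \<longrightarrow> cmod \<zeta> \<le> \<rho> \<longrightarrow> cmod (g \<zeta>) \<le> C"
proof -
  obtain \<kappa> s where ks: "\<kappa> > 0" "s > 0"
    "\<forall>q\<in>normal_coeffs N. (\<forall>w. 0 \<le> levi N q w) \<longrightarrow>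
        (\<exists>w0. cmod w0 \<le> 1 \<and> (\<forall>w. cmod (w - w0) \<le> s \<longrightarrow> \<kappa> \<le> levi N q w))"
    using levi_uniform_lower_bound[of N] by (elim exE conjE) (rule that)
  \<comment> \<open>Discs are restricted to radius \<open>R\<close>, so that after rescaling they
    are holomorphic beyond the closed unit disc; the radius \<open>\<rho>\<close> becomes
    \<open>r < 1\<close>.\<close>
  define R where "R = (1 + \<rho>) / 2"
  have R: "0 < R" "R < 1" "\<rho> < R" using rho by (auto simp: R_def)
  define r where "r = \<rho> / R"
  have r: "0 < r" "r < 1" using R rho by (auto simp: r_def)
  define c where "c = \<kappa> * s\<^sup>2"
  have c: "c > 0" using ks by (simp add: c_def)
  \<comment> \<open>The bound of \<open>sub_harnack\<close> for a superharmonic function with value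
    at most \<open>1 + \<kappa>\<close> at 0.\<close>
  define B where "B = (1 + r) / (1 - r) * (1 + \<kappa> + 3) + 1"
  show ?thesis
  proof (intro exI[of _ "1 + s * exp (B / c)"] conjI allI impI)
    show "1 + s * exp (B / c) > 0" using ks by (simp add: add_pos_pos)
    fix q :: "nat \<times> nat \<Rightarrow> complex" and g f0 :: "complex \<Rightarrow> complex" and \<zeta> :: complex
    assume q: "q \<in> normal_coeffs N" and lam0: "\<forall>w. 0 \<le> levi N q w" and g: "g holomorphic_on ball 0 1"
      and f0: "f0 holomorphic_on ball 0 1" and g0: "g 0 = 0" and f00: "f0 0 = - 1"
      and neg0: "\<forall>z. cmod z < 1 \<longrightarrow> Re (f0 z) + Re (pev N q (g z)) \<le> 0" and z: "cmod \<zeta> \<le> \<rho>"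
    have levi: "\<And>w. 0 \<le> levi N q w" using lam0 by blast
    have neg: "\<And>z. cmod z < 1 \<Longrightarrow> Re (f0 z) + Re (pev N q (g z)) \<le> 0" using neg0 by blast
    obtain w0 where w0: "cmod w0 \<le> 1" "\<And>w. cmod (w - w0) \<le> s \<Longrightarrow> \<kappa> \<le> levi N q w"
      using ks(3)[rule_format, OF q lam0[rule_format]] by blast
    define V where "V x = logcap ((x - w0) / of_real s)" for x
    define A where "A x = Re (pev N q x) - c * V x" for x
    have subA: "sub_at A x" for x
      unfolding A_def V_def c_def using sub_at_pev_minus_logcap[OF N levi w0(2) ks(2,1)] by simp
    have subV: "sub_at V x" for x unfolding V_def by (rule sub_at_logcap[OF ks(2)])
    define g' where "g' w = g (of_real R * w)" for w
    define f' where "f' w = f0 (of_real R * w)" for w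
    have holg: "g' holomorphic_on ball 0 (1 / R)" unfolding g'_def by (rule holomorphic_scaled_ball[OF g R(1,2)])
    have holf: "f' holomorphic_on ball 0 (1 / R)" unfolding f'_def by (rule holomorphic_scaled_ball[OF f0 R(1,2)])
    have "1 < 1 / R" using R by simp
    then have sub: "cball 0 1 \<subseteq> ball (0::complex) (1 / R)" by auto
    then have inB: "x \<in> ball 0 (1 / R)" if "cmod x < 1" for x using that \<open>1 < 1 / R\<close> by auto
    have contg: "continuous_on (cball 0 1) g'" using holg sub holomorphic_on_imp_continuous_on continuous_on_subset by blast
    have contf: "continuous_on (cball 0 1) f'" using holf sub holomorphic_on_imp_continuous_on continuous_on_subset by blast
    have contp: "continuous_on UNIV (\<lambda>x. pev N q x)" unfolding pev_def by (intro continuous_intros)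
    have contV: "continuous_on UNIV V" unfolding V_def using ks by (intro continuous_intros) auto
    have contA: "continuous_on UNIV A" unfolding A_def by (intro continuous_intros contp contV)
    have inR: "cmod (of_real R * x) < 1" if "cmod x \<le> 1" for x
    proof -
      have "R * cmod x \<le> R * 1" using that R by (intro mult_left_mono) auto
      moreover have "cmod (of_real R * x) = R * cmod x" using R by (simp add: norm_mult)
      ultimately show ?thesis using R by linarith
    qed
    \<comment> \<open>The summand \<open>c\<close> makes the subharmonic function nonnegative, as
      \<open>logcap \<ge> - 1\<close>.\<close>
    have "c * V (g' (\<zeta> / of_real R)) + c \<le> (1 + r) / (1 - r) * ((- Re (f' 0) + - A (g' 0) + c) + 3) + 1"
    proof (rule sub_harnack[where w = "\<lambda>x. c * V (g' x) + c" and S = "\<lambda>x. - Re (f' x) + - A (g' x) + c"])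
      show "continuous_on (cball 0 1) (\<lambda>x. c * V (g' x) + c)"
        by (intro continuous_intros continuous_on_compose2[OF contV contg]) auto
      show "continuous_on (cball 0 1) (\<lambda>x. - Re (f' x) + - A (g' x) + c)"
        by (intro continuous_intros contf continuous_on_compose2[OF contA contg]) auto
      fix x :: complex
      show "0 \<le> c * V (g' x) + c" unfolding V_def using c mult_left_mono[OF logcap_ge[of "(g' x - w0) / of_real s"], of c] by simp
      show "sub_at (\<lambda>x. c * V (g' x) + c) x" if "cmod x < 1"
        using inB[OF that] c by (intro sub_at_add sub_at_cmult sub_at_const sub_at_compose[OF subV holg]) auto
      have "sub_at (\<lambda>x. Re (f' x) + A (g' x) + - c) x" if "cmod x < 1"
        using inB[OF that] by (intro sub_at_add sub_at_const sub_at_Re[OF holf] sub_at_compose[OF subA holg]) auto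
      then show "sub_at (\<lambda>x. - (- Re (f' x) + - A (g' x) + c)) x" if "cmod x < 1"
        using that by (simp add: algebra_simps)
      show "c * V (g' x) + c \<le> - Re (f' x) + - A (g' x) + c" if "cmod x \<le> 1"
        using neg[OF inR[OF that]] by (simp add: A_def f'_def g'_def)
    qed (use z R r in \<open>auto simp: r_def norm_divide divide_right_mono\<close>)
    also have "g' (\<zeta> / of_real R) = g \<zeta>" using R by (simp add: g'_def)
    finally have 1: "c * V (g \<zeta>) + c \<le> (1 + r) / (1 - r) * ((- Re (f' 0) + - A (g' 0) + c) + 3) + 1" .
    \<comment> \<open>Here \<open>|w0| \<le> 1\<close> enters: it bounds the superharmonic function
      at 0.\<close>
    have "c * V 0 \<le> c * ((cmod ((0 - w0) / of_real s))\<^sup>2 - 1)" unfolding V_def using c by (intro mult_left_mono logcap_le) auto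
    also have "\<dots> = \<kappa> * (cmod w0)\<^sup>2 - c" using ks by (simp add: norm_divide power_divide c_def field_simps)
    also have "\<kappa> * (cmod w0)\<^sup>2 \<le> \<kappa> * 1" using ks w0 by (intro mult_left_mono power_le_one) auto
    finally have "- Re (f' 0) + - A (g' 0) + c \<le> 1 + \<kappa>"
      using pev_mixed_0[OF q] by (simp add: f'_def g'_def A_def f00 g0)
    then have "(1 + r) / (1 - r) * ((- Re (f' 0) + - A (g' 0) + c) + 3) \<le> (1 + r) / (1 - r) * (1 + \<kappa> + 3)"
      using r by (intro mult_left_mono) auto
    with 1 have "c * V (g \<zeta>) \<le> B" using c unfolding B_def by linarith
    then have VB: "V (g \<zeta>) \<le> B / c" using c by (simp add: field_simps)
    have B0: "B \<ge> 0" unfolding B_def using r ks by (intro add_nonneg_nonneg mult_nonneg_nonneg divide_nonneg_nonneg) auto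
    define x where "x = (g \<zeta> - w0) / of_real s"
    have "cmod x \<le> exp (B / c)"
    proof (cases "cmod x \<le> 1")
      case True
      moreover have "1 \<le> exp (B / c)" using B0 c by simp
      ultimately show ?thesis by linarith
    next
      case False
      then have "ln ((cmod x)\<^sup>2) \<le> B / c" using VB by (simp add: V_def x_def logcap_outside)
      then have "(cmod x)\<^sup>2 \<le> exp (B / c)" using False by (subst ln_le_cancel_iff[symmetric]) (auto intro!: zero_less_power)
      moreover have "cmod x * 1 \<le> cmod x * cmod x" using False by (intro mult_left_mono) auto
      ultimately show ?thesis by (simp add: power2_eq_square)
    qed
    then have "cmod (g \<zeta> - w0) \<le> s * exp (B / c)" using ks by (simp add: x_def norm_divide field_simps)
    then show "cmod (g \<zeta>) \<le> 1 + s * exp (B / c)" using w0 norm_triangle_ineq[of "g \<zeta> - w0" w0] by simp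
  qed
qed

lemma pev_bound:
  assumes "\<And>j k. cmod (c (j, k)) \<le> K" "cmod z \<le> B" "B \<ge> 1" "K \<ge> 0"
  shows "cmod (pev N c z) \<le> (real N + 1)\<^sup>2 * K * B ^ (2 * N)"
proof -
  have "cmod (c (j, k) * z ^ j * cnj z ^ k) \<le> K * B ^ (2 * N)" if "j \<le> N" "k \<le> N" for j k
  proof -
    have "cmod z ^ (j + k) \<le> B ^ (j + k)" using assms by (intro power_mono) auto
    also have "\<dots> \<le> B ^ (2 * N)" using assms that by (intro power_increasing) auto
    finally have "cmod (c (j, k)) * cmod z ^ (j + k) \<le> K * B ^ (2 * N)" using assms by (intro mult_mono) auto
    then show ?thesis by (simp add: norm_mult norm_power power_add mult.assoc)
  qed
  then have "cmod (pev N c z) \<le> (\<Sum>j\<le>N. \<Sum>k\<le>N. K * B ^ (2 * N))"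
    unfolding pev_def by (intro sum_norm_le) auto
  also have "\<dots> = (real N + 1)\<^sup>2 * K * B ^ (2 * N)" by (simp add: power2_eq_square algebra_simps)
  finally show ?thesis .
qed

text \<open>Throughout the family \<open>\<kappa>\<close> bounds from below the coefficient at
  \<open>(j0, k0)\<close>, one of top degree \<open>N\<close>. Both exponents are positive, so it
  survives the removal of the harmonic terms.\<close>

locale model_family =
  fixes i0 i1 :: "'n::finite" and N j0 k0 :: nat and \<kappa> :: real
  assumes i01: "i0 \<noteq> i1" and jk0: "1 \<le> j0" "1 \<le> k0" "j0 + k0 = N" and kappa: "\<kappa> > 0"
begin

lemma N2: "2 \<le> N" using jk0 by linarith

definition mfun :: "(nat \<times> nat \<Rightarrow> complex) \<Rightarrow> complex ^ 'n \<Rightarrow> real" where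
  "mfun c z = Re (z $ i0) + Re (pev N c (z $ i1)) + (\<Sum>\<alpha>\<in>- {i0, i1}. (cmod (z $ \<alpha>))\<^sup>2)"

definition mdom :: "(nat \<times> nat \<Rightarrow> complex) \<Rightarrow> (complex ^ 'n) set" where
  "mdom c = {z. mfun c z < 0}"

definition admissible :: "(nat \<times> nat \<Rightarrow> complex) \<Rightarrow> bool" where
  "admissible c \<longleftrightarrow> (\<forall>j k. c (j, k) \<noteq> 0 \<longrightarrow> j + k \<le> N) \<and> \<kappa> \<le> cmod (c (j0, k0)) \<and> (\<forall>z. pev N c z \<in> \<real>) \<and> (\<forall>z. 0 \<le> levi N c z)"

text \<open>The coordinates are bounded in turn: \<open>z\<^sub>1\<close> by the logarithmic
  estimate; then \<open>z\<^sub>0\<close> by Harnack, since a bound on \<open>z\<^sub>1\<close> puts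
  \<open>M + 1 - z\<^sub>0\<close> into the right half-plane; then the others by the inequality that
  defines the domain.\<close>

lemma normalized_curve_bound:
  assumes rho: "0 < \<rho>" "\<rho> < 1"
  shows "\<exists>C>0. \<forall>q G \<zeta> i. q \<in> normal_coeffs N \<longrightarrow> (\<forall>w. 0 \<le> levi N q w) \<longrightarrow> holomorphic_curve_on G (ball 0 1) \<longrightarrow>
       G 0 = axis i0 (- 1) \<longrightarrow> G ` ball 0 1 \<subseteq> mdom q \<longrightarrow> cmod \<zeta> \<le> \<rho> \<longrightarrow> cmod (G \<zeta> $ i) \<le> C"
proof -
  define R where "R = (1 + \<rho>) / 2"
  have R: "0 < R" "R < 1" "\<rho> < R" using rho by (auto simp: R_def)
  obtain C where C: "C > 0"
    "\<forall>q g f0 \<zeta>. q \<in> normal_coeffs N \<longrightarrow> (\<forall>w. 0 \<le> levi N q w) \<longrightarrow> g holomorphic_on ball 0 1 \<longrightarrow>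
       f0 holomorphic_on ball 0 1 \<longrightarrow> g 0 = 0 \<longrightarrow> f0 0 = - 1 \<longrightarrow>
       (\<forall>z. cmod z < 1 \<longrightarrow> Re (f0 z) + Re (pev N q (g z)) \<le> 0) \<longrightarrow> cmod \<zeta> \<le> R \<longrightarrow> cmod (g \<zeta>) \<le> C"
    using normalized_disc_bound[OF N2 R(1,2)] by (elim exE conjE) (rule that)
  define B where "B = max 1 C"
  define M where "M = (real N + 1)\<^sup>2 * 1 * B ^ (2 * N)"
  have M: "M \<ge> 0" by (simp add: M_def B_def)
  define r where "r = \<rho> / R"
  have r: "0 < r" "r < 1" "\<rho> = r * R" using R rho by (auto simp: r_def)
  \<comment> \<open>\<open>M + 2\<close> is the value of \<open>M + 1 - G x $ i0\<close> at the
    centre, where \<open>G 0 $ i0 = - 1\<close>.\<close>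
  define K where "K = (1 + r) / (1 - r) * (M + 2)"
  have K: "K \<ge> 0" unfolding K_def using r M by (intro mult_nonneg_nonneg divide_nonneg_nonneg) auto
  show ?thesis
  proof (intro exI[of _ "C + (M + 1 + K) + (M + 2 + K + M)"] conjI allI impI)
    show "C + (M + 1 + K) + (M + 2 + K + M) > 0" using C M K by linarith
    fix q :: "nat \<times> nat \<Rightarrow> complex" and G :: "complex \<Rightarrow> complex ^ 'n" and \<zeta> :: complex and i :: 'n
    assume q: "q \<in> normal_coeffs N" and levi: "\<forall>w. 0 \<le> levi N q w" and G: "holomorphic_curve_on G (ball 0 1)"
      and G0: "G 0 = axis i0 (- 1)" and im: "G ` ball 0 1 \<subseteq> mdom q" and z: "cmod \<zeta> \<le> \<rho>"
    have hol: "(\<lambda>t. G t $ i) holomorphic_on ball 0 1" for i using G by (simp add: holomorphic_curve_on_def)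
    have neg: "mfun q (G x) < 0" if "cmod x < 1" for x using im that by (auto simp: mdom_def image_subset_iff)
    have neg2: "Re (G x $ i0) + Re (pev N q (G x $ i1)) \<le> 0" if "cmod x < 1" for x
    proof -
      have "0 \<le> (\<Sum>\<alpha>\<in>- {i0, i1}. (cmod (G x $ \<alpha>))\<^sup>2)" by (intro sum_nonneg) auto
      then show ?thesis using neg[OF that] by (simp add: mfun_def)
    qed
    have g: "cmod (G x $ i1) \<le> C" if "cmod x \<le> R" for x
      by (rule C(2)[rule_format, OF q levi[rule_format] hol hol _ _ neg2 that]) (use i01 in \<open>auto simp: G0 axis_def\<close>)
    have p: "\<bar>Re (pev N q (G x $ i1))\<bar> \<le> M" if "cmod x \<le> R" for x
    proof -
      have "cmod (pev N q (G x $ i1)) \<le> M" unfolding M_def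
        using g[OF that] q by (intro pev_bound) (auto simp: B_def normal_coeffs_def)
      then show ?thesis using abs_Re_le_cmod[of "pev N q (G x $ i1)"] by linarith
    qed
    have "cmod (of_real (M + 1) - G \<zeta> $ i0) \<le> (1 + r) / (1 - r) * Re (of_real (M + 1) - G 0 $ i0)"
    proof (rule harnack_norm_ball[where R = R and f = "\<lambda>x. of_real (M + 1) - G x $ i0"])
      show "(\<lambda>x. of_real (M + 1) - G x $ i0) holomorphic_on ball 0 R"
        using R by (intro holomorphic_intros holomorphic_on_subset[OF hol]) auto
      show "0 < Re (of_real (M + 1) - G x $ i0)" if "cmod x < R" for x
        using neg2[of x] p[of x] that R by simp
      show "Im (of_real (M + 1) - G 0 $ i0) = 0" by (simp add: G0 axis_def)
    qed (use z r R in auto)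
    also have "(1 + r) / (1 - r) * Re (of_real (M + 1) - G 0 $ i0) = K" by (simp add: K_def G0 axis_def)
    finally have "cmod (of_real (M + 1) - G \<zeta> $ i0) \<le> K" .
    then have b0: "cmod (G \<zeta> $ i0) \<le> M + 1 + K"
      using norm_triangle_ineq4[of "of_real (M + 1)" "of_real (M + 1) - G \<zeta> $ i0"] M by simp
    have z1: "cmod \<zeta> < 1" "cmod \<zeta> \<le> R" using z rho R by auto
    have b1: "cmod (G \<zeta> $ i1) \<le> C" using g z1 by blast
    have b2: "cmod (G \<zeta> $ i) \<le> M + 2 + K + M" if "i \<in> - {i0, i1}"
    proof -
      have "(cmod (G \<zeta> $ i))\<^sup>2 \<le> (\<Sum>\<alpha>\<in>- {i0, i1}. (cmod (G \<zeta> $ \<alpha>))\<^sup>2)"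
        using that by (intro member_le_sum) auto
      also have "\<dots> \<le> - Re (G \<zeta> $ i0) - Re (pev N q (G \<zeta> $ i1))" using neg[OF z1(1)] by (simp add: mfun_def)
      also have "\<dots> \<le> M + 1 + K + M" using p[OF z1(2)] b0 abs_Re_le_cmod[of "G \<zeta> $ i0"] by linarith
      finally have "(cmod (G \<zeta> $ i))\<^sup>2 \<le> M + 1 + K + M" .
      moreover have "cmod (G \<zeta> $ i) \<le> 1 + (cmod (G \<zeta> $ i))\<^sup>2"
      proof -
        have "2 * cmod (G \<zeta> $ i) \<le> 1 + (cmod (G \<zeta> $ i))\<^sup>2"
          using zero_le_power2[of "cmod (G \<zeta> $ i) - 1"] by (simp add: power2_eq_square algebra_simps)
        then show ?thesis using norm_ge_zero[of "G \<zeta> $ i"] by linarith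
      qed
      ultimately show ?thesis by linarith
    qed
    show "cmod (G \<zeta> $ i) \<le> C + (M + 1 + K) + (M + 2 + K + M)"
      using b0 b1 b2 C(1) M K by (cases "i = i0"; cases "i = i1") auto
  qed
qed

end

section \<open>Rescaling a model domain at an interior point\<close>

definition mixed :: "(nat \<times> nat \<Rightarrow> complex) \<Rightarrow> nat \<times> nat \<Rightarrow> complex" where
  "mixed c = (\<lambda>(j, k). if 1 \<le> j \<and> 1 \<le> k then c (j, k) else 0)"

text \<open>\<open>Re (hpart N c)\<close> collects the harmonic monomials of \<open>Re (pev N c)\<close> without the constant.\<close>

definition hpart :: "nat \<Rightarrow> (nat \<times> nat \<Rightarrow> complex) \<Rightarrow> complex \<Rightarrow> complex" where
  "hpart N c w = (\<Sum>a\<in>{1..N}. (c (a, 0) + cnj (c (0, a))) * w ^ a)"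

lemma pev_split: "Re (pev N c w) = Re (c (0, 0)) + Re (hpart N c w) + Re (pev N (mixed c) w)"
proof -
  have s: "sum f {..N} = f 0 + sum f {1..N}" for f :: "nat \<Rightarrow> complex"
  proof -
    have "{..N} = insert 0 {1..N}" by auto
    then show ?thesis by simp
  qed
  have "pev N c w = c (0, 0) + (\<Sum>k\<in>{1..N}. c (0, k) * cnj w ^ k) + (\<Sum>j\<in>{1..N}. c (j, 0) * w ^ j)
      + (\<Sum>j\<in>{1..N}. \<Sum>k\<in>{1..N}. c (j, k) * w ^ j * cnj w ^ k)"
    unfolding pev_def by (simp add: s sum.distrib)
  moreover have "pev N (mixed c) w = (\<Sum>j\<in>{1..N}. \<Sum>k\<in>{1..N}. c (j, k) * w ^ j * cnj w ^ k)"
  proof -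
    have "pev N (mixed c) w = (\<Sum>j\<in>{1..N}. \<Sum>k\<in>{1..N}. mixed c (j, k) * w ^ j * cnj w ^ k)"
      unfolding pev_def by (simp add: s mixed_def)
    also have "\<dots> = (\<Sum>j\<in>{1..N}. \<Sum>k\<in>{1..N}. c (j, k) * w ^ j * cnj w ^ k)"
      by (intro sum.cong refl) (simp add: mixed_def)
    finally show ?thesis .
  qed
  moreover have "Re (\<Sum>k\<in>{1..N}. c (0, k) * cnj w ^ k) = Re (\<Sum>k\<in>{1..N}. cnj (c (0, k)) * w ^ k)"
  proof -
    have "(\<Sum>k\<in>{1..N}. c (0, k) * cnj w ^ k) = cnj (\<Sum>k\<in>{1..N}. cnj (c (0, k)) * w ^ k)" by simp
    then show ?thesis by (metis complex_cnj(1) cnj.sel(1))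
  qed
  moreover have "hpart N c w = (\<Sum>j\<in>{1..N}. c (j, 0) * w ^ j) + (\<Sum>k\<in>{1..N}. cnj (c (0, k)) * w ^ k)"
    unfolding hpart_def by (simp add: distrib_right sum.distrib)
  ultimately show ?thesis by simp
qed

lemma hpart_0: "hpart N c 0 = 0"
  unfolding hpart_def by (intro sum.neutral) auto

lemma hpart_holomorphic: "hpart N c holomorphic_on A"
  unfolding hpart_def by (intro holomorphic_intros)

lemma hpart_deriv:
  assumes "1 \<le> N"
  shows "(hpart N c has_field_derivative (c (1, 0) + cnj (c (0, 1)))) (at 0)"
proof -
  have "((\<lambda>w. \<Sum>a\<in>{1..N}. (c (a, 0) + cnj (c (0, a))) * w ^ a) has_field_derivative
     (\<Sum>a\<in>{1..N}. (c (a, 0) + cnj (c (0, a))) * (of_nat a * 0 ^ (a - 1)))) (at 0)"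
    by (intro DERIV_sum DERIV_cmult) (auto intro!: derivative_eq_intros)
  moreover have "(\<Sum>a\<in>{1..N}. (c (a, 0) + cnj (c (0, a))) * (of_nat a * 0 ^ (a - 1))) =
     (\<Sum>a\<in>{1..N}. if a = 1 then c (a, 0) + cnj (c (0, a)) else 0)"
    by (intro sum.cong refl) (auto simp: power_0_left)
  moreover have "\<dots> = c (1, 0) + cnj (c (0, 1))" using assms by (simp add: sum.delta)
  ultimately show ?thesis unfolding hpart_def[abs_def] by simp
qed

text \<open>The largest scale at which no term exceeds \<open>\<delta>\<close>, namely the minimum
  of \<open>(\<delta> / |c x|)^(1 / degree)\<close> over the nonzero coefficients. A term that
  attains it turns into a coefficient of modulus 1.\<close>

lemma normalizing_scale:
  fixes c :: "nat \<times> nat \<Rightarrow> complex"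
  assumes "x0 \<in> {1..N} \<times> {1..N}" "c x0 \<noteq> 0" "\<delta> > 0"
  obtains \<tau> where "\<tau> > 0" "\<And>x. x \<in> {1..N} \<times> {1..N} \<Longrightarrow> cmod (c x) * \<tau> ^ (fst x + snd x) \<le> \<delta>"
    "\<exists>x\<in>{1..N} \<times> {1..N}. cmod (c x) * \<tau> ^ (fst x + snd x) = \<delta>"
proof -
  define I where "I = {x \<in> {1..N} \<times> {1..N}. c x \<noteq> 0}"
  define t where "t x = root (fst x + snd x) (\<delta> / cmod (c x))" for x
  have "x0 \<in> I" using assms by (simp add: I_def)
  moreover have "finite I" unfolding I_def by auto
  ultimately have I: "finite (t ` I)" "t ` I \<noteq> {}" by auto
  have tp: "t x ^ (fst x + snd x) = \<delta> / cmod (c x)" "t x > 0" if "x \<in> I" for x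
    using that assms unfolding t_def I_def by (auto intro!: real_root_pow_pos2 real_root_gt_zero)
  define \<tau> where "\<tau> = Min (t ` I)"
  obtain x1 where x1: "x1 \<in> I" "\<tau> = t x1" using Min_in[OF I] unfolding \<tau>_def by auto
  show thesis
  proof (rule that[of \<tau>])
    show "\<tau> > 0" using x1 tp by simp
    show "cmod (c x) * \<tau> ^ (fst x + snd x) \<le> \<delta>" if x: "x \<in> {1..N} \<times> {1..N}" for x
    proof (cases "x \<in> I")
      case True
      then have "\<tau> \<le> t x" unfolding \<tau>_def using I(1) by (intro Min_le) auto
      then have "\<tau> ^ (fst x + snd x) \<le> \<delta> / cmod (c x)" using tp[OF True] \<open>\<tau> > 0\<close> by (metis less_imp_le power_mono)
      then show ?thesis using True by (simp add: I_def field_simps)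
    next
      case False
      then have "c x = 0" using x by (auto simp: I_def)
      then show ?thesis using assms by simp
    qed
    show "\<exists>x\<in>{1..N} \<times> {1..N}. cmod (c x) * \<tau> ^ (fst x + snd x) = \<delta>"
      using x1 tp(1)[OF x1(1)] by (intro bexI[of _ x1]) (auto simp: I_def)
  qed
qed

text \<open>Recentring moves a monomial only to smaller exponents, and in total degree at most
  \<open>N\<close> nothing but the monomial itself reaches \<open>(j0, k0)\<close>. The lower bound
  \<open>\<kappa>\<close> is thus the same at every point.\<close>

lemma shift_top:
  assumes "\<And>j k. c (j, k) \<noteq> 0 \<Longrightarrow> j + k \<le> N" "j0 + k0 = N"
  shows "shift N p c (j0, k0) = c (j0, k0)"
proof -
  have "shift N p c (j0, k0) = (\<Sum>j\<le>N. \<Sum>k\<le>N. if j = j0 then if k = k0 then c (j, k) else 0 else 0)"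
    unfolding shift_def split
  proof (intro sum.cong refl)
    fix j k
    have "c (j, k) = 0 \<or> j < j0 \<or> k < k0 \<or> (j = j0 \<and> k = k0)" using assms(1)[of j k] assms(2) by linarith
    then show "c (j, k) * of_nat (j choose j0) * of_nat (k choose k0) * p ^ (j - j0) * cnj p ^ (k - k0)
      = (if j = j0 then if k = k0 then c (j, k) else 0 else 0)"
      by (elim disjE) (auto simp: binomial_eq_0)
  qed
  also have "\<dots> = (\<Sum>j\<le>N. if j = j0 then c (j, k0) else 0)"
    using assms by (intro sum.cong refl) (simp add: sum.delta)
  also have "\<dots> = c (j0, k0)" using assms by (simp add: sum.delta)
  finally show ?thesis .
qed

context model_family
begin

text \<open>The shear that replaces \<open>z\<^sub>0\<close>: the first-order and pluriharmonic part of the defining function at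
  \<open>p\<close>, see \<open>mfun_expand\<close>.\<close>

definition normal_coord :: "(nat \<times> nat \<Rightarrow> complex) \<Rightarrow> complex ^ 'n \<Rightarrow> complex ^ 'n \<Rightarrow> complex" where
  "normal_coord c p z = z $ i0 - p $ i0 + hpart N (shift N (p $ i1) c) (z $ i1 - p $ i1)
     + (\<Sum>\<alpha>\<in>- {i0, i1}. 2 * cnj (p $ \<alpha>) * (z $ \<alpha> - p $ \<alpha>))"

lemma mfun_expand:
  "mfun c z = mfun c p + Re (normal_coord c p z) + Re (pev N (mixed (shift N (p $ i1) c)) (z $ i1 - p $ i1))
     + (\<Sum>\<alpha>\<in>- {i0, i1}. (cmod (z $ \<alpha> - p $ \<alpha>))\<^sup>2)"
proof -
  have 1: "Re (pev N c (z $ i1)) = Re (pev N c (p $ i1)) + Re (hpart N (shift N (p $ i1) c) (z $ i1 - p $ i1))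
     + Re (pev N (mixed (shift N (p $ i1) c)) (z $ i1 - p $ i1))"
    using pev_shift[of N c "p $ i1" "z $ i1 - p $ i1"] pev_split[of N "shift N (p $ i1) c" "z $ i1 - p $ i1"]
    by (simp add: shift_00)
  have "(cmod x)\<^sup>2 = (cmod y)\<^sup>2 + Re (2 * cnj y * (x - y)) + (cmod (x - y))\<^sup>2" for x y
    by (simp only: cmod_power2) (simp add: power2_eq_square algebra_simps)
  then have "(\<Sum>\<alpha>\<in>- {i0, i1}. (cmod (z $ \<alpha>))\<^sup>2) = (\<Sum>\<alpha>\<in>- {i0, i1}. (cmod (p $ \<alpha>))\<^sup>2
     + Re (2 * cnj (p $ \<alpha>) * (z $ \<alpha> - p $ \<alpha>)) + (cmod (z $ \<alpha> - p $ \<alpha>))\<^sup>2)"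
    by (intro sum.cong refl) blast
  then have 2: "(\<Sum>\<alpha>\<in>- {i0, i1}. (cmod (z $ \<alpha>))\<^sup>2) = (\<Sum>\<alpha>\<in>- {i0, i1}. (cmod (p $ \<alpha>))\<^sup>2)
     + Re (\<Sum>\<alpha>\<in>- {i0, i1}. 2 * cnj (p $ \<alpha>) * (z $ \<alpha> - p $ \<alpha>)) + (\<Sum>\<alpha>\<in>- {i0, i1}. (cmod (z $ \<alpha> - p $ \<alpha>))\<^sup>2)"
    by (simp only: sum.distrib Re_sum)
  show ?thesis unfolding mfun_def 1 2 normal_coord_def by simp
qed

text \<open>Apply \<open>normalized_curve_bound\<close> to the disc in normalized coordinates and
  undo the scales \<open>\<delta>\<close>, \<open>\<tau>\<close> and \<open>sqrt \<delta>\<close>.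
  The normalized polynomial depends on the centre but stays in the compact family, so the constant
  does not.\<close>

lemma disc_estimate:
  assumes rho: "0 < \<rho>" "\<rho> < 1"
  shows "\<exists>C>0. \<forall>c f. admissible c \<longrightarrow> holomorphic_curve_on f (ball 0 1) \<longrightarrow> f ` ball 0 1 \<subseteq> mdom c \<longrightarrow>
    (\<forall>\<zeta> i. cmod \<zeta> \<le> \<rho> \<longrightarrow> i \<noteq> i0 \<longrightarrow> cmod (f \<zeta> $ i - f 0 $ i) \<le> C * (root N (- mfun c (f 0) / \<kappa>) + sqrt (- mfun c (f 0))))
    \<and> (\<forall>\<zeta>. cmod \<zeta> \<le> \<rho> \<longrightarrow> cmod (normal_coord c (f 0) (f \<zeta>)) \<le> C * (- mfun c (f 0)))"
proof -
  obtain C where C: "C > 0" "\<forall>q G \<zeta> i. q \<in> normal_coeffs N \<longrightarrow> (\<forall>w. 0 \<le> levi N q w) \<longrightarrow> holomorphic_curve_on G (ball 0 1) \<longrightarrow>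
       G 0 = axis i0 (- 1) \<longrightarrow> G ` ball 0 1 \<subseteq> mdom q \<longrightarrow> cmod \<zeta> \<le> \<rho> \<longrightarrow> cmod (G \<zeta> $ i) \<le> C"
    using normalized_curve_bound[OF rho] by (elim exE conjE) (rule that)
  show ?thesis
  \<comment> \<open>The extra 1 compensates the translation that puts the centre at
    \<open>- 1\<close> in the normal coordinate.\<close>
  proof (rule exI[of _ "C + 1"], rule conjI, use C(1) in simp, intro allI impI)
    fix c :: "nat \<times> nat \<Rightarrow> complex" and f :: "complex \<Rightarrow> complex ^ 'n"
    assume admissible: "admissible c" and hol: "holomorphic_curve_on f (ball 0 1)" and im: "f ` ball 0 1 \<subseteq> mdom c"
    define p where "p = f 0"
    define \<delta> where "\<delta> = - mfun c p"
    have inD: "mfun c (f x) < 0" if "cmod x < 1" for x using im that by (auto simp: mdom_def image_subset_iff)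
    have d: "\<delta> > 0" using inD[of 0] by (simp add: \<delta>_def p_def)
    define c' where "c' = shift N (p $ i1) c"
    have top: "c' (j0, k0) = c (j0, k0)" unfolding c'_def
      using admissible jk0 by (intro shift_top) (auto simp: admissible_def)
    have ktop: "\<kappa> \<le> cmod (c' (j0, k0))" using admissible top by (simp add: admissible_def)
    then have "c' (j0, k0) \<noteq> 0" using kappa by auto
    moreover have in0: "(j0, k0) \<in> {1..N} \<times> {1..N}" using jk0 by auto
    ultimately obtain \<tau> where t: "\<tau> > 0" "\<And>x. x \<in> {1..N} \<times> {1..N} \<Longrightarrow> cmod (c' x) * \<tau> ^ (fst x + snd x) \<le> \<delta>"
        "\<exists>x\<in>{1..N} \<times> {1..N}. cmod (c' x) * \<tau> ^ (fst x + snd x) = \<delta>"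
      using normalizing_scale[of "(j0, k0)" N c' \<delta>] d by blast
    \<comment> \<open>The scale is controlled by the preserved top coefficient alone.\<close>
    have tN: "\<tau> \<le> root N (\<delta> / \<kappa>)"
    proof -
      have "\<kappa> * \<tau> ^ N \<le> cmod (c' (j0, k0)) * \<tau> ^ N" using ktop t by (intro mult_right_mono) auto
      also have "\<dots> \<le> \<delta>" using t(2)[OF in0] jk0 by simp
      finally have "\<tau> ^ N \<le> \<delta> / \<kappa>" using kappa by (simp add: field_simps)
      then have "root N (\<tau> ^ N) \<le> root N (\<delta> / \<kappa>)" using N2 by simp
      then show ?thesis using t(1) N2 by (simp add: real_root_power_cancel)
    qed
    define q where "q x = (if x \<in> {1..N} \<times> {1..N} then c' x * of_real (\<tau> ^ (fst x + snd x) / \<delta>) else 0)" for x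
    have cp_real: "pev N c' w \<in> \<real>" for w
      using admissible unfolding admissible_def c'_def by (metis pev_shift)
    have cmq: "cmod (q x) = cmod (c' x) * \<tau> ^ (fst x + snd x) / \<delta>" if "x \<in> {1..N} \<times> {1..N}" for x
      using that t(1) d by (simp add: q_def norm_mult norm_divide norm_power)
    have q: "q \<in> normal_coeffs N"
    proof -
      have "\<forall>j k. q (j, k) \<noteq> 0 \<longrightarrow> 1 \<le> j \<and> 1 \<le> k \<and> j \<le> N \<and> k \<le> N" by (auto simp: q_def split: if_splits)
      moreover have "cmod (q x) \<le> 1" for x
        using cmq[of x] t(2)[of x] d by (cases "x \<in> {1..N} \<times> {1..N}") (auto simp: q_def)
      moreover have "\<exists>x. cmod (q x) = 1"
      proof -
        obtain x where x: "x \<in> {1..N} \<times> {1..N}" "cmod (c' x) * \<tau> ^ (fst x + snd x) = \<delta>" using t(3) by blast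
        then have "cmod (q x) = 1" using cmq[OF x(1)] d by simp
        then show ?thesis by blast
      qed
      moreover have "cnj (q (prod.swap x)) = q x" for x
      proof (cases x)
        case (Pair j k)
        show ?thesis
        proof (cases "x \<in> {1..N} \<times> {1..N}")
          case True
          then have "cnj (c' (k, j)) = c' (j, k)"
            using pev_real_imp_hermitian[OF cp_real, of j k] Pair by simp
          then show ?thesis using True Pair by (simp add: q_def add.commute)
        qed (use Pair in \<open>auto simp: q_def\<close>)
      qed
      ultimately show ?thesis unfolding normal_coeffs_def by blast
    qed
    have qev: "pev N q w = pev N (mixed c') (of_real \<tau> * w) / of_real \<delta>" for w
    proof -
      have "pev N (mixed c') (of_real \<tau> * w) / of_real \<delta> = (\<Sum>j\<le>N. \<Sum>k\<le>N. mixed c' (j, k) * (of_real \<tau> * w) ^ j * cnj (of_real \<tau> * w) ^ k / of_real \<delta>)"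
        unfolding pev_def by (simp add: sum_divide_distrib)
      also have "\<dots> = pev N q w" unfolding pev_def
        by (intro sum.cong refl) (auto simp: mixed_def q_def power_mult_distrib power_add)
      finally show ?thesis by simp
    qed
    \<comment> \<open>Nonnegativity is transported through \<open>sub_at\<close>, by composition
      with an affine map and subtraction of a harmonic part, so no transformation rule for
      \<open>levi\<close> is called for.\<close>
    have levi: "0 \<le> levi N q w" for w
    proof -
      have e: "Re (pev N q x) = 1 / \<delta> * (Re (pev N c (of_real \<tau> * x + p $ i1)) + - Re (c' (0,0) + hpart N c' (of_real \<tau> * x)))" for x
        using pev_shift[of N c "p $ i1" "of_real \<tau> * x"] pev_split[of N c' "of_real \<tau> * x"] d
        by (simp add: qev c'_def[symmetric] add.commute field_simps)
      have "sub_at (\<lambda>x. Re (pev N c x)) z" for z using admissible N2 by (simp add: sub_at_pev_iff admissible_def)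
      then have 1: "sub_at (\<lambda>x. Re (pev N c (of_real \<tau> * x + p $ i1))) w"
        by (rule sub_at_compose[where k = "\<lambda>x. Re (pev N c x)" and g = "\<lambda>x. of_real \<tau> * x + p $ i1" and S = UNIV])
          (auto intro!: holomorphic_intros)
      have "hpart N c' \<circ> (\<lambda>x. of_real \<tau> * x) holomorphic_on UNIV"
        by (intro holomorphic_on_compose hpart_holomorphic holomorphic_intros)
      then have "(\<lambda>x. c' (0,0) + hpart N c' (of_real \<tau> * x)) holomorphic_on UNIV"
        unfolding o_def by (intro holomorphic_intros)
      then have 2: "sub_at (\<lambda>x. - Re (c' (0,0) + hpart N c' (of_real \<tau> * x))) w"
        by (rule sub_at_minus_Re) auto
      have "sub_at (\<lambda>x. 1 / \<delta> * (Re (pev N c (of_real \<tau> * x + p $ i1)) + - Re (c' (0,0) + hpart N c' (of_real \<tau> * x)))) w"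
        using d by (intro sub_at_cmult[OF sub_at_add[OF 1 2]]) simp
      then show ?thesis using sub_at_pev_iff[OF N2, of q w] by (simp only: e)
    qed
    define G where "G \<zeta> = (\<chi> i. if i = i0 then normal_coord c p (f \<zeta>) / of_real \<delta> - 1 else if i = i1 then (f \<zeta> $ i1 - p $ i1) / of_real \<tau>
       else (f \<zeta> $ i - p $ i) / of_real (sqrt \<delta>))" for \<zeta>
    have G0: "G \<zeta> $ i0 = normal_coord c p (f \<zeta>) / of_real \<delta> - 1" for \<zeta> by (simp add: G_def)
    have G1: "G \<zeta> $ i1 = (f \<zeta> $ i1 - p $ i1) / of_real \<tau>" for \<zeta> using i01 by (simp add: G_def)
    have Ga: "G \<zeta> $ i = (f \<zeta> $ i - p $ i) / of_real (sqrt \<delta>)" if "i \<in> - {i0, i1}" for \<zeta> i using that by (simp add: G_def)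
    have holf: "(\<lambda>t. f t $ i) holomorphic_on ball 0 1" for i using hol by (simp add: holomorphic_curve_on_def)
    have hole: "(\<lambda>t. normal_coord c p (f t)) holomorphic_on ball 0 1"
    proof -
      have "(hpart N c' \<circ> (\<lambda>t. f t $ i1 - p $ i1)) holomorphic_on ball 0 1"
        by (intro holomorphic_on_compose hpart_holomorphic holomorphic_intros holf)
      then show ?thesis unfolding normal_coord_def c'_def[symmetric] o_def by (intro holomorphic_intros holf)
    qed
    have holG: "holomorphic_curve_on G (ball 0 1)"
      unfolding holomorphic_curve_on_def
    proof
      fix i
      consider "i = i0" | "i = i1" | "i \<in> - {i0, i1}" by blast
      then show "(\<lambda>t. G t $ i) holomorphic_on ball 0 1"
      proof cases
        case 1 then show ?thesis using d by (simp add: G0) (intro holomorphic_intros hole, simp)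
      next
        case 2 then show ?thesis using t by (simp add: G1) (intro holomorphic_intros holf, simp)
      next
        case 3 then show ?thesis using d by (simp only: Ga[OF 3]) (intro holomorphic_intros holf, simp)
      qed
    qed
    have ep: "normal_coord c p p = 0" by (simp add: normal_coord_def hpart_0)
    have Gz: "G 0 = axis i0 (- 1)"
      unfolding vec_eq_iff using ep by (auto simp: G_def axis_def p_def)
    have mG: "mfun q (G x) = mfun c (f x) / \<delta>" for x
    proof -
      have "(\<Sum>\<alpha>\<in>- {i0, i1}. (cmod (G x $ \<alpha>))\<^sup>2) = (\<Sum>\<alpha>\<in>- {i0, i1}. (cmod (f x $ \<alpha> - p $ \<alpha>))\<^sup>2) / \<delta>"
        unfolding sum_divide_distrib using d by (intro sum.cong refl) (simp only: Ga, simp add: norm_divide power_divide)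
      moreover have "Re (pev N q (G x $ i1)) = Re (pev N (mixed c') (f x $ i1 - p $ i1)) / \<delta>"
        using t(1) by (simp add: qev G1)
      ultimately show ?thesis
        unfolding mfun_def[of q] using mfun_expand[of c "f x" p] d
        by (simp add: G0 \<delta>_def c'_def[symmetric] field_simps)
    qed
    have imG: "G ` ball 0 1 \<subseteq> mdom q"
      using inD d by (auto simp: mdom_def mG divide_less_0_iff)
    have bd: "cmod (G \<zeta> $ i) \<le> C" if "cmod \<zeta> \<le> \<rho>" for \<zeta> i
      by (rule C(2)[rule_format, OF q levi holG Gz imG that])
    have r0: "0 \<le> root N (\<delta> / \<kappa>)" using d kappa N2 by (intro real_root_pos_pos_le) auto
    show "(\<forall>\<zeta> i. cmod \<zeta> \<le> \<rho> \<longrightarrow> i \<noteq> i0 \<longrightarrow> cmod (f \<zeta> $ i - f 0 $ i) \<le> (C + 1) * (root N (- mfun c (f 0) / \<kappa>) + sqrt (- mfun c (f 0))))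
    \<and> (\<forall>\<zeta>. cmod \<zeta> \<le> \<rho> \<longrightarrow> cmod (normal_coord c (f 0) (f \<zeta>)) \<le> (C + 1) * (- mfun c (f 0)))"
      unfolding p_def[symmetric] \<delta>_def[symmetric]
    proof (intro conjI allI impI)
      fix \<zeta> i assume z: "cmod \<zeta> \<le> \<rho>" and i: "i \<noteq> i0"
      show "cmod (f \<zeta> $ i - p $ i) \<le> (C + 1) * (root N (\<delta> / \<kappa>) + sqrt \<delta>)"
      proof (cases "i = i1")
        case True
        have "cmod (f \<zeta> $ i1 - p $ i1) = cmod (G \<zeta> $ i1) * \<tau>" using t(1) by (simp add: G1 norm_divide)
        also have "\<dots> \<le> C * root N (\<delta> / \<kappa>)" using bd[OF z] tN C(1) t(1) by (intro mult_mono) auto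
        also have "\<dots> \<le> (C + 1) * (root N (\<delta> / \<kappa>) + sqrt \<delta>)" using C(1) d r0 by (intro mult_mono) auto
        finally show ?thesis using True by simp
      next
        case False
        then have "i \<in> - {i0, i1}" using i by auto
        then have "cmod (f \<zeta> $ i - p $ i) = cmod (G \<zeta> $ i) * sqrt \<delta>" using d by (simp add: Ga norm_divide)
        also have "\<dots> \<le> C * sqrt \<delta>" using bd[OF z] d by (intro mult_right_mono) auto
        also have "\<dots> \<le> (C + 1) * (root N (\<delta> / \<kappa>) + sqrt \<delta>)" using C(1) d r0 by (intro mult_mono) auto
        finally show ?thesis .
      qed
    next
      fix \<zeta> assume z: "cmod \<zeta> \<le> \<rho>"
      have "normal_coord c p (f \<zeta>) / of_real \<delta> = G \<zeta> $ i0 + 1" by (simp add: G0)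
      then have "cmod (normal_coord c p (f \<zeta>) / of_real \<delta>) \<le> C + 1"
        using bd[OF z, of i0] norm_triangle_ineq[of "G \<zeta> $ i0" 1] by simp
      then show "cmod (normal_coord c p (f \<zeta>)) \<le> (C + 1) * \<delta>" using d by (simp add: norm_divide field_simps)
    qed
  qed
qed

end

section \<open>Estimates for the Kobayashi metric\<close>

lemma norm_vector_smult: "norm (c *s (v :: complex ^ 'n)) = cmod c * norm v"
  unfolding norm_vec_def by (simp add: norm_mult L2_set_right_distrib)

lemma kobayashi_metric_le:
  assumes "holomorphic_curve_on f (ball 0 1)" "f ` ball 0 1 \<subseteq> D" "f 0 = p" "l *s curve_deriv f 0 = X"
  shows "kobayashi_metric D p X \<le> cmod l"
  unfolding kobayashi_metric_def
proof (rule cInf_lower)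
  show "bdd_below {cmod l |l f. holomorphic_curve_on f (ball 0 1) \<and> f ` ball 0 1 \<subseteq> D \<and> f 0 = p \<and> l *s curve_deriv f 0 = X}"
    by (rule bdd_belowI[of _ 0]) auto
qed (use assms in blast)

lemma linear_disc:
  fixes p v :: "complex ^ 'n"
  assumes "cball p (norm v) \<subseteq> D"
  shows "holomorphic_curve_on (\<lambda>t. p + t *s v) (ball 0 1)" "(\<lambda>t. p + t *s v) ` ball 0 1 \<subseteq> D"
    "curve_deriv (\<lambda>t. p + t *s v) 0 = v"
proof -
  show "holomorphic_curve_on (\<lambda>t. p + t *s v) (ball 0 1)"
    unfolding holomorphic_curve_on_def by (auto intro!: holomorphic_intros)
  have "p + t *s v \<in> cball p (norm v)" if "cmod t < 1" for t
    using that by (simp add: dist_norm norm_vector_smult mult_left_le_one_le)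
  then show "(\<lambda>t. p + t *s v) ` ball 0 1 \<subseteq> D" using assms by auto
  have "deriv (\<lambda>s. p $ i + s * v $ i) 0 = v $ i" for i
    by (rule DERIV_imp_deriv) (auto intro!: derivative_eq_intros)
  then show "curve_deriv (\<lambda>t. p + t *s v) 0 = v" by (simp add: curve_deriv_def vec_eq_iff)
qed

lemma kobayashi_metric_le_ball:
  fixes p X :: "complex ^ 'n"
  assumes "cball p r \<subseteq> D" "r > 0"
  shows "kobayashi_metric D p X \<le> norm X / r"
proof (cases "X = 0")
  case True
  have *: "cball p (norm (0 :: complex ^ 'n)) \<subseteq> D" using assms by auto
  show ?thesis using kobayashi_metric_le[OF linear_disc(1,2)[OF *], of p 0 X] True by simp
next
  case False
  define v where "v = of_real (r / norm X) *s X"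
  have nv: "norm v = r" using False assms unfolding v_def by (simp add: norm_vector_smult norm_divide)
  then have *: "cball p (norm v) \<subseteq> D" using assms by simp
  have "of_real (norm X / r) *s v = X" using False assms by (simp add: v_def vec_eq_iff)
  then have "kobayashi_metric D p X \<le> cmod (of_real (norm X / r))"
    using linear_disc(3)[OF *] by (intro kobayashi_metric_le[OF linear_disc(1,2)[OF *]]) auto
  then show ?thesis using assms by (simp add: norm_divide)
qed

lemma kobayashi_discs_nonempty:
  fixes p X :: "complex ^ 'n"
  assumes "open D" "p \<in> D"
  shows "{cmod l |l f. holomorphic_curve_on f (ball 0 1) \<and> f ` ball 0 1 \<subseteq> D \<and> f 0 = p \<and> l *s curve_deriv f 0 = X} \<noteq> {}"
proof -
  obtain r where r: "r > 0" "cball p r \<subseteq> D" using assms open_contains_cball by blast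
  define v where "v = of_real (r / (norm X + 1)) *s X"
  have "norm v = norm X * r / (norm X + 1)"
    using r unfolding v_def by (simp add: norm_vector_smult add_nonneg_pos del: of_real_divide)
  also have "\<dots> \<le> r" using r by (simp add: field_simps add_pos_nonneg)
  finally have *: "cball p (norm v) \<subseteq> D" using r by auto
  have "norm X + 1 > 0" by (simp add: add_nonneg_pos)
  then have "complex_of_real (norm X + 1) \<noteq> 0" unfolding of_real_eq_0_iff by linarith
  then have "of_real ((norm X + 1) / r) *s v = X" using r unfolding v_def by (simp add: vec_eq_iff flip: of_real_mult)
  then have "of_real ((norm X + 1) / r) *s curve_deriv (\<lambda>t. p + t *s v) 0 = X" using linear_disc(3)[OF *] by simp
  then show ?thesis using linear_disc(1,2)[OF *] by force
qed

lemma kobayashi_metric_nonneg: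
  fixes p X :: "complex ^ 'n"
  assumes "open D" "p \<in> D"
  shows "0 \<le> kobayashi_metric D p X"
  unfolding kobayashi_metric_def by (rule cInf_greatest[OF kobayashi_discs_nonempty[OF assms]]) auto

lemma kobayashi_metric_geI:
  fixes p X :: "complex ^ 'n"
  assumes "open D" "p \<in> D" "\<And>l f. holomorphic_curve_on f (ball 0 1) \<Longrightarrow> f ` ball 0 1 \<subseteq> D \<Longrightarrow> f 0 = p \<Longrightarrow> l *s curve_deriv f 0 = X \<Longrightarrow> a \<le> cmod l"
  shows "a \<le> kobayashi_metric D p X"
  unfolding kobayashi_metric_def by (rule cInf_greatest[OF kobayashi_discs_nonempty[OF assms(1,2)]]) (use assms(3) in blast)

lemma kobayashi_metric_lessD:
  fixes p X :: "complex ^ 'n"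
  assumes "open D" "p \<in> D" "kobayashi_metric D p X < B"
  shows "\<exists>l f. holomorphic_curve_on f (ball 0 1) \<and> f ` ball 0 1 \<subseteq> D \<and> f 0 = p \<and> l *s curve_deriv f 0 = X \<and> cmod l < B"
  using cInf_lessD[OF kobayashi_discs_nonempty[OF assms(1,2)] assms(3)[unfolded kobayashi_metric_def]] by blast

lemma deriv_bound_half:
  assumes "f holomorphic_on ball 0 1" "\<And>z. cmod z \<le> 1/2 \<Longrightarrow> cmod (f z - a) \<le> B"
  shows "cmod (deriv f 0) \<le> 2 * B"
proof -
  have f: "f holomorphic_on cball 0 (1/2)" using assms(1) by (rule holomorphic_on_subset) auto
  have "deriv (\<lambda>z. f z - a) 0 = deriv f 0"
    using assms(1) by (subst deriv_diff) (auto simp: holomorphic_on_imp_differentiable_at)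
  moreover have "norm ((deriv ^^ 1) (\<lambda>z. f z - a) 0) \<le> fact 1 * B / (1/2) ^ 1"
  proof (rule Cauchy_inequality)
    show "(\<lambda>z. f z - a) holomorphic_on ball 0 (1/2)"
      using assms(1) by (intro holomorphic_intros) (auto elim: holomorphic_on_subset)
    show "continuous_on (cball 0 (1/2)) (\<lambda>z. f z - a)" using f by (intro continuous_intros holomorphic_on_imp_continuous_on)
  qed (use assms(2) in auto)
  ultimately show ?thesis by simp
qed

lemma pev_has_derivative:
  assumes "2 \<le> N"
  shows "((\<lambda>z. Re (pev N c z)) has_derivative (\<lambda>X. Re (pev_dz N c z * X))) (at z)"
proof -
  obtain \<beta> where b: "\<And>e. e > 0 \<Longrightarrow> \<forall>\<^sub>F w in nhds 0.
    \<bar>Re (pev N c (z + w)) - (Re (pev N c z) + Re (pev_dz N c z * w + \<beta> * w\<^sup>2) + levi N c z * (cmod w)\<^sup>2)\<bar>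
     \<le> e * (cmod w)\<^sup>2" by (rule pev_taylor_eventually[OF assms, where c=c and z=z]) (rule that)
  define M where "M = 1 + cmod \<beta> + \<bar>levi N c z\<bar>"
  have "\<forall>\<^sub>F w in at 0. norm (norm (Re (pev N c (z + w)) - Re (pev N c z) - Re (pev_dz N c z * w)) / norm w) \<le> M * norm w"
    using b[OF zero_less_one] unfolding eventually_at_filter
  proof eventually_elim
    case (elim w)
    have "\<bar>Re (\<beta> * w\<^sup>2)\<bar> \<le> cmod \<beta> * (cmod w)\<^sup>2"
      by (metis abs_Re_le_cmod norm_mult norm_power)
    moreover have "\<bar>levi N c z * (cmod w)\<^sup>2\<bar> = \<bar>levi N c z\<bar> * (cmod w)\<^sup>2" by (simp add: abs_mult)
    ultimately have "\<bar>Re (pev N c (z + w)) - Re (pev N c z) - Re (pev_dz N c z * w)\<bar> \<le> M * (cmod w)\<^sup>2"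
      using elim unfolding M_def plus_complex.sel distrib_right by linarith
    then show ?case by (auto simp: field_simps power2_eq_square)
  qed
  moreover have "((\<lambda>w. M * norm w) \<longlongrightarrow> 0) (at (0::complex))"
    by (rule tendsto_eq_rhs, rule tendsto_intros, rule tendsto_const, rule tendsto_norm, rule tendsto_ident_at) simp
  ultimately have "((\<lambda>w. norm (Re (pev N c (z + w)) - Re (pev N c z) - Re (pev_dz N c z * w)) / norm w) \<longlongrightarrow> 0) (at 0)"
    by (rule Lim_null_comparison)
  moreover have "bounded_linear (\<lambda>X. Re (pev_dz N c z * X))"
    by (intro bounded_linear_compose[OF bounded_linear_Re] bounded_linear_mult_right)
  ultimately show ?thesis unfolding has_derivative_at by simp
qed

lemma shift_bound:
  assumes "\<And>x. cmod (c x) \<le> K" "cmod p \<le> B" "B \<ge> 1" "K \<ge> 0"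
  shows "cmod (shift N p c x) \<le> (real N + 1)\<^sup>2 * (K * 2 ^ N * 2 ^ N * B ^ N * B ^ N)"
proof -
  obtain a b where x: "x = (a, b)" by (cases x)
  have pw: "cmod p ^ (j - a) \<le> B ^ N" if "j \<le> N" for j a
  proof -
    have "cmod p ^ (j - a) \<le> B ^ (j - a)" using assms by (intro power_mono) auto
    also have "\<dots> \<le> B ^ N" using assms that by (intro power_increasing) auto
    finally show ?thesis .
  qed
  have bn: "real (j choose a) \<le> 2 ^ N" if "j \<le> N" for j a
  proof -
    have "j choose a \<le> 2 ^ j" by (rule binomial_le_pow2)
    also have "(2::nat) ^ j \<le> 2 ^ N" using that by (intro power_increasing) auto
    finally show ?thesis by (metis of_nat_le_iff of_nat_numeral of_nat_power)
  qed
  have "cmod (c (j, k) * of_nat (j choose a) * of_nat (k choose b) * p ^ (j - a) * cnj p ^ (k - b))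
     \<le> K * 2 ^ N * 2 ^ N * B ^ N * B ^ N" if "j \<le> N" "k \<le> N" for j k
    unfolding norm_mult norm_power norm_of_nat complex_mod_cnj
    using that assms by (intro mult_mono pw bn) auto
  then have "cmod (shift N p c x) \<le> (\<Sum>j\<le>N. \<Sum>k\<le>N. K * 2 ^ N * 2 ^ N * B ^ N * B ^ N)"
    unfolding shift_def x split by (intro sum_norm_le) auto
  also have "\<dots> = (real N + 1)\<^sup>2 * (K * 2 ^ N * 2 ^ N * B ^ N * B ^ N)" by (simp add: power2_eq_square algebra_simps)
  finally show ?thesis .
qed

lemma hpart_bound:
  assumes "\<And>x. cmod (c x) \<le> S" "cmod w \<le> W" "W \<ge> 1" "S \<ge> 0"
  shows "cmod (hpart N c w) \<le> real N * (2 * S * W ^ N)"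
proof -
  have "cmod ((c (a, 0) + cnj (c (0, a))) * w ^ a) \<le> 2 * S * W ^ N" if "a \<in> {1..N}" for a
  proof -
    have "cmod (c (a, 0) + cnj (c (0, a))) \<le> 2 * S"
      using norm_triangle_ineq[of "c (a, 0)" "cnj (c (0, a))"] assms(1)[of "(a,0)"] assms(1)[of "(0,a)"] by simp
    moreover have "cmod w ^ a \<le> W ^ N"
    proof -
      have "cmod w ^ a \<le> W ^ a" using assms by (intro power_mono) auto
      also have "\<dots> \<le> W ^ N" using assms that by (intro power_increasing) auto
      finally show ?thesis .
    qed
    ultimately show ?thesis unfolding norm_mult norm_power using assms by (intro mult_mono) auto
  qed
  then have "cmod (hpart N c w) \<le> (\<Sum>a\<in>{1..N}. 2 * S * W ^ N)"
    unfolding hpart_def by (intro sum_norm_le) auto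
  then show ?thesis by simp
qed

lemma has_derivative_pev_compose:
  assumes "2 \<le> N"
  shows "((\<lambda>z :: complex ^ 'n. Re (pev N c (z $ i))) has_derivative (\<lambda>X. Re (pev_dz N c (z $ i) * X $ i))) (at z)"
  by (rule has_derivative_compose[OF bounded_linear_imp_has_derivative[OF bounded_linear_vec_nth] pev_has_derivative[OF assms]])

context model_family
begin

text \<open>Twice the derivative \<open>\<partial>\<close> of the defining function in the direction \<open>X\<close>.\<close>

definition dmfun :: "(nat \<times> nat \<Rightarrow> complex) \<Rightarrow> complex ^ 'n \<Rightarrow> complex ^ 'n \<Rightarrow> complex" where
  "dmfun c p X = X $ i0 + pev_dz N c (p $ i1) * X $ i1 + (\<Sum>\<alpha>\<in>- {i0, i1}. 2 * cnj (p $ \<alpha>) * X $ \<alpha>)"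

lemma mfun_has_derivative: "(mfun c has_derivative (\<lambda>X. Re (dmfun c z X))) (at z)"
proof -
  have 1: "((\<lambda>z. Re (z $ i0)) has_derivative (\<lambda>X. Re (X $ i0))) (at z)"
    by (intro bounded_linear_imp_has_derivative bounded_linear_compose[OF bounded_linear_Re bounded_linear_vec_nth])
  have 2: "((\<lambda>z. (cmod (z $ i))\<^sup>2) has_derivative (\<lambda>X. Re (2 * cnj (z $ i) * X $ i))) (at z)" for i
  proof -
    have "((\<lambda>z. z $ i \<bullet> z $ i) has_derivative (\<lambda>X. z $ i \<bullet> X $ i + X $ i \<bullet> z $ i)) (at z)"
      by (intro has_derivative_inner bounded_linear_imp_has_derivative bounded_linear_vec_nth)
    then show ?thesis by (simp add: power2_norm_eq_inner inner_complex_def algebra_simps)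
  qed
  have "((\<lambda>z. Re (z $ i0) + Re (pev N c (z $ i1)) + (\<Sum>\<alpha>\<in>- {i0, i1}. (cmod (z $ \<alpha>))\<^sup>2)) has_derivative
     (\<lambda>X. Re (X $ i0) + Re (pev_dz N c (z $ i1) * X $ i1) + (\<Sum>\<alpha>\<in>- {i0, i1}. Re (2 * cnj (z $ \<alpha>) * X $ \<alpha>)))) (at z)"
    by (intro has_derivative_add has_derivative_sum 1 2 has_derivative_pev_compose N2)
  then show ?thesis unfolding mfun_def[abs_def] dmfun_def by (simp only: plus_complex.sel Re_sum)
qed

lemma continuous_on_mfun: "continuous_on A (mfun c)"
proof (rule continuous_at_imp_continuous_on, rule ballI)
  show "isCont (mfun c) x" for x by (rule has_derivative_continuous[OF mfun_has_derivative])
qed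

lemma open_mdom: "open (mdom c)"
proof -
  have "open (mfun c -` {..<0})" by (intro open_vimage continuous_on_mfun) auto
  then show ?thesis by (simp add: mdom_def vimage_def)
qed

lemma tendsto_mfun:
  assumes "\<And>x. ((\<lambda>k. c k x) \<longlongrightarrow> c' x) F" "(z \<longlongrightarrow> z') F"
  shows "((\<lambda>k. mfun (c k) (z k)) \<longlongrightarrow> mfun c' z') F"
proof -
  have [tendsto_intros]: "((\<lambda>k. z k $ i) \<longlongrightarrow> z' $ i) F" for i using assms(2) by (rule tendsto_vec_nth)
  show ?thesis unfolding mfun_def pev_def by (intro tendsto_intros assms(1))
qed

text \<open>At its centre the shear has complex derivative \<open>dmfun\<close>, so a bound on
  \<open>normal_coord\<close> along a disc becomes one on the derivative of the defining
  function.\<close>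

lemma normal_coord_deriv:
  assumes "holomorphic_curve_on f (ball 0 1)" "f 0 = p"
  shows "deriv (\<lambda>t. normal_coord c p (f t)) 0 = dmfun c p (curve_deriv f 0)" "(\<lambda>t. normal_coord c p (f t)) holomorphic_on ball 0 1"
proof -
  have hol: "(\<lambda>t. f t $ i) holomorphic_on ball 0 1" for i using assms by (simp add: holomorphic_curve_on_def)
  have d: "((\<lambda>t. f t $ i) has_field_derivative curve_deriv f 0 $ i) (at 0)" for i
    using hol[of i] unfolding curve_deriv_def by (simp add: holomorphic_derivI)
  have "1 \<le> N" using N2 by simp
  have "((\<lambda>t. hpart N (shift N (p $ i1) c) (f t $ i1 - p $ i1)) has_field_derivative pev_dz N c (p $ i1) * curve_deriv f 0 $ i1) (at 0)"
    unfolding pev_dz_def using hpart_deriv[OF \<open>1 \<le> N\<close>, of "shift N (p $ i1) c"] assms(2)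
    by (intro DERIV_chain'[of "\<lambda>t. f t $ i1 - p $ i1", where g = "hpart N (shift N (p $ i1) c)"]) (auto intro!: derivative_eq_intros d)
  then have "((\<lambda>t. normal_coord c p (f t)) has_field_derivative dmfun c p (curve_deriv f 0)) (at 0)"
    unfolding normal_coord_def dmfun_def by (auto intro!: derivative_eq_intros d DERIV_sum sum.cong)
  then show "deriv (\<lambda>t. normal_coord c p (f t)) 0 = dmfun c p (curve_deriv f 0)" by (rule DERIV_imp_deriv)
  have "(hpart N (shift N (p $ i1) c) \<circ> (\<lambda>t. f t $ i1 - p $ i1)) holomorphic_on ball 0 1"
    by (intro holomorphic_on_compose hpart_holomorphic holomorphic_intros hol)
  then show "(\<lambda>t. normal_coord c p (f t)) holomorphic_on ball 0 1" unfolding normal_coord_def o_def by (intro holomorphic_intros hol)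
qed

text \<open>Bounds, up to a constant, the directions \<open>z\<^sub>1\<close> and \<open>z\<^sub>*\<close> of discs centred at depth \<open>d\<close>.\<close>

definition polyradius :: "real \<Rightarrow> real" where
  "polyradius d = root N (d / \<kappa>) + sqrt d"

lemma polyradius_pos: "d > 0 \<Longrightarrow> polyradius d > 0"
  unfolding polyradius_def using kappa N2 by (intro add_pos_pos) auto

lemma polyradius_mono: "d \<le> d' \<Longrightarrow> polyradius d \<le> polyradius d'"
  unfolding polyradius_def using kappa N2 by (intro add_mono) (auto simp: divide_right_mono)

text \<open>Cauchy estimates on the disc of radius 1/2. The second bound is linear in the depth
  rather than of order \<open>polyradius\<close>; this is what later controls the logarithm of the
  depth.\<close>

lemma disc_deriv_estimate:
  "\<exists>C>0. \<forall>c f. admissible c \<longrightarrow> holomorphic_curve_on f (ball 0 1) \<longrightarrow> f ` ball 0 1 \<subseteq> mdom c \<longrightarrow>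
    (\<forall>i. i \<noteq> i0 \<longrightarrow> cmod (curve_deriv f 0 $ i) \<le> C * polyradius (- mfun c (f 0)))
    \<and> cmod (dmfun c (f 0) (curve_deriv f 0)) \<le> C * (- mfun c (f 0))"
proof -
  have half: "0 < (1 / 2 :: real)" "1 / 2 < (1 :: real)" by simp_all
  obtain C where C: "C > 0" "\<forall>c f. admissible c \<longrightarrow> holomorphic_curve_on f (ball 0 1) \<longrightarrow> f ` ball 0 1 \<subseteq> mdom c \<longrightarrow>
    (\<forall>\<zeta> i. cmod \<zeta> \<le> 1/2 \<longrightarrow> i \<noteq> i0 \<longrightarrow> cmod (f \<zeta> $ i - f 0 $ i) \<le> C * (root N (- mfun c (f 0) / \<kappa>) + sqrt (- mfun c (f 0))))
    \<and> (\<forall>\<zeta>. cmod \<zeta> \<le> 1/2 \<longrightarrow> cmod (normal_coord c (f 0) (f \<zeta>)) \<le> C * (- mfun c (f 0)))"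
    using disc_estimate[OF half] by (elim exE conjE) (rule that)
  show ?thesis
  proof (intro exI[of _ "2 * C"] conjI allI impI)
    fix c :: "nat \<times> nat \<Rightarrow> complex" and f :: "complex \<Rightarrow> complex ^ 'n"
    assume a: "admissible c" "holomorphic_curve_on f (ball 0 1)" "f ` ball 0 1 \<subseteq> mdom c"
    note * = C(2)[rule_format, OF a]
    have hol: "(\<lambda>t. f t $ i) holomorphic_on ball 0 1" for i using a by (simp add: holomorphic_curve_on_def)
    show "cmod (curve_deriv f 0 $ i) \<le> 2 * C * polyradius (- mfun c (f 0))" if i: "i \<noteq> i0" for i
    proof -
      have "cmod (deriv (\<lambda>t. f t $ i) 0) \<le> 2 * (C * polyradius (- mfun c (f 0)))"
        unfolding polyradius_def by (rule deriv_bound_half[OF hol, of _ "f 0 $ i"]) (use * i in blast)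
      then show ?thesis by (simp add: curve_deriv_def mult.assoc)
    qed
    have "cmod (deriv (\<lambda>t. normal_coord c (f 0) (f t)) 0) \<le> 2 * (C * - mfun c (f 0))"
      by (rule deriv_bound_half[OF normal_coord_deriv(2)[OF a(2) refl], where a = 0]) (use * in simp)
    then show "cmod (dmfun c (f 0) (curve_deriv f 0)) \<le> 2 * C * - mfun c (f 0)"
      unfolding normal_coord_deriv(1)[OF a(2) refl] by (simp add: mult.assoc)
  qed (use C in simp)
qed

text \<open>\<open>disc_estimate\<close> bounds the sheared coordinate only; undoing the shear to
  reach \<open>z\<^sub>0\<close> brings in the coefficients, the depth and the centre, hence
  \<open>K\<close>, \<open>\<Delta>\<close> and \<open>B\<close>.\<close>

lemma disc_bounded:
  assumes rho: "0 < \<rho>" "\<rho> < 1"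
  shows "\<exists>C>0. \<forall>c f. admissible c \<longrightarrow> (\<forall>x. cmod (c x) \<le> K) \<longrightarrow> holomorphic_curve_on f (ball 0 1) \<longrightarrow> f ` ball 0 1 \<subseteq> mdom c \<longrightarrow>
     - mfun c (f 0) \<le> \<Delta> \<longrightarrow> (\<forall>i. i \<noteq> i0 \<longrightarrow> cmod (f 0 $ i) \<le> B) \<longrightarrow> (\<forall>\<zeta> i. cmod \<zeta> \<le> \<rho> \<longrightarrow> cmod (f \<zeta> $ i - f 0 $ i) \<le> C)"
proof -
  obtain C where C: "C > 0" "\<forall>c f. admissible c \<longrightarrow> holomorphic_curve_on f (ball 0 1) \<longrightarrow> f ` ball 0 1 \<subseteq> mdom c \<longrightarrow>
    (\<forall>\<zeta> i. cmod \<zeta> \<le> \<rho> \<longrightarrow> i \<noteq> i0 \<longrightarrow> cmod (f \<zeta> $ i - f 0 $ i) \<le> C * (root N (- mfun c (f 0) / \<kappa>) + sqrt (- mfun c (f 0))))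
    \<and> (\<forall>\<zeta>. cmod \<zeta> \<le> \<rho> \<longrightarrow> cmod (normal_coord c (f 0) (f \<zeta>)) \<le> C * (- mfun c (f 0)))"
    using disc_estimate[OF rho] by (elim exE conjE) (rule that)
  \<comment> \<open>The maxima with 1 and 0 meet the side conditions of \<open>shift_bound\<close>
    for all \<open>B\<close> and \<open>K\<close>.\<close>
  define B' where "B' = max 1 B"
  define K' where "K' = max 0 K"
  define D where "D = \<bar>C * polyradius \<Delta>\<bar>"
  define W where "W = D + 1"
  define S where "S = (real N + 1)\<^sup>2 * (K' * 2 ^ N * 2 ^ N * B' ^ N * B' ^ N)"
  define H where "H = real N * (2 * S * W ^ N)"
  define T where "T = real (card (- {i0, i1})) * (2 * B' * D)"
  have S0: "S \<ge> 0" unfolding S_def K'_def B'_def by (intro mult_nonneg_nonneg) auto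
  have D0: "D \<ge> 0" by (simp add: D_def)
  have H0: "H \<ge> 0" unfolding H_def W_def using S0 D0 by (intro mult_nonneg_nonneg) auto
  have T0: "T \<ge> 0" unfolding T_def B'_def using D0 by (intro mult_nonneg_nonneg) auto
  show ?thesis
  proof (intro exI[of _ "D + 1 + (\<bar>C * \<Delta>\<bar> + H + T)"] conjI allI impI)
    show "0 < D + 1 + (\<bar>C * \<Delta>\<bar> + H + T)" using D0 H0 T0 by linarith
    fix c :: "nat \<times> nat \<Rightarrow> complex" and f :: "complex \<Rightarrow> complex ^ 'n" and \<zeta> :: complex and i :: 'n
    assume a: "admissible c" and cK: "\<forall>x. cmod (c x) \<le> K" and hol: "holomorphic_curve_on f (ball 0 1)" and im: "f ` ball 0 1 \<subseteq> mdom c"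
      and del: "- mfun c (f 0) \<le> \<Delta>" and B: "\<forall>i. i \<noteq> i0 \<longrightarrow> cmod (f 0 $ i) \<le> B" and z: "cmod \<zeta> \<le> \<rho>"
    note * = C(2)[rule_format, OF a hol im]
    have b1: "cmod (f \<zeta> $ i - f 0 $ i) \<le> D" if "i \<noteq> i0" for i
    proof -
      have "cmod (f \<zeta> $ i - f 0 $ i) \<le> C * polyradius (- mfun c (f 0))" using * z that by (simp add: polyradius_def)
      also have "\<dots> \<le> C * polyradius \<Delta>" using C(1) by (intro mult_left_mono polyradius_mono del) auto
      finally show ?thesis by (simp add: D_def)
    qed
    have b2: "cmod (normal_coord c (f 0) (f \<zeta>)) \<le> \<bar>C * \<Delta>\<bar>"
    proof -
      have "cmod (normal_coord c (f 0) (f \<zeta>)) \<le> C * (- mfun c (f 0))" using * z by blast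
      also have "\<dots> \<le> C * \<Delta>" using C(1) del by (intro mult_left_mono) auto
      finally show ?thesis by linarith
    qed
    have b3: "cmod (hpart N (shift N (f 0 $ i1) c) (f \<zeta> $ i1 - f 0 $ i1)) \<le> H"
      unfolding H_def
    proof (rule hpart_bound)
      show "cmod (shift N (f 0 $ i1) c x) \<le> S" for x unfolding S_def
      proof (rule shift_bound)
        show "cmod (c x) \<le> K'" for x using cK[rule_format, of x] by (simp add: K'_def)
        show "cmod (f 0 $ i1) \<le> B'" using B i01 by (auto simp: B'_def le_max_iff_disj)
      qed (auto simp: B'_def K'_def)
      show "cmod (f \<zeta> $ i1 - f 0 $ i1) \<le> W" using b1[of i1] i01 by (simp add: W_def)
    qed (use S0 D0 in \<open>auto simp: W_def\<close>)
    have b4: "cmod (\<Sum>\<alpha>\<in>- {i0, i1}. 2 * cnj (f 0 $ \<alpha>) * (f \<zeta> $ \<alpha> - f 0 $ \<alpha>)) \<le> T"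
    proof -
      have "cmod (2 * cnj (f 0 $ \<alpha>) * (f \<zeta> $ \<alpha> - f 0 $ \<alpha>)) \<le> 2 * B' * D" if "\<alpha> \<in> - {i0, i1}" for \<alpha>
        unfolding norm_mult using that b1[of \<alpha>] B D0 by (intro mult_mono) (auto simp: B'_def le_max_iff_disj)
      then have "cmod (\<Sum>\<alpha>\<in>- {i0, i1}. 2 * cnj (f 0 $ \<alpha>) * (f \<zeta> $ \<alpha> - f 0 $ \<alpha>)) \<le> (\<Sum>\<alpha>\<in>- {i0, i1}. 2 * B' * D)"
        by (intro sum_norm_le) auto
      then show ?thesis by (simp add: T_def)
    qed
    have b0: "cmod (f \<zeta> $ i0 - f 0 $ i0) \<le> \<bar>C * \<Delta>\<bar> + H + T"
    proof -
      let ?h = "hpart N (shift N (f 0 $ i1) c) (f \<zeta> $ i1 - f 0 $ i1)"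
      let ?s = "\<Sum>\<alpha>\<in>- {i0, i1}. 2 * cnj (f 0 $ \<alpha>) * (f \<zeta> $ \<alpha> - f 0 $ \<alpha>)"
      have "f \<zeta> $ i0 - f 0 $ i0 = normal_coord c (f 0) (f \<zeta>) - ?h - ?s" by (simp add: normal_coord_def)
      then have "cmod (f \<zeta> $ i0 - f 0 $ i0) \<le> cmod (normal_coord c (f 0) (f \<zeta>)) + cmod ?h + cmod ?s"
        using norm_triangle_ineq4[of "normal_coord c (f 0) (f \<zeta>) - ?h" ?s] norm_triangle_ineq4[of "normal_coord c (f 0) (f \<zeta>)" ?h] by simp
      then show ?thesis using b2 b3 b4 by linarith
    qed
    show "cmod (f \<zeta> $ i - f 0 $ i) \<le> D + 1 + (\<bar>C * \<Delta>\<bar> + H + T)"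
      using b0 b1[of i] D0 H0 T0 by (cases "i = i0") auto
  qed
qed

end

section \<open>Limits of the Kobayashi metric\<close>

lemma has_vector_derivative_vecI:
  fixes f :: "real \<Rightarrow> complex ^ 'n"
  assumes "\<And>i. ((\<lambda>t. f t $ i) has_vector_derivative v $ i) (at t)"
  shows "(f has_vector_derivative v) (at t)"
  unfolding has_vector_derivative_def has_derivative_def
proof (intro conjI bounded_linear_scaleR_left vec_tendstoI)
  fix i
  have "((\<lambda>y. ((f y $ i - f (Lim (at t) (\<lambda>x. x)) $ i) - (y - Lim (at t) (\<lambda>x. x)) *\<^sub>R v $ i) /\<^sub>R norm (y - Lim (at t) (\<lambda>x. x))) \<longlongrightarrow> 0) (at t)"
    using assms[of i] unfolding has_vector_derivative_def has_derivative_def by blast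
  then show "((\<lambda>y. (((f y - f (Lim (at t) (\<lambda>x. x))) - (y - Lim (at t) (\<lambda>x. x)) *\<^sub>R v) /\<^sub>R norm (y - Lim (at t) (\<lambda>x. x))) $ i) \<longlongrightarrow> 0 $ i) (at t)"
    by simp
qed

lemma holomorphic_curve_has_vector_derivative:
  assumes "holomorphic_curve_on f S" "open S" "of_real t * \<zeta> \<in> S"
  shows "((\<lambda>t. f (of_real t * \<zeta>)) has_vector_derivative \<zeta> *s curve_deriv f (of_real t * \<zeta>)) (at t)"
proof (rule has_vector_derivative_vecI)
  fix i
  have "((\<lambda>s. f s $ i) has_field_derivative curve_deriv f (of_real t * \<zeta>) $ i) (at (of_real t * \<zeta>))"
    using assms unfolding holomorphic_curve_on_def curve_deriv_def by (auto intro: holomorphic_derivI)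
  moreover have "((\<lambda>t. of_real t * \<zeta>) has_vector_derivative \<zeta>) (at t)"
    by (auto intro!: derivative_eq_intros simp: has_vector_derivative_def scaleR_conv_of_real)
  ultimately show "((\<lambda>t. f (of_real t * \<zeta>) $ i) has_vector_derivative (\<zeta> *s curve_deriv f (of_real t * \<zeta>)) $ i) (at t)"
    using field_vector_diff_chain_at[of "\<lambda>t. of_real t * \<zeta>" \<zeta> t "\<lambda>s. f s $ i"] by (simp add: o_def)
qed

text \<open>The largest disc about \<open>a\<close> inside the unit disc. Estimates at centres
  transfer to other points at the price of the factor \<open>1 - |a|\<close>.\<close>

lemma recentered_disc:
  assumes "holomorphic_curve_on f (ball 0 1)" "cmod a < 1"
  shows "holomorphic_curve_on (\<lambda>t. f (a + of_real (1 - cmod a) * t)) (ball 0 1)"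
    "(\<lambda>t. f (a + of_real (1 - cmod a) * t)) ` ball 0 1 \<subseteq> f ` ball 0 1"
    "curve_deriv (\<lambda>t. f (a + of_real (1 - cmod a) * t)) 0 = of_real (1 - cmod a) *s curve_deriv f a"
proof -
  let ?m = "\<lambda>t. a + of_real (1 - cmod a) * t"
  have m: "?m t \<in> ball 0 1" if "cmod t < 1" for t
  proof -
    have "cmod (?m t) \<le> cmod a + cmod (of_real (1 - cmod a) * t)" by (rule norm_triangle_ineq)
    also have "cmod (of_real (1 - cmod a) * t) = (1 - cmod a) * cmod t" using assms(2) by (simp add: norm_mult del: of_real_diff)
    also have "(1 - cmod a) * cmod t < (1 - cmod a) * 1" using assms(2) that by (intro mult_strict_left_mono) auto
    finally show ?thesis by simp
  qed
  then show "(\<lambda>t. f (?m t)) ` ball 0 1 \<subseteq> f ` ball 0 1" by auto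
  have hol: "(\<lambda>t. f t $ i) holomorphic_on ball 0 1" for i using assms by (simp add: holomorphic_curve_on_def)
  have "(\<lambda>t. f t $ i) \<circ> ?m holomorphic_on ball 0 1" for i
    by (rule holomorphic_on_compose_gen[OF _ hol]) (use m in \<open>auto intro!: holomorphic_intros\<close>)
  then show "holomorphic_curve_on (\<lambda>t. f (?m t)) (ball 0 1)" unfolding holomorphic_curve_on_def o_def by blast
  have "deriv (\<lambda>t. f (?m t) $ i) 0 = of_real (1 - cmod a) * deriv (\<lambda>t. f t $ i) a" for i
  proof (rule DERIV_imp_deriv)
    have "((\<lambda>t. f t $ i) has_field_derivative deriv (\<lambda>t. f t $ i) a) (at (?m 0))"
      using hol[of i] assms(2) by (auto intro: holomorphic_derivI)
    then have "((\<lambda>t. f (?m t) $ i) has_field_derivative deriv (\<lambda>t. f t $ i) a * of_real (1 - cmod a)) (at 0)"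
      by (rule DERIV_chain'[where f = ?m and g = "\<lambda>t. f t $ i", rotated]) (auto intro!: derivative_eq_intros)
    then show "((\<lambda>t. f (?m t) $ i) has_field_derivative of_real (1 - cmod a) * deriv (\<lambda>t. f t $ i) a) (at 0)"
      by (simp only: mult.commute)
  qed
  then show "curve_deriv (\<lambda>t. f (?m t)) 0 = of_real (1 - cmod a) *s curve_deriv f a"
    unfolding curve_deriv_def vec_eq_iff by (simp only: vec_lambda_beta vector_smult_component simp_thms)
qed

lemma montel_finite:
  fixes F :: "nat \<Rightarrow> complex \<Rightarrow> complex ^ 'n"
  assumes hol: "\<And>n. holomorphic_curve_on (F n) (ball 0 1)"
    and bd: "\<And>\<rho>. 0 < \<rho> \<Longrightarrow> \<rho> < 1 \<Longrightarrow> \<exists>B. \<forall>n \<zeta> i. cmod \<zeta> \<le> \<rho> \<longrightarrow> cmod (F n \<zeta> $ i) \<le> B"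
    and I: "finite I"
  shows "\<exists>r g. strict_mono (r :: nat \<Rightarrow> nat) \<and> (\<forall>i\<in>I. g i holomorphic_on ball 0 1 \<and>
     (\<forall>K. compact K \<and> K \<subseteq> ball 0 1 \<longrightarrow> uniform_limit K (\<lambda>n z. F (r n) z $ i) (g i) sequentially))"
  using I
proof (induction I)
  case empty
  show ?case by (rule exI[of _ id]) (auto simp: strict_mono_def)
next
  case (insert j I)
  then obtain r g where r: "strict_mono (r :: nat \<Rightarrow> nat)" and g: "\<And>i. i \<in> I \<Longrightarrow> g i holomorphic_on ball 0 1"
     "\<And>i K. i \<in> I \<Longrightarrow> compact K \<Longrightarrow> K \<subseteq> ball 0 1 \<Longrightarrow> uniform_limit K (\<lambda>n z. F (r n) z $ i) (g i) sequentially"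
    by blast
  define \<H> where "\<H> = range (\<lambda>n z. F n z $ j)"
  have bdK: "\<exists>B. \<forall>h\<in>\<H>. \<forall>z\<in>K. cmod (h z) \<le> B" if K: "compact K" "K \<subseteq> ball 0 1" for K
  proof (cases "K = {}")
    case False
    obtain x where x: "x \<in> K" "\<And>y. y \<in> K \<Longrightarrow> cmod y \<le> cmod x"
      using continuous_attains_sup[OF K(1) False, of cmod] by (auto intro!: continuous_intros)
    define \<rho> where "\<rho> = (1 + cmod x) / 2"
    have "cmod x < 1" using x K by auto
    then have rho: "0 < \<rho>" "\<rho> < 1" "cmod x \<le> \<rho>" by (auto simp: \<rho>_def intro: add_pos_nonneg)
    then obtain B where B: "\<forall>n \<zeta> i. cmod \<zeta> \<le> \<rho> \<longrightarrow> cmod (F n \<zeta> $ i) \<le> B" using bd by blast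
    have "\<forall>h\<in>\<H>. \<forall>z\<in>K. cmod (h z) \<le> B" using B x rho unfolding \<H>_def by force
    then show ?thesis by blast
  qed auto
  obtain g' r' where g': "g' holomorphic_on ball 0 1" "strict_mono (r' :: nat \<Rightarrow> nat)"
     "\<And>K. compact K \<Longrightarrow> K \<subseteq> ball 0 1 \<Longrightarrow> uniform_limit K ((\<lambda>n z. F (r n) z $ j) \<circ> r') g' sequentially"
  proof (rule Montel[of "ball 0 1" \<H> "\<lambda>n z. F (r n) z $ j"])
    show "h holomorphic_on ball 0 1" if "h \<in> \<H>" for h using that hol by (auto simp: \<H>_def holomorphic_curve_on_def)
    show "range (\<lambda>n z. F (r n) z $ j) \<subseteq> \<H>" by (auto simp: \<H>_def)
  qed (use bdK in \<open>auto\<close>)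
  define g2 where "g2 = g(j := g')"
  show ?case
  proof (intro exI[of _ "r \<circ> r'"] exI[of _ g2] conjI ballI allI impI)
    show "strict_mono (r \<circ> r')" using r g' by (simp add: strict_mono_o)
    fix i assume i: "i \<in> insert j I"
    show "g2 i holomorphic_on ball 0 1" using i g(1) g'(1) by (auto simp: g2_def)
    fix K :: "complex set" assume K: "compact K \<and> K \<subseteq> ball 0 1"
    show "uniform_limit K (\<lambda>n z. F ((r \<circ> r') n) z $ i) (g2 i) sequentially"
    proof (cases "i = j")
      case True
      then show ?thesis using g'(3)[of K] K by (simp add: g2_def o_def)
    next
      case False
      then have "uniform_limit K (\<lambda>n z. F (r n) z $ i) (g i) sequentially" using g(2) i K by blast
      then have "uniform_limit K (\<lambda>n z. F (r (r' n)) z $ i) (g i) sequentially"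
        using filterlim_compose[OF _ filterlim_subseq[OF g'(2)]] by blast
      then show ?thesis using False by (simp add: g2_def)
    qed
  qed
qed

text \<open>Failure for infinitely many \<open>k\<close> would provide bad points along a
  subsequence that converges in \<open>S\<close>, and one good index contradicts this. Statements
  about moving points in moving domains become uniform ones in this way.\<close>

lemma eventually_ball_compactI:
  fixes S :: "'a :: metric_space set"
  assumes S: "compact S"
    and P: "\<And>z \<zeta> r. z \<in> S \<Longrightarrow> (\<And>k. \<zeta> k \<in> S) \<Longrightarrow> \<zeta> \<longlonglongrightarrow> z \<Longrightarrow> strict_mono (r :: nat \<Rightarrow> nat) \<Longrightarrow> \<exists>k. P (r k) (\<zeta> k)"
  shows "\<forall>\<^sub>F k in sequentially. \<forall>z\<in>S. P k z"
proof (rule ccontr)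
  assume "\<not> ?thesis"
  then obtain r :: "nat \<Rightarrow> nat" where r: "strict_mono r" "\<forall>n. \<not> (\<forall>z\<in>S. P (r n) z)"
    using not_eventually_sequentiallyD by blast
  then have "\<exists>\<zeta>. \<forall>n. \<zeta> n \<in> S \<and> \<not> P (r n) (\<zeta> n)" by (intro choice) blast
  then obtain \<zeta> where z: "\<And>n. \<zeta> n \<in> S" "\<And>n. \<not> P (r n) (\<zeta> n)" by blast
  obtain l r' where l: "l \<in> S" "strict_mono (r' :: nat \<Rightarrow> nat)" "(\<zeta> \<circ> r') \<longlonglongrightarrow> l"
    using S z(1) unfolding compact_eq_seq_compact_metric seq_compact_def by blast
  have "\<exists>k. P ((r \<circ> r') k) ((\<zeta> \<circ> r') k)"
  proof (rule P[OF l(1) _ l(3)])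
    show "strict_mono (r \<circ> r')" using r(1) l(2) by (rule strict_mono_o)
  qed (simp add: z(1))
  then show False using z(2) by auto
qed

lemma kobayashi_metric_scale_le:
  fixes p X :: "complex ^ 'n"
  assumes D: "open D" "p \<in> D" and t: "0 < t"
  shows "kobayashi_metric D p (of_real t *s X) \<le> t * kobayashi_metric D p X"
proof -
  have "kobayashi_metric D p (of_real t *s X) / t \<le> kobayashi_metric D p X"
  proof (rule kobayashi_metric_geI[OF D])
    fix l f assume f: "holomorphic_curve_on f (ball 0 1)" "f ` ball 0 1 \<subseteq> D" "f 0 = p" "l *s curve_deriv f 0 = X"
    have "(of_real t * l) *s curve_deriv f 0 = of_real t *s X" using f(4) by (simp flip: vector_smult_assoc)
    from kobayashi_metric_le[OF f(1-3) this]
    show "kobayashi_metric D p (of_real t *s X) / t \<le> cmod l" using t by (simp add: norm_mult field_simps)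
  qed
  then show ?thesis using t by (simp add: field_simps)
qed

lemma kobayashi_metric_scale:
  fixes p X :: "complex ^ 'n"
  assumes D: "open D" "p \<in> D" and t: "0 < t"
  shows "kobayashi_metric D p (of_real t *s X) = t * kobayashi_metric D p X"
proof (rule antisym[OF kobayashi_metric_scale_le[OF assms]])
  have "of_real (1 / t) *s (of_real t *s X) = X" using t by (simp add: vec_eq_iff)
  then have "kobayashi_metric D p X \<le> (1 / t) * kobayashi_metric D p (of_real t *s X)"
    using kobayashi_metric_scale_le[OF D, of "1 / t" "of_real t *s X"] t by simp
  then show "t * kobayashi_metric D p X \<le> kobayashi_metric D p (of_real t *s X)" using t by (simp add: field_simps)
qed

lemma kobayashi_metric_zero:
  fixes p :: "complex ^ 'n"
  assumes D: "open D" "p \<in> D"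
  shows "kobayashi_metric D p 0 = 0"
proof -
  obtain r where r: "r > 0" "cball p r \<subseteq> D" using assms open_contains_cball by blast
  show ?thesis using kobayashi_metric_le_ball[OF r(2,1), of 0] kobayashi_metric_nonneg[OF D, of 0] by simp
qed

context model_family
begin

lemma dmfun_smult: "dmfun c p (l *s v) = l * dmfun c p v"
  unfolding dmfun_def by (simp add: algebra_simps sum_distrib_left)

lemma kobayashi_estimate:
  "\<exists>C>0. \<forall>c p X. admissible c \<longrightarrow> p \<in> mdom c \<longrightarrow>
    (\<forall>i. i \<noteq> i0 \<longrightarrow> cmod (X $ i) \<le> C * polyradius (- mfun c p) * kobayashi_metric (mdom c) p X)
    \<and> cmod (dmfun c p X) \<le> C * (- mfun c p) * kobayashi_metric (mdom c) p X"
proof -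
  obtain C where C: "C > 0" "\<forall>c f. admissible c \<longrightarrow> holomorphic_curve_on f (ball 0 1) \<longrightarrow> f ` ball 0 1 \<subseteq> mdom c \<longrightarrow>
    (\<forall>i. i \<noteq> i0 \<longrightarrow> cmod (curve_deriv f 0 $ i) \<le> C * polyradius (- mfun c (f 0)))
    \<and> cmod (dmfun c (f 0) (curve_deriv f 0)) \<le> C * (- mfun c (f 0))"
    using disc_deriv_estimate by (elim exE conjE) (rule that)
  show ?thesis
  proof (rule exI[of _ C], rule conjI[OF C(1)], intro allI impI conjI)
    fix c p and X :: "complex ^ 'n" assume a: "admissible c" "p \<in> mdom c"
    have d: "- mfun c p > 0" using a by (simp add: mdom_def)
    show "cmod (X $ i) \<le> C * polyradius (- mfun c p) * kobayashi_metric (mdom c) p X" if i: "i \<noteq> i0" for i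
    proof -
      have pos: "C * polyradius (- mfun c p) > 0" using C(1) polyradius_pos[OF d] by simp
      have "cmod (X $ i) / (C * polyradius (- mfun c p)) \<le> kobayashi_metric (mdom c) p X"
      proof (rule kobayashi_metric_geI[OF open_mdom a(2)])
        fix l f assume f: "holomorphic_curve_on f (ball 0 1)" "f ` ball 0 1 \<subseteq> mdom c" "f 0 = p" "l *s curve_deriv f 0 = X"
        have "cmod (X $ i) = cmod l * cmod (curve_deriv f 0 $ i)" using f(4) by (auto simp: norm_mult)
        also have "\<dots> \<le> cmod l * (C * polyradius (- mfun c p))"
          using C(2)[rule_format, OF a(1) f(1,2)] i f(3) by (intro mult_left_mono) auto
        finally show "cmod (X $ i) / (C * polyradius (- mfun c p)) \<le> cmod l" using pos by (simp add: divide_le_eq)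
      qed
      then show ?thesis using pos by (simp add: divide_le_eq mult.commute)
    qed
    have pos: "C * (- mfun c p) > 0" using C(1) d by (rule mult_pos_pos)
    have "cmod (dmfun c p X) / (C * (- mfun c p)) \<le> kobayashi_metric (mdom c) p X"
    proof (rule kobayashi_metric_geI[OF open_mdom a(2)])
      fix l f assume f: "holomorphic_curve_on f (ball 0 1)" "f ` ball 0 1 \<subseteq> mdom c" "f 0 = p" "l *s curve_deriv f 0 = X"
      have "cmod (dmfun c p X) = cmod l * cmod (dmfun c p (curve_deriv f 0))" using f(4) dmfun_smult by (metis norm_mult)
      also have "\<dots> \<le> cmod l * (C * (- mfun c p))"
        using C(2)[rule_format, OF a(1) f(1,2)] f(3) by (intro mult_left_mono) auto
      finally show "cmod (dmfun c p X) / (C * (- mfun c p)) \<le> cmod l" using pos by (simp only: pos_divide_le_eq)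
    qed
    then show "cmod (dmfun c p X) \<le> C * (- mfun c p) * kobayashi_metric (mdom c) p X" using pos by (simp only: pos_divide_le_eq mult.commute)
  qed
qed

text \<open>Bounds every component of \<open>X\<close>, that along \<open>z\<^sub>0\<close>
  included, uniformly for bounded coefficients, depth and coordinates.\<close>

lemma kobayashi_lower:
  "\<exists>C>0. \<forall>c p X i. admissible c \<longrightarrow> (\<forall>x. cmod (c x) \<le> K) \<longrightarrow> p \<in> mdom c \<longrightarrow> - mfun c p \<le> \<Delta> \<longrightarrow> (\<forall>i. i \<noteq> i0 \<longrightarrow> cmod (p $ i) \<le> B) \<longrightarrow>
    cmod (X $ i) \<le> C * kobayashi_metric (mdom c) p X"
proof -
  have half: "0 < (1 / 2 :: real)" "1 / 2 < (1 :: real)" by simp_all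
  obtain C where C: "C > 0" "\<forall>c f. admissible c \<longrightarrow> (\<forall>x. cmod (c x) \<le> K) \<longrightarrow> holomorphic_curve_on f (ball 0 1) \<longrightarrow> f ` ball 0 1 \<subseteq> mdom c \<longrightarrow>
     - mfun c (f 0) \<le> \<Delta> \<longrightarrow> (\<forall>i. i \<noteq> i0 \<longrightarrow> cmod (f 0 $ i) \<le> B) \<longrightarrow> (\<forall>\<zeta> i. cmod \<zeta> \<le> 1/2 \<longrightarrow> cmod (f \<zeta> $ i - f 0 $ i) \<le> C)"
    using disc_bounded[OF half, of K \<Delta> B] by (elim exE conjE) (rule that)
  show ?thesis
  proof (rule exI[of _ "2 * C"], rule conjI, use C(1) in simp, intro allI impI)
    fix c p and X :: "complex ^ 'n" and i
    assume a: "admissible c" "\<forall>x. cmod (c x) \<le> K" "p \<in> mdom c" "- mfun c p \<le> \<Delta>" "\<forall>i. i \<noteq> i0 \<longrightarrow> cmod (p $ i) \<le> B"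
    have "cmod (X $ i) / (2 * C) \<le> kobayashi_metric (mdom c) p X"
    proof (rule kobayashi_metric_geI[OF open_mdom a(3)])
      fix l f assume f: "holomorphic_curve_on f (ball 0 1)" "f ` ball 0 1 \<subseteq> mdom c" "f 0 = p" "l *s curve_deriv f 0 = X"
      have "cmod (deriv (\<lambda>t. f t $ i) 0) \<le> 2 * C"
      proof (rule deriv_bound_half[of _ "f 0 $ i"])
        show "(\<lambda>t. f t $ i) holomorphic_on ball 0 1" using f by (simp add: holomorphic_curve_on_def)
        show "cmod (f z $ i - f 0 $ i) \<le> C" if "cmod z \<le> 1 / 2" for z
          using C(2)[rule_format, OF a(1) a(2)[rule_format] f(1,2)] a(4,5) f(3) that by blast
      qed
      then have "cmod l * cmod (deriv (\<lambda>t. f t $ i) 0) \<le> cmod l * (2 * C)" by (rule mult_left_mono) simp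
      then show "cmod (X $ i) / (2 * C) \<le> cmod l" using C(1) f(4) by (auto simp: norm_mult curve_deriv_def divide_le_eq)
    qed
    then show "cmod (X $ i) \<le> 2 * C * kobayashi_metric (mdom c) p X" using C(1) by (simp add: divide_le_eq mult.commute)
  qed
qed

text \<open>This keeps the limit of a sequence of discs away from the boundary of the limit domain.\<close>

lemma disc_delta_lower:
  "\<exists>C>0. \<forall>c f \<zeta>. admissible c \<longrightarrow> holomorphic_curve_on f (ball 0 1) \<longrightarrow> f ` ball 0 1 \<subseteq> mdom c \<longrightarrow> cmod \<zeta> < 1 \<longrightarrow>
     - mfun c (f 0) * exp (- C / (1 - cmod \<zeta>)) \<le> - mfun c (f \<zeta>)"
proof -
  obtain C where C: "C > 0" "\<forall>c f. admissible c \<longrightarrow> holomorphic_curve_on f (ball 0 1) \<longrightarrow> f ` ball 0 1 \<subseteq> mdom c \<longrightarrow>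
    (\<forall>i. i \<noteq> i0 \<longrightarrow> cmod (curve_deriv f 0 $ i) \<le> C * polyradius (- mfun c (f 0)))
    \<and> cmod (dmfun c (f 0) (curve_deriv f 0)) \<le> C * (- mfun c (f 0))"
    using disc_deriv_estimate by (elim exE conjE) (rule that)
  show ?thesis
  proof (rule exI[of _ C], rule conjI[OF C(1)], intro allI impI)
    fix c :: "nat \<times> nat \<Rightarrow> complex" and f :: "complex \<Rightarrow> complex ^ 'n" and \<zeta> :: complex
    assume a: "admissible c" "holomorphic_curve_on f (ball 0 1)" "f ` ball 0 1 \<subseteq> mdom c" and z: "cmod \<zeta> < 1"
    have inD: "mfun c (f x) < 0" if "cmod x < 1" for x using a that by (auto simp: mdom_def image_subset_iff)
    \<comment> \<open>The estimate at the centre, applied to the disc recentred at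
      \<open>x\<close>.\<close>
    have est: "cmod (dmfun c (f x) (curve_deriv f x)) \<le> C * (- mfun c (f x)) / (1 - cmod x)" if x: "cmod x < 1" for x
    proof -
      define g where "g = (\<lambda>t. f (x + of_real (1 - cmod x) * t))"
      have g: "holomorphic_curve_on g (ball 0 1)" "g ` ball 0 1 \<subseteq> mdom c" "curve_deriv g 0 = of_real (1 - cmod x) *s curve_deriv f x"
        using recentered_disc[OF a(2) x] a(3) by (auto simp: g_def)
      have "g 0 = f x" by (simp add: g_def)
      then have "cmod (dmfun c (f x) (curve_deriv g 0)) \<le> C * (- mfun c (f x))" using C(2)[rule_format, OF a(1) g(1,2)] by simp
      then have "cmod (of_real (1 - cmod x)) * cmod (dmfun c (f x) (curve_deriv f x)) \<le> C * (- mfun c (f x))"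
        unfolding g(3) dmfun_smult norm_mult .
      moreover have "cmod (of_real (1 - cmod x)) = 1 - cmod x" using x by (simp del: of_real_diff)
      ultimately have "(1 - cmod x) * cmod (dmfun c (f x) (curve_deriv f x)) \<le> C * (- mfun c (f x))" by (simp only:)
      then show ?thesis using x by (subst pos_le_divide_eq) (simp_all add: mult.commute)
    qed
    define h where "h t = ln (- mfun c (f (of_real t * \<zeta>)))" for t
    define h' where "h' t = - Re (dmfun c (f (of_real t * \<zeta>)) (\<zeta> *s curve_deriv f (of_real t * \<zeta>))) / (- mfun c (f (of_real t * \<zeta>)))" for t
    have tz: "cmod (of_real t * \<zeta>) \<le> cmod \<zeta>" if "0 \<le> t" "t \<le> 1" for t
      using that by (simp add: norm_mult mult_left_le_one_le)
    have der: "(h has_real_derivative h' t) (at t)" if t: "0 \<le> t" "t \<le> 1" for t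
    proof -
      have lt: "cmod (of_real t * \<zeta>) < 1" using tz[OF t] z by linarith
      have "((\<lambda>t. f (of_real t * \<zeta>)) has_vector_derivative \<zeta> *s curve_deriv f (of_real t * \<zeta>)) (at t)"
        by (rule holomorphic_curve_has_vector_derivative[OF a(2)]) (use lt in auto)
      then have "((\<lambda>t. mfun c (f (of_real t * \<zeta>))) has_derivative (\<lambda>s. Re (dmfun c (f (of_real t * \<zeta>)) (s *\<^sub>R (\<zeta> *s curve_deriv f (of_real t * \<zeta>)))))) (at t)"
        unfolding has_vector_derivative_def by (rule has_derivative_compose[OF _ mfun_has_derivative])
      moreover have "dmfun c p (s *\<^sub>R v) = of_real s * dmfun c p v" for p s v
      proof -
        have "s *\<^sub>R v = complex_of_real s *s v"
          unfolding vec_eq_iff vector_scaleR_component vector_smult_component by (simp add: scaleR_conv_of_real)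
        then show ?thesis by (simp only: dmfun_smult)
      qed
      ultimately have "((\<lambda>t. mfun c (f (of_real t * \<zeta>))) has_real_derivative Re (dmfun c (f (of_real t * \<zeta>)) (\<zeta> *s curve_deriv f (of_real t * \<zeta>)))) (at t)"
        unfolding has_field_derivative_def by (simp add: mult_commute_abs)
      then show ?thesis unfolding h_def h'_def using inD[OF lt]
        by (auto intro!: derivative_eq_intros)
    qed
    \<comment> \<open>The mean value theorem along the radius to \<open>\<zeta>\<close> is precise
      enough: any positive factor that does not depend on the disc will do for the passage to the
      limit.\<close>
    obtain s where s: "0 < s" "s < 1" "h 1 - h 0 = (1 - 0) * h' s"
      using MVT2[of 0 1 h h'] der by auto
    have lts: "cmod (of_real s * \<zeta>) < 1" using tz[of s] s z by linarith
    have "\<bar>h' s\<bar> \<le> C / (1 - cmod \<zeta>)"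
    proof -
      let ?x = "of_real s * \<zeta>"
      have "\<bar>h' s\<bar> \<le> cmod (dmfun c (f ?x) (\<zeta> *s curve_deriv f ?x)) / (- mfun c (f ?x))"
        unfolding h'_def using inD[OF lts] abs_Re_le_cmod[of "dmfun c (f ?x) (\<zeta> *s curve_deriv f ?x)"] by (simp add: abs_divide divide_right_mono_neg divide_le_cancel)
      also have "\<dots> \<le> C / (1 - cmod ?x)"
      proof -
        have "cmod (dmfun c (f ?x) (\<zeta> *s curve_deriv f ?x)) \<le> 1 * (C * (- mfun c (f ?x)) / (1 - cmod ?x))"
          unfolding dmfun_smult norm_mult[of \<zeta>] using z by (intro mult_mono est[OF lts]) auto
        also have "\<dots> = C / (1 - cmod ?x) * (- mfun c (f ?x))" by simp
        finally show ?thesis using inD[OF lts] by (subst pos_divide_le_eq) simp_all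
      qed
      also have "\<dots> \<le> C / (1 - cmod \<zeta>)" using tz[of s] s z C(1) by (intro divide_left_mono) auto
      finally show ?thesis .
    qed
    then have "h 0 + - C / (1 - cmod \<zeta>) \<le> h 1" using s(3) by (simp add: abs_le_iff)
    then have "exp (h 0 + - C / (1 - cmod \<zeta>)) \<le> exp (h 1)" by simp
    then show "- mfun c (f 0) * exp (- C / (1 - cmod \<zeta>)) \<le> - mfun c (f \<zeta>)"
      unfolding exp_add h_def using inD[of 0] inD[OF z] by simp
  qed
qed

section \<open>Semicontinuity of the metric in the coefficients\<close>

text \<open>Since all supports lie in one finite set, convergence of each coefficient already makes
  the defining functions converge locally uniformly.\<close>

definition admissible_limit :: "(nat \<Rightarrow> nat \<times> nat \<Rightarrow> complex) \<Rightarrow> (nat \<times> nat \<Rightarrow> complex) \<Rightarrow> bool" where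
  "admissible_limit cs c \<longleftrightarrow> (\<forall>k. admissible (cs k)) \<and> admissible c \<and> (\<forall>x. (\<lambda>k. cs k x) \<longlonglongrightarrow> c x)"

lemma admissible_limit_const: "admissible c \<Longrightarrow> admissible_limit (\<lambda>_. c) c"
  by (simp add: admissible_limit_def)

lemma admissible_limit_subseq:
  assumes "admissible_limit cs c" "strict_mono r"
  shows "admissible_limit (\<lambda>k. cs (r k)) c"
  using assms LIMSEQ_subseq_LIMSEQ[of _ _ r] unfolding admissible_limit_def o_def by blast

lemma admissible_limit_bounded:
  assumes "admissible_limit cs c"
  shows "\<exists>K. \<forall>k x. cmod (cs k x) \<le> K"
proof -
  have "\<exists>K. \<forall>k. cmod (cs k x) \<le> K" for x
    using assms convergent_imp_Bseq[OF convergentI, of "\<lambda>k. cs k x" "c x"] unfolding admissible_limit_def Bseq_def by blast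
  then obtain K where K: "\<And>x k. cmod (cs k x) \<le> K x" by metis
  have K0: "0 \<le> K x" for x using K[of 0 x] norm_ge_zero order_trans by blast
  have "cmod (cs k x) \<le> sum K ({..N} \<times> {..N})" for k x
  proof (cases "x \<in> {..N} \<times> {..N}")
    case True
    have "cmod (cs k x) \<le> K x" by (rule K)
    also have "\<dots> \<le> sum K ({..N} \<times> {..N})" using True K0 by (intro member_le_sum) auto
    finally show ?thesis .
  next
    case False
    obtain a b where x: "x = (a, b)" by (cases x)
    have "cs k (a, b) \<noteq> 0 \<longrightarrow> a + b \<le> N" using assms unfolding admissible_limit_def admissible_def by blast
    then have "cs k x = 0" using False x by auto
    then show ?thesis using K0 by (simp add: sum_nonneg)
  qed
  then show ?thesis by blast
qed

lemma tendsto_mfun_limit: "admissible_limit cs c \<Longrightarrow> z \<longlonglongrightarrow> z' \<Longrightarrow> (\<lambda>k. mfun (cs k) (z k)) \<longlonglongrightarrow> mfun c z'"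
  by (intro tendsto_mfun) (auto simp: admissible_limit_def)

lemma eventually_mdom:
  assumes "admissible_limit cs c" "z \<longlonglongrightarrow> z'" "z' \<in> mdom c"
  shows "\<forall>\<^sub>F k in sequentially. z k \<in> mdom (cs k)"
  using order_tendstoD(2)[OF tendsto_mfun_limit[OF assms(1,2)], of 0] assms(3) by (simp add: mdom_def)

text \<open>Discs that realize the bound \<open>B\<close> form a normal family by
  \<open>disc_bounded\<close>. A limit of them satisfies at first only
  \<open>mfun c \<le> 0\<close>; the strict inequality comes from \<open>disc_delta_lower\<close> at
  each point.\<close>

lemma kobayashi_lsc0:
  assumes cv: "admissible_limit cs c" and p: "ps \<longlonglongrightarrow> p" and X: "Xs \<longlonglongrightarrow> X" and pD: "p \<in> mdom c"
    and psD: "\<And>k. ps k \<in> mdom (cs k)" and less: "\<And>k. kobayashi_metric (mdom (cs k)) (ps k) (Xs k) < B"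
  shows "kobayashi_metric (mdom c) p X \<le> B"
proof -
  have ad: "admissible (cs k)" for k using cv by (simp add: admissible_limit_def)
  have "\<forall>k. \<exists>lf. holomorphic_curve_on (snd lf) (ball 0 1) \<and> snd lf ` ball 0 1 \<subseteq> mdom (cs k) \<and> snd lf 0 = ps k
       \<and> fst lf *s curve_deriv (snd lf) 0 = Xs k \<and> cmod (fst lf) < B"
    using kobayashi_metric_lessD[OF open_mdom psD less] by (metis fst_conv snd_conv)
  from choice[OF this] obtain lf where lf: "\<forall>k. holomorphic_curve_on (snd (lf k)) (ball 0 1) \<and> snd (lf k) ` ball 0 1 \<subseteq> mdom (cs k) \<and> snd (lf k) 0 = ps k
       \<and> fst (lf k) *s curve_deriv (snd (lf k)) 0 = Xs k \<and> cmod (fst (lf k)) < B" by (elim exE)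
  define f where "f k = snd (lf k)" for k
  define l where "l k = fst (lf k)" for k
  have f: "holomorphic_curve_on (f k) (ball 0 1)" "f k ` ball 0 1 \<subseteq> mdom (cs k)" "f k 0 = ps k"
    "l k *s curve_deriv (f k) 0 = Xs k" "cmod (l k) < B" for k using lf by (auto simp: f_def l_def)
  have hol: "(\<lambda>t. f k t $ i) holomorphic_on ball 0 1" for k i using f(1) by (simp add: holomorphic_curve_on_def)
  obtain K where K: "\<forall>k x. cmod (cs k x) \<le> K" using admissible_limit_bounded[OF cv] by blast
  obtain B1 where B1: "\<forall>k. norm (ps k) \<le> B1" using convergent_imp_Bseq[OF convergentI[OF p]] unfolding Bseq_def by blast
  obtain \<Delta> where D: "\<forall>k. norm (mfun (cs k) (ps k)) \<le> \<Delta>"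
    using convergent_imp_Bseq[OF convergentI[OF tendsto_mfun_limit[OF cv p]]] unfolding Bseq_def by blast
  have pB: "cmod (ps k $ i) \<le> B1" for k i using B1 Finite_Cartesian_Product.norm_nth_le[of "ps k" i] order_trans by blast
  have bdd: "\<exists>M. \<forall>k \<zeta> i. cmod \<zeta> \<le> \<rho> \<longrightarrow> cmod (f k \<zeta> $ i) \<le> M" if rho: "0 < \<rho>" "\<rho> < 1" for \<rho>
  proof -
    obtain C where C: "C > 0" "\<forall>c f. admissible c \<longrightarrow> (\<forall>x. cmod (c x) \<le> K) \<longrightarrow> holomorphic_curve_on f (ball 0 1) \<longrightarrow> f ` ball 0 1 \<subseteq> mdom c \<longrightarrow>
     - mfun c (f 0) \<le> \<Delta> \<longrightarrow> (\<forall>i. i \<noteq> i0 \<longrightarrow> cmod (f 0 $ i) \<le> B1) \<longrightarrow> (\<forall>\<zeta> i. cmod \<zeta> \<le> \<rho> \<longrightarrow> cmod (f \<zeta> $ i - f 0 $ i) \<le> C)"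
      using disc_bounded[OF rho, of K \<Delta> B1] by (elim exE conjE) (rule that)
    have "cmod (f k \<zeta> $ i) \<le> C + B1" if z: "cmod \<zeta> \<le> \<rho>" for k \<zeta> i
    proof -
      have "- mfun (cs k) (f k 0) \<le> \<Delta>" using D[rule_format, of k] f(3)[of k] by (simp add: abs_le_iff)
      then have "cmod (f k \<zeta> $ i - f k 0 $ i) \<le> C"
        using C(2)[rule_format, OF ad K[rule_format] f(1,2)] pB z f(3) by auto
      then show ?thesis using norm_triangle_ineq[of "f k \<zeta> $ i - f k 0 $ i" "f k 0 $ i"] pB[of k i] f(3)[of k] by simp
    qed
    then show ?thesis by blast
  qed
  obtain r g where r: "strict_mono (r :: nat \<Rightarrow> nat)" and "\<forall>i\<in>UNIV. g i holomorphic_on ball 0 1 \<and>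
     (\<forall>K. compact K \<and> K \<subseteq> ball 0 1 \<longrightarrow> uniform_limit K (\<lambda>n z. f (r n) z $ i) (g i) sequentially)"
  proof -
    have "\<exists>r g. strict_mono (r :: nat \<Rightarrow> nat) \<and> (\<forall>i\<in>UNIV. g i holomorphic_on ball 0 1 \<and>
     (\<forall>K. compact K \<and> K \<subseteq> ball 0 1 \<longrightarrow> uniform_limit K (\<lambda>n z. f (r n) z $ i) (g i) sequentially))"
      by (rule montel_finite[of f UNIV, OF f(1) _ finite_class.finite_UNIV]) (rule bdd)
    then show thesis using that by blast
  qed
  then have g: "g i holomorphic_on ball 0 1" "compact K \<Longrightarrow> K \<subseteq> ball 0 1 \<Longrightarrow> uniform_limit K (\<lambda>n z. f (r n) z $ i) (g i) sequentially" for i K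
    by blast+
  \<comment> \<open>The factors \<open>l\<close> are bounded by \<open>B\<close> and converge along
    a further subsequence.\<close>
  have "bounded (range (l \<circ> r))" using f(5) by (intro boundedI[of _ B]) (auto intro: less_imp_le)
  then obtain L r2 where L: "strict_mono (r2 :: nat \<Rightarrow> nat)" "((l \<circ> r) \<circ> r2) \<longlonglongrightarrow> L"
    using bounded_imp_convergent_subsequence by blast
  define R where "R = r \<circ> r2"
  have R: "strict_mono R" using r L by (simp add: R_def strict_mono_o)
  have ul: "uniform_limit S (\<lambda>n z. f (R n) z $ i) (g i) sequentially" if "compact S" "S \<subseteq> ball 0 1" for S i
    using filterlim_compose[OF g(2)[OF that] filterlim_subseq[OF L(1)]] by (simp add: R_def)
  define G where "G \<zeta> = (\<chi> i. g i \<zeta>)" for \<zeta>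
  have lim: "(\<lambda>k. f (R k) \<zeta>) \<longlonglongrightarrow> G \<zeta>" if "cmod \<zeta> < 1" for \<zeta>
  proof (rule vec_tendstoI)
    fix i
    have "uniform_limit {\<zeta>} (\<lambda>n z. f (R n) z $ i) (g i) sequentially" using that by (intro ul) auto
    then show "(\<lambda>k. f (R k) \<zeta> $ i) \<longlonglongrightarrow> G \<zeta> $ i" by (auto simp: G_def dest: tendsto_uniform_limitI)
  qed
  have cvR: "admissible_limit (\<lambda>k. cs (R k)) c" by (rule admissible_limit_subseq[OF cv R])
  have pR: "(\<lambda>k. ps (R k)) \<longlonglongrightarrow> p" using LIMSEQ_subseq_LIMSEQ[OF p R] by (simp add: o_def)
  have XR: "(\<lambda>k. Xs (R k)) \<longlonglongrightarrow> X" using LIMSEQ_subseq_LIMSEQ[OF X R] by (simp add: o_def)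
  have "(\<lambda>k. f (R k) 0) \<longlonglongrightarrow> p" using pR by (simp add: f(3))
  with lim[of 0] have G0: "G 0 = p" by (auto intro: LIMSEQ_unique)
  have holG: "holomorphic_curve_on G (ball 0 1)" unfolding holomorphic_curve_on_def G_def using g(1) by simp
  obtain C where C: "C > 0" "\<forall>c f \<zeta>. admissible c \<longrightarrow> holomorphic_curve_on f (ball 0 1) \<longrightarrow> f ` ball 0 1 \<subseteq> mdom c \<longrightarrow> cmod \<zeta> < 1 \<longrightarrow>
     - mfun c (f 0) * exp (- C / (1 - cmod \<zeta>)) \<le> - mfun c (f \<zeta>)"
    using disc_delta_lower by (elim exE conjE) (rule that)
  have GD: "G \<zeta> \<in> mdom c" if z: "cmod \<zeta> < 1" for \<zeta>
  proof -
    have 1: "(\<lambda>k. - mfun (cs (R k)) (f (R k) \<zeta>)) \<longlonglongrightarrow> - mfun c (G \<zeta>)"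
      by (intro tendsto_minus tendsto_mfun_limit[OF cvR lim[OF z]])
    have 2: "(\<lambda>k. - mfun (cs (R k)) (f (R k) 0) * exp (- C / (1 - cmod \<zeta>))) \<longlonglongrightarrow> - mfun c p * exp (- C / (1 - cmod \<zeta>))"
      unfolding f(3) by (intro tendsto_intros tendsto_mfun_limit[OF cvR pR])
    have "- mfun c p * exp (- C / (1 - cmod \<zeta>)) \<le> - mfun c (G \<zeta>)"
      by (rule LIMSEQ_le[OF 2 1]) (use C(2)[rule_format, OF ad f(1,2) z] in blast)
    moreover have "- mfun c p * exp (- C / (1 - cmod \<zeta>)) > 0" using pD by (intro mult_pos_pos) (auto simp: mdom_def)
    ultimately show ?thesis by (simp add: mdom_def)
  qed
  have "L *s curve_deriv G 0 = X"
  proof (rule LIMSEQ_unique[OF _ XR], rule vec_tendstoI)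
    fix i
    have "uniform_limit (ball 0 (1/2)) (\<lambda>n z. f (R n) z $ i) (g i) sequentially"
      by (rule uniform_limit_on_subset[OF ul[of "cball 0 (1/2)"]]) auto
    moreover have "(\<lambda>z. f (R n) z $ i) holomorphic_on ball 0 (1/2)" for n by (rule holomorphic_on_subset[OF hol]) auto
    ultimately have "(\<lambda>k. deriv (\<lambda>z. f (R k) z $ i) 0) \<longlonglongrightarrow> deriv (g i) 0"
      by (intro deriv_complex_uniform_limit[where A = "ball 0 (1/2)"]) auto
    then have "(\<lambda>k. l (R k) * deriv (\<lambda>z. f (R k) z $ i) 0) \<longlonglongrightarrow> L * deriv (g i) 0"
      using L(2) by (intro tendsto_mult) (simp add: R_def o_def)
    moreover have "Xs (R k) $ i = l (R k) * deriv (\<lambda>z. f (R k) z $ i) 0" for k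
      using f(4)[of "R k", symmetric] by (simp add: curve_deriv_def)
    ultimately show "(\<lambda>k. Xs (R k) $ i) \<longlonglongrightarrow> (L *s curve_deriv G 0) $ i" by (simp add: curve_deriv_def G_def)
  qed
  then have "kobayashi_metric (mdom c) p X \<le> cmod L"
    using GD by (intro kobayashi_metric_le[OF holG _ G0]) auto
  also have "cmod L \<le> B"
    using tendsto_norm[OF L(2)] by (rule LIMSEQ_le_const2) (use f(5) in \<open>auto intro: less_imp_le\<close>)
  finally show ?thesis .
qed

lemma kobayashi_lsc:
  assumes cv: "admissible_limit cs c" and p: "ps \<longlonglongrightarrow> p" and X: "Xs \<longlonglongrightarrow> X" and pD: "p \<in> mdom c"
    and less: "\<forall>\<^sub>F k in sequentially. kobayashi_metric (mdom (cs k)) (ps k) (Xs k) < B"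
  shows "kobayashi_metric (mdom c) p X \<le> B"
proof -
  have "\<forall>\<^sub>F k in sequentially. kobayashi_metric (mdom (cs k)) (ps k) (Xs k) < B \<and> ps k \<in> mdom (cs k)"
    using less eventually_mdom[OF cv p pD] by eventually_elim simp
  then obtain k0 where k0: "\<And>k. k \<ge> k0 \<Longrightarrow> kobayashi_metric (mdom (cs k)) (ps k) (Xs k) < B \<and> ps k \<in> mdom (cs k)"
    unfolding eventually_sequentially by blast
  show ?thesis
  proof (rule kobayashi_lsc0[of "\<lambda>k. cs (k + k0)" c "\<lambda>k. ps (k + k0)" p "\<lambda>k. Xs (k + k0)"])
    show "admissible_limit (\<lambda>k. cs (k + k0)) c" by (rule admissible_limit_subseq[OF cv]) (simp add: strict_mono_def)
  qed (use k0 pD in \<open>auto intro: LIMSEQ_ignore_initial_segment p X\<close>)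
qed

text \<open>A nearly extremal disc, shrunk by \<open>\<rho>\<close>, has compact closure in the
  limit domain, so small perturbations of it lie in the nearby domains. An affine correction adjusts
  its centre to \<open>ps k\<close> and its direction to \<open>Xs k\<close>.\<close>

lemma kobayashi_usc:
  assumes cv: "admissible_limit cs c" and p: "ps \<longlonglongrightarrow> p" and X: "Xs \<longlonglongrightarrow> X" and pD: "p \<in> mdom c"
    and less: "kobayashi_metric (mdom c) p X < B"
  shows "\<forall>\<^sub>F k in sequentially. kobayashi_metric (mdom (cs k)) (ps k) (Xs k) < B"
proof -
  have B: "B > 0" using kobayashi_metric_nonneg[OF open_mdom pD, of X] less by linarith
  obtain l f where f: "holomorphic_curve_on f (ball 0 1)" "f ` ball 0 1 \<subseteq> mdom c" "f 0 = p" "l *s curve_deriv f 0 = X" "cmod l < B" "l \<noteq> 0"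
  proof -
    obtain l f where f: "holomorphic_curve_on f (ball 0 1)" "f ` ball 0 1 \<subseteq> mdom c" "f 0 = p" "l *s curve_deriv f 0 = X" "cmod l < B"
      using kobayashi_metric_lessD[OF open_mdom pD less] by blast
    show thesis
    \<comment> \<open>The factor is inverted below, so 0 is excluded: it forces
      \<open>X = 0\<close>, which the constant disc realizes with any factor.\<close>
    proof (cases "l = 0")
      case True
      then have "X = 0" using f(4) by simp
      moreover have "curve_deriv (\<lambda>_. p) 0 = 0" by (simp add: curve_deriv_def vec_eq_iff)
      ultimately show thesis using B pD by (intro that[of "\<lambda>_. p" "of_real (B / 2)"]) (auto simp: holomorphic_curve_on_def)
    next
      case False
      then show thesis using that f by blast
    qed
  qed
  \<comment> \<open>Halfway between \<open>|l| / B\<close> and 1, so that the factor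
    \<open>l / \<rho>\<close> of the shrunk disc is still below \<open>B\<close> in modulus.\<close>
  define \<rho> where "\<rho> = (1 + cmod l / B) / 2"
  have lB: "cmod l / B < 1" "0 \<le> cmod l / B" using f(5) B by (auto simp: divide_less_eq)
  have rho: "0 < \<rho>" "\<rho> < 1" "cmod l / B < \<rho>"
  proof -
    have "0 < (1 + x) / 2 \<and> (1 + x) / 2 < 1 \<and> x < (1 + x) / 2" if "x < 1" "0 \<le> x" for x :: real using that by auto
    from this[OF lB] show "0 < \<rho>" "\<rho> < 1" "cmod l / B < \<rho>" unfolding \<rho>_def by blast+
  qed
  define l' where "l' = l / of_real \<rho>"
  have l': "l' \<noteq> 0" "cmod l' < B" using f(6) rho B by (auto simp: l'_def norm_divide field_simps)
  \<comment> \<open>The correction that makes \<open>l' *s curve_deriv (h k) 0\<close> exactly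
    \<open>Xs k\<close>; it tends to 0.\<close>
  define v where "v k = inverse l' *s (Xs k - X)" for k
  define h where "h k t = f (of_real \<rho> * t) + (ps k - p) + t *s v k" for k t
  have holf: "(\<lambda>t. f t $ i) holomorphic_on ball 0 1" for i using f by (simp add: holomorphic_curve_on_def)
  have rb: "cmod (of_real \<rho> * t) < 1" if "cmod t \<le> 1" for t
  proof -
    have "\<rho> * cmod t \<le> \<rho> * 1" using that rho by (intro mult_left_mono) auto
    moreover have "cmod (of_real \<rho> * t) = \<rho> * cmod t" using rho by (simp add: norm_mult)
    ultimately show ?thesis using rho by linarith
  qed
  have holh: "holomorphic_curve_on (h k) (ball 0 1)" for k
    unfolding holomorphic_curve_on_def
  proof
    fix i
    have "(\<lambda>t. f t $ i) \<circ> (\<lambda>t. of_real \<rho> * t) holomorphic_on ball 0 1"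
      by (rule holomorphic_on_compose_gen[OF _ holf]) (use rb in \<open>auto intro!: holomorphic_intros\<close>)
    then show "(\<lambda>t. h k t $ i) holomorphic_on ball 0 1" unfolding h_def o_def by (simp, intro holomorphic_intros)
  qed
  have dh: "curve_deriv (h k) 0 = of_real \<rho> *s curve_deriv f 0 + v k" for k
  proof -
    have "deriv (\<lambda>t. h k t $ i) 0 = of_real \<rho> * deriv (\<lambda>t. f t $ i) 0 + v k $ i" for i
    proof (rule DERIV_imp_deriv)
      have "((\<lambda>t. f t $ i) has_field_derivative deriv (\<lambda>t. f t $ i) 0) (at (of_real \<rho> * 0))"
        using holf[of i] by (auto intro: holomorphic_derivI)
      then have "((\<lambda>t. f (of_real \<rho> * t) $ i) has_field_derivative deriv (\<lambda>t. f t $ i) 0 * of_real \<rho>) (at 0)"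
        by (rule DERIV_chain'[where f = "\<lambda>t. of_real \<rho> * t" and g = "\<lambda>t. f t $ i", rotated]) (auto intro!: derivative_eq_intros)
      then show "((\<lambda>t. h k t $ i) has_field_derivative of_real \<rho> * deriv (\<lambda>t. f t $ i) 0 + v k $ i) (at 0)"
        unfolding h_def by (auto intro!: derivative_eq_intros)
    qed
    then show ?thesis by (simp add: curve_deriv_def vec_eq_iff)
  qed
  have eqX: "l' *s curve_deriv (h k) 0 = Xs k" for k
  proof -
    have "l' *s (of_real \<rho> *s curve_deriv f 0) = X" using f(4) rho by (simp add: l'_def)
    moreover have "l' *s v k = Xs k - X" unfolding v_def using l' by simp
    ultimately show ?thesis unfolding dh by (simp add: vector_add_ldistrib)
  qed
  have "\<forall>\<^sub>F k in sequentially. \<forall>t\<in>cball 0 1. h k t \<in> mdom (cs k)"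
  proof (rule eventually_ball_compactI)
    fix t :: complex and \<zeta> and r :: "nat \<Rightarrow> nat" assume t: "t \<in> cball 0 1" and z: "\<zeta> \<longlonglongrightarrow> t" and zk: "\<And>k. \<zeta> k \<in> cball 0 1" and r: "strict_mono r"
    have pr: "(\<lambda>k. ps (r k)) \<longlonglongrightarrow> p" using LIMSEQ_subseq_LIMSEQ[OF p r] by (simp add: o_def)
    have Xr: "(\<lambda>k. Xs (r k)) \<longlonglongrightarrow> X" using LIMSEQ_subseq_LIMSEQ[OF X r] by (simp add: o_def)
    have "(\<lambda>k. h (r k) (\<zeta> k)) \<longlonglongrightarrow> f (of_real \<rho> * t)"
    proof (rule vec_tendstoI)
      fix i
      have "isCont (\<lambda>t. f t $ i) (of_real \<rho> * t)"
        using holf[of i] rb[of t] t by (metis continuous_on_eq_continuous_at dist_0_norm holomorphic_on_imp_continuous_on mem_ball mem_cball open_ball)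
      moreover have "(\<lambda>k. of_real \<rho> * \<zeta> k) \<longlonglongrightarrow> of_real \<rho> * t" by (intro tendsto_intros z)
      ultimately have lf: "(\<lambda>k. f (of_real \<rho> * \<zeta> k) $ i) \<longlonglongrightarrow> f (of_real \<rho> * t) $ i" by (rule isCont_tendsto_compose)
      have "(\<lambda>k. f (of_real \<rho> * \<zeta> k) $ i + (ps (r k) $ i - p $ i) + \<zeta> k * (inverse l' * (Xs (r k) $ i - X $ i)))
         \<longlonglongrightarrow> f (of_real \<rho> * t) $ i + (p $ i - p $ i) + t * (inverse l' * (X $ i - X $ i))"
        by (intro tendsto_add tendsto_diff tendsto_mult tendsto_const lf z tendsto_vec_nth[OF pr] tendsto_vec_nth[OF Xr])
      moreover have "h (r k) (\<zeta> k) $ i = f (of_real \<rho> * \<zeta> k) $ i + (ps (r k) $ i - p $ i) + \<zeta> k * (inverse l' * (Xs (r k) $ i - X $ i))" for k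
        by (simp add: h_def v_def algebra_simps)
      ultimately show "(\<lambda>k. h (r k) (\<zeta> k) $ i) \<longlonglongrightarrow> f (of_real \<rho> * t) $ i" by simp
    qed
    moreover have "f (of_real \<rho> * t) \<in> mdom c" using f(2) rb[of t] t by (auto simp: image_subset_iff)
    ultimately have "\<forall>\<^sub>F k in sequentially. h (r k) (\<zeta> k) \<in> mdom (cs (r k))"
      using eventually_mdom[OF admissible_limit_subseq[OF cv r]] by blast
    then show "\<exists>k. h (r k) (\<zeta> k) \<in> mdom (cs (r k))" using eventually_happens by force
  qed simp
  then show ?thesis
  proof eventually_elim
    case (elim k)
    have "h k 0 = ps k" by (simp add: h_def f(3))
    moreover have "h k ` ball 0 1 \<subseteq> mdom (cs k)" using elim by auto
    ultimately have "kobayashi_metric (mdom (cs k)) (ps k) (Xs k) \<le> cmod l'"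
      using kobayashi_metric_le[OF holh _ _ eqX] by blast
    then show ?case using l' by linarith
  qed
qed

end

section \<open>Curves of bounded length\<close>

text \<open>In contrast to \<open>nn_integral_cmult\<close> the integrand need not be measurable; that of the Kobayashi
  length is not known to be.\<close>

lemma nn_integral_cmult_ge:
  assumes "0 \<le> c"
  shows "ennreal c * integral\<^sup>N M f \<le> (\<integral>\<^sup>+x. ennreal c * f x \<partial>M)"
  unfolding nn_integral_def SUP_mult_left_ennreal
proof (rule SUP_mono)
  fix g assume g: "g \<in> {g. simple_function M g \<and> g \<le> f}"
  then have "simple_function M (\<lambda>x. ennreal c * g x)" by (auto intro: simple_function_mult)
  moreover have "(\<lambda>x. ennreal c * g x) \<le> (\<lambda>x. ennreal c * f x)"
    using g by (auto simp: le_fun_def intro!: mult_left_mono)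
  moreover have "ennreal c * integral\<^sup>S M g = integral\<^sup>S M (\<lambda>x. ennreal c * g x)"
    using g by (simp add: simple_integral_mult)
  ultimately show "\<exists>h\<in>{g. simple_function M g \<and> g \<le> (\<lambda>x. ennreal c * f x)}. ennreal c * integral\<^sup>S M g \<le> integral\<^sup>S M h"
    by (intro bexI[of _ "\<lambda>x. ennreal c * g x"]) auto
qed

text \<open>The inequality \<open>nn_integral_cmult_ge\<close> with factor \<open>1 / c\<close>,
  hence again without measurability.\<close>

lemma nn_integral_cmult_le:
  assumes "0 < c"
  shows "(\<integral>\<^sup>+x. ennreal c * f x \<partial>M) \<le> ennreal c * integral\<^sup>N M f"
proof -
  have e: "ennreal (1 / c) * (ennreal c * x) = x" "ennreal c * (ennreal (1 / c) * x) = x" for x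
    using assms by (simp_all add: mult.assoc[symmetric] ennreal_mult[symmetric])
  have "ennreal (1 / c) * (\<integral>\<^sup>+x. ennreal c * f x \<partial>M) \<le> (\<integral>\<^sup>+x. ennreal (1 / c) * (ennreal c * f x) \<partial>M)"
    using assms by (intro nn_integral_cmult_ge) auto
  then have "ennreal c * (ennreal (1 / c) * (\<integral>\<^sup>+x. ennreal c * f x \<partial>M)) \<le> ennreal c * integral\<^sup>N M f"
    unfolding e(1) by (intro mult_left_mono) auto
  then show ?thesis unfolding e(2) .
qed

text \<open>Measurability is demanded of \<open>h'\<close> alone, where it comes with gauge
  integrability from the fundamental theorem of calculus. \<open>F\<close> enters through
  monotonicity of the integral, which holds for arbitrary functions.\<close>

lemma variation_le_nn_integral:
  fixes h h' :: "real \<Rightarrow> real" and F :: "real \<Rightarrow> ennreal"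
  assumes cont: "continuous_on {0..1} h" and S: "finite S"
    and der: "\<And>t. t \<in> {0<..<1} - S \<Longrightarrow> (h has_vector_derivative h' t) (at t)"
    and bd: "\<And>t. t \<in> {0<..<1} - S \<Longrightarrow> ennreal \<bar>h' t\<bar> \<le> ennreal K * F t"
    and len: "(\<integral>\<^sup>+t\<in>{0..1}. F t \<partial>lborel) \<le> ennreal R" and K: "0 < K" and R: "0 \<le> R" and s: "s \<in> {0..1}"
  shows "\<bar>h s - h 0\<bar> \<le> K * R"
proof -
  have hi: "(h' has_integral (h s - h 0)) {0..s}"
    by (rule fundamental_theorem_of_calculus_interior_strong[OF S])
      (use s der cont in \<open>auto elim: continuous_on_subset\<close>)
  define g where "g x = h' x * indicator {0..s} x" for x
  have m: "g \<in> borel_measurable lebesgue"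
    unfolding g_def using has_integral_implies_lebesgue_measurable_real[OF hi] .
  have "(\<integral>\<^sup>+x. ennreal (norm (g x)) \<partial>lebesgue) = (\<integral>\<^sup>+x. ennreal (norm (g x)) \<partial>lborel)"
    by (rule nn_integral_completion)
  also have "\<dots> \<le> (\<integral>\<^sup>+x. ennreal K * (F x * indicator {0..1} x) \<partial>lborel)"
  proof (rule nn_integral_mono_AE)
    have "AE x in lborel. x \<notin> S \<union> {0, 1}" using S by (intro AE_not_in finite_imp_null_set_lborel) auto
    then show "AE x in lborel. ennreal (norm (g x)) \<le> ennreal K * (F x * indicator {0..1} x)"
    proof eventually_elim
      case (elim x)
      show ?case
      proof (cases "x \<in> {0..s}")
        case True
        then have "x \<in> {0<..<1} - S" using elim s by auto
        then show ?thesis using bd[of x] True by (simp add: g_def)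
      qed (simp add: g_def)
    qed
  qed
  also have "\<dots> \<le> ennreal K * (\<integral>\<^sup>+x. F x * indicator {0..1} x \<partial>lborel)" by (rule nn_integral_cmult_le[OF K])
  also have "\<dots> \<le> ennreal K * ennreal R" using len by (rule mult_left_mono) simp
  finally have le: "(\<integral>\<^sup>+x. ennreal (norm (g x)) \<partial>lebesgue) \<le> ennreal (K * R)" using K R by (simp add: ennreal_mult)
  then have "(\<integral>\<^sup>+x. ennreal (norm (g x)) \<partial>lebesgue) < \<infinity>" by (rule le_less_trans) simp
  then have int: "integrable lebesgue g" using m by (intro integrableI_bounded)
  have "(g has_integral integral\<^sup>L lebesgue g) UNIV" by (rule has_integral_integral_lebesgue[OF int])
  moreover have "(g has_integral (h s - h 0)) UNIV"
  proof -
    have "g = (\<lambda>x. if x \<in> {0..s} then h' x else 0)" by (auto simp: g_def)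
    then show ?thesis using hi by (simp only: has_integral_restrict_UNIV)
  qed
  ultimately have "h s - h 0 = integral\<^sup>L lebesgue g" by (rule has_integral_unique[rotated])
  then have "ennreal (norm (h s - h 0)) \<le> ennreal (K * R)"
    using integral_norm_bound_ennreal[OF int] le by (metis order_trans)
  then show ?thesis using K R by (simp add: ennreal_le_iff)
qed

text \<open>A function whose differential is dominated by the metric is Lipschitz with respect to
  the length. It is applied to the logarithm of the depth and to single coordinates.\<close>

lemma path_variation:
  fixes \<gamma> :: "real \<Rightarrow> complex ^ 'n" and \<phi> :: "complex ^ 'n \<Rightarrow> real"
  assumes vp: "valid_path \<gamma>"
    and der: "\<And>z. z \<in> path_image \<gamma> \<Longrightarrow> (\<phi> has_derivative \<phi>' z) (at z)"
    and bd: "\<And>z X. z \<in> path_image \<gamma> \<Longrightarrow> \<bar>\<phi>' z X\<bar> \<le> K * kobayashi_metric D z X"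
    and len: "kobayashi_length D \<gamma> \<le> ennreal R" and K: "0 < K" and R: "0 \<le> R" and s: "s \<in> {0..1}"
  shows "\<bar>\<phi> (\<gamma> s) - \<phi> (\<gamma> 0)\<bar> \<le> K * R"
proof -
  obtain S D' where S: "finite S" "\<And>t. t \<in> {0..1} - S \<Longrightarrow> (\<gamma> has_vector_derivative D' t) (at t)" "continuous_on {0..1} \<gamma>"
    using vp unfolding valid_path_def piecewise_C1_differentiable_on_def C1_differentiable_on_def by blast
  have pi: "\<gamma> t \<in> path_image \<gamma>" if "t \<in> {0..1}" for t using that by (auto simp: path_image_def)
  have "continuous_on (path_image \<gamma>) \<phi>"
    using der by (intro continuous_at_imp_continuous_on ballI) (rule has_derivative_continuous)
  then have "continuous_on {0..1} (\<phi> \<circ> \<gamma>)"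
    using S(3) by (intro continuous_on_compose) (auto simp: path_image_def)
  then have cont: "continuous_on {0..1} (\<lambda>t. \<phi> (\<gamma> t))" by (simp add: o_def)
  show ?thesis
  proof (rule variation_le_nn_integral[OF cont S(1) _ _ _ K R s])
    fix t :: real assume t: "t \<in> {0<..<1} - S"
    then have t': "t \<in> {0..1} - S" by auto
    have vd: "(\<gamma> has_vector_derivative vector_derivative \<gamma> (at t)) (at t)"
      using S(2)[OF t'] by (simp add: vector_derivative_at)
    have dz: "(\<phi> has_derivative \<phi>' (\<gamma> t)) (at (\<gamma> t))" using der pi t' by auto
    have "((\<lambda>t. \<phi> (\<gamma> t)) has_derivative (\<lambda>x. \<phi>' (\<gamma> t) (x *\<^sub>R vector_derivative \<gamma> (at t)))) (at t)"
      by (rule has_derivative_compose[where f = \<gamma> and g = \<phi> and g' = "\<phi>' (\<gamma> t)"])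
        (use vd dz in \<open>auto simp: has_vector_derivative_def\<close>)
    moreover have "\<phi>' (\<gamma> t) (x *\<^sub>R v) = x *\<^sub>R \<phi>' (\<gamma> t) v" for x v
      using has_derivative_bounded_linear[OF dz] by (simp add: bounded_linear.linear linear_cmul)
    ultimately show "((\<lambda>t. \<phi> (\<gamma> t)) has_vector_derivative \<phi>' (\<gamma> t) (vector_derivative \<gamma> (at t))) (at t)"
      unfolding has_vector_derivative_def by simp
    show "ennreal \<bar>\<phi>' (\<gamma> t) (vector_derivative \<gamma> (at t))\<bar> \<le> ennreal K * ennreal (kobayashi_metric D (\<gamma> t) (vector_derivative \<gamma> (at t)))"
      using bd[OF pi, of t] t' K by (simp add: ennreal_mult'[symmetric] ennreal_leI)
  qed (use len in \<open>simp add: kobayashi_length_def\<close>)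
qed

lemma kobayashi_length_scale:
  assumes "\<And>z X. z \<in> path_image \<gamma> \<Longrightarrow> a * kobayashi_metric D z X \<le> kobayashi_metric D' z X" "0 \<le> a"
  shows "ennreal a * kobayashi_length D \<gamma> \<le> kobayashi_length D' \<gamma>"
proof -
  let ?f = "\<lambda>t. ennreal (kobayashi_metric D (\<gamma> t) (vector_derivative \<gamma> (at t))) * indicator {0..1} t"
  have "ennreal a * kobayashi_length D \<gamma> \<le> (\<integral>\<^sup>+t. ennreal a * ?f t \<partial>lborel)"
    unfolding kobayashi_length_def by (rule nn_integral_cmult_ge[OF assms(2)])
  also have "\<dots> \<le> kobayashi_length D' \<gamma>"
    unfolding kobayashi_length_def
  proof (rule nn_integral_mono)
    fix t :: real
    show "ennreal a * ?f t \<le> ennreal (kobayashi_metric D' (\<gamma> t) (vector_derivative \<gamma> (at t))) * indicator {0..1} t"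
    proof (cases "t \<in> {0..1}")
      case True
      then have "\<gamma> t \<in> path_image \<gamma>" by (auto simp: path_image_def)
      then show ?thesis using True assms by (simp add: ennreal_mult'[symmetric] ennreal_leI)
    qed simp
  qed
  finally show ?thesis .
qed

lemma compact_polybox: "compact {z :: complex ^ 'n. \<forall>i. cmod (z $ i) \<le> B}"
proof -
  have "closed {z :: complex ^ 'n. \<forall>i. cmod (z $ i) \<le> B}"
    by (intro closed_Collect_all closed_Collect_le continuous_intros)
  moreover have "bounded {z :: complex ^ 'n. \<forall>i. cmod (z $ i) \<le> B}"
  proof (rule boundedI)
    fix z :: "complex ^ 'n" assume z: "z \<in> {z. \<forall>i. cmod (z $ i) \<le> B}"
    have "norm z \<le> (\<Sum>i\<in>UNIV. cmod (z $ i))" unfolding norm_vec_def by (rule L2_set_le_sum) simp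
    also have "\<dots> \<le> (\<Sum>i\<in>(UNIV :: 'n set). B)" using z by (intro sum_mono) auto
    finally show "norm z \<le> (\<Sum>i\<in>(UNIV :: 'n set). B)" .
  qed
  ultimately show ?thesis by (simp add: compact_eq_bounded_closed)
qed

context model_family
begin

section \<open>Ratios of the metrics over compact sets\<close>

lemma kobayashi_pos:
  assumes "admissible c" "p \<in> mdom c" "X \<noteq> 0"
  shows "0 < kobayashi_metric (mdom c) p X"
proof -
  obtain K where K: "\<forall>k::nat. \<forall>x. cmod (c x) \<le> K" using admissible_limit_bounded[OF admissible_limit_const[OF assms(1)]] by blast
  obtain C where C: "C > 0" "\<forall>c' q X i. admissible c' \<longrightarrow> (\<forall>x. cmod (c' x) \<le> K) \<longrightarrow> q \<in> mdom c' \<longrightarrow> - mfun c' q \<le> - mfun c p \<longrightarrow> (\<forall>i. i \<noteq> i0 \<longrightarrow> cmod (q $ i) \<le> norm p) \<longrightarrow>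
    cmod (X $ i) \<le> C * kobayashi_metric (mdom c') q X"
    using kobayashi_lower[of K "- mfun c p" "norm p"] by (elim exE conjE) (rule that)
  have *: "cmod (X $ i) \<le> C * kobayashi_metric (mdom c) p X" for i
    by (rule C(2)[rule_format, OF assms(1) _ assms(2)]) (use K in \<open>auto intro: Finite_Cartesian_Product.norm_nth_le\<close>)
  obtain i where "X $ i \<noteq> 0" using assms(3) by (auto simp: vec_eq_iff)
  then have "0 < cmod (X $ i)" by simp
  then have "0 < C * kobayashi_metric (mdom c) p X" using *[of i] by linarith
  then show ?thesis using C(1) by (simp add: zero_less_mult_iff)
qed

text \<open>Both semicontinuity results are used twice, for the moving domains and for the constant
  sequence \<open>c\<close>, so that both metrics tend to the same value \<open>A\<close>. As
  \<open>A\<close> is positive, this compares ratios.\<close>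

lemma metric_ratio_sphere:
  assumes cv: "admissible_limit cs c" and L: "compact L" "L \<subseteq> mdom c" and e: "0 < e" "e < 1"
  shows "\<forall>\<^sub>F k in sequentially. \<forall>xX\<in>L \<times> sphere 0 1.
    (1 - e) * kobayashi_metric (mdom c) (fst xX) (snd xX) \<le> kobayashi_metric (mdom (cs k)) (fst xX) (snd xX)
    \<and> kobayashi_metric (mdom (cs k)) (fst xX) (snd xX) \<le> (1 + e) * kobayashi_metric (mdom c) (fst xX) (snd xX)"
proof (rule eventually_ball_compactI)
  show "compact (L \<times> sphere (0 :: complex ^ 'n) 1)" by (intro compact_Times L compact_sphere)
  fix z \<zeta> and r :: "nat \<Rightarrow> nat"
  assume z: "z \<in> L \<times> sphere (0 :: complex ^ 'n) 1" and zk: "\<And>k. \<zeta> k \<in> L \<times> sphere (0 :: complex ^ 'n) 1" and lim: "\<zeta> \<longlonglongrightarrow> z" and r: "strict_mono r"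
  define A where "A = kobayashi_metric (mdom c) (fst z) (snd z)"
  define a where "a k = kobayashi_metric (mdom c) (fst (\<zeta> k)) (snd (\<zeta> k))" for k
  define b where "b k = kobayashi_metric (mdom (cs (r k))) (fst (\<zeta> k)) (snd (\<zeta> k))" for k
  have ad: "admissible c" using cv by (simp add: admissible_limit_def)
  have zD: "fst z \<in> mdom c" using z L by auto
  have A: "A > 0" unfolding A_def by (rule kobayashi_pos[OF ad zD]) (use z in auto)
  have l1: "(\<lambda>k. fst (\<zeta> k)) \<longlonglongrightarrow> fst z" and l2: "(\<lambda>k. snd (\<zeta> k)) \<longlonglongrightarrow> snd z" using lim by (auto intro: tendsto_intros)
  note usc = kobayashi_usc[OF _ l1 l2 zD, folded A_def]
  have cvr: "admissible_limit (\<lambda>k. cs (r k)) c" by (rule admissible_limit_subseq[OF cv r])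
  have lower: "\<forall>\<^sub>F k in sequentially. x < kobayashi_metric (mdom (ds k)) (fst (\<zeta> k)) (snd (\<zeta> k))"
    if ds: "admissible_limit ds c" and x: "x < A" for ds x
  proof (rule ccontr)
    let ?a = "\<lambda>k. kobayashi_metric (mdom (ds k)) (fst (\<zeta> k)) (snd (\<zeta> k))"
    assume "\<not> ?thesis"
    then obtain s :: "nat \<Rightarrow> nat" where s: "strict_mono s" "\<forall>n. \<not> x < ?a (s n)" using not_eventually_sequentiallyD by blast
    have less: "?a (s k) < (x + A) / 2" for k using s(2)[rule_format, of k] x by (simp add: field_simps)
    have "A \<le> (x + A) / 2"
      unfolding A_def
    proof (rule kobayashi_lsc[OF admissible_limit_subseq[OF ds s(1)] _ _ zD])
      show "(\<lambda>k. fst (\<zeta> (s k))) \<longlonglongrightarrow> fst z" using LIMSEQ_subseq_LIMSEQ[OF l1 s(1)] by (simp add: o_def)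
      show "(\<lambda>k. snd (\<zeta> (s k))) \<longlonglongrightarrow> snd z" using LIMSEQ_subseq_LIMSEQ[OF l2 s(1)] by (simp add: o_def)
    qed (use less in \<open>simp add: A_def\<close>)
    then show False using x by simp
  qed
  have ge: "\<forall>\<^sub>F k in sequentially. x < b k" if "x < A" for x unfolding b_def by (rule lower[OF cvr that])
  have ge2: "\<forall>\<^sub>F k in sequentially. x < a k" if "x < A" for x unfolding a_def by (rule lower[OF admissible_limit_const[OF ad] that])
  have le: "\<forall>\<^sub>F k in sequentially. b k < x" if "A < x" for x unfolding b_def by (rule usc[OF cvr that])
  have le2: "\<forall>\<^sub>F k in sequentially. a k < x" if "A < x" for x unfolding a_def by (rule usc[OF admissible_limit_const[OF ad] that])
  \<comment> \<open>A third is enough: \<open>(1 - e) * (1 + e / 3) \<le> 1 - e / 3\<close> and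
    \<open>(1 + e) * (1 - e / 3) \<ge> 1 + e / 3\<close> for \<open>0 < e < 1\<close>.\<close>
  have "(1 - e / 3) * A < A" "A < (1 + e / 3) * A" using A e by auto
  from ge[OF this(1)] ge2[OF this(1)] le[OF this(2)] le2[OF this(2)]
  have "\<forall>\<^sub>F k in sequentially. (1 - e) * a k \<le> b k \<and> b k \<le> (1 + e) * a k"
  proof eventually_elim
    case (elim k)
    have e9: "0 \<le> e * e" by simp
    have "(1 - e) * a k \<le> (1 - e) * ((1 + e / 3) * A)" using elim e by (intro mult_left_mono) auto
    also have "\<dots> = ((1 - e) * (1 + e / 3)) * A" by simp
    also have "\<dots> \<le> (1 - e / 3) * A" using A e e9 by (intro mult_right_mono) (auto simp: algebra_simps)
    finally have 1: "(1 - e) * a k \<le> b k" using elim by linarith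
    have "e * e \<le> e * 1" using e by (intro mult_left_mono) auto
    then have "1 + e / 3 \<le> 1 + e - e / 3 - e * e / 3" by simp
    also have "\<dots> = (1 + e) * (1 - e / 3)" by (simp add: field_simps)
    finally have "(1 + e / 3) * A \<le> ((1 + e) * (1 - e / 3)) * A" using A by (intro mult_right_mono) auto
    also have "\<dots> = (1 + e) * ((1 - e / 3) * A)" by simp
    also have "\<dots> \<le> (1 + e) * a k" using elim e by (intro mult_left_mono) auto
    finally show ?case using 1 elim by linarith
  qed
  then obtain k where "(1 - e) * a k \<le> b k \<and> b k \<le> (1 + e) * a k" using eventually_happens[of _ sequentially] by auto
  then show "\<exists>k. (1 - e) * kobayashi_metric (mdom c) (fst (\<zeta> k)) (snd (\<zeta> k)) \<le> kobayashi_metric (mdom (cs (r k))) (fst (\<zeta> k)) (snd (\<zeta> k)) \<and>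
    kobayashi_metric (mdom (cs (r k))) (fst (\<zeta> k)) (snd (\<zeta> k)) \<le> (1 + e) * kobayashi_metric (mdom c) (fst (\<zeta> k)) (snd (\<zeta> k))"
    unfolding a_def b_def by blast
qed

lemma eventually_subset_mdom:
  assumes "admissible_limit cs c" "compact L" "L \<subseteq> mdom c"
  shows "\<forall>\<^sub>F k in sequentially. L \<subseteq> mdom (cs k)"
proof -
  have "\<forall>\<^sub>F k in sequentially. \<forall>z\<in>L. z \<in> mdom (cs k)"
  proof (rule eventually_ball_compactI[OF assms(2)])
    fix z \<zeta> and r :: "nat \<Rightarrow> nat"
    assume "z \<in> L" "\<zeta> \<longlonglongrightarrow> z" "strict_mono r"
    then have "\<forall>\<^sub>F k in sequentially. \<zeta> k \<in> mdom (cs (r k))"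
      using eventually_mdom[OF admissible_limit_subseq[OF assms(1)]] assms(3) by blast
    then show "\<exists>k. \<zeta> k \<in> mdom (cs (r k))" using eventually_happens[of _ sequentially] by auto
  qed
  then show ?thesis by eventually_elim blast
qed

lemma metric_ratio:
  assumes cv: "admissible_limit cs c" and L: "compact L" "L \<subseteq> mdom c" and e: "0 < e" "e < 1"
  shows "\<forall>\<^sub>F k in sequentially. \<forall>x\<in>L. \<forall>X.
    (1 - e) * kobayashi_metric (mdom c) x X \<le> kobayashi_metric (mdom (cs k)) x X
    \<and> kobayashi_metric (mdom (cs k)) x X \<le> (1 + e) * kobayashi_metric (mdom c) x X"
  using metric_ratio_sphere[OF assms] eventually_subset_mdom[OF cv L]
proof eventually_elim
  case (elim k)
  show ?case
  proof (intro ballI allI)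
    fix x and X :: "complex ^ 'n" assume x: "x \<in> L"
    have D: "x \<in> mdom c" "x \<in> mdom (cs k)" using x L elim by auto
    show "(1 - e) * kobayashi_metric (mdom c) x X \<le> kobayashi_metric (mdom (cs k)) x X
    \<and> kobayashi_metric (mdom (cs k)) x X \<le> (1 + e) * kobayashi_metric (mdom c) x X"
    proof (cases "X = 0")
      case True
      then show ?thesis using kobayashi_metric_zero[OF open_mdom] D by simp
    next
      case False
      define Y where "Y = of_real (1 / norm X) *s X"
      have nY: "norm Y = 1" using False by (simp add: Y_def norm_vector_smult norm_divide)
      have X: "X = of_real (norm X) *s Y" using False by (simp add: Y_def vec_eq_iff)
      have n: "norm X > 0" using False by simp
      have k1: "kobayashi_metric (mdom c) x X = norm X * kobayashi_metric (mdom c) x Y"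
        by (subst X) (rule kobayashi_metric_scale[OF open_mdom D(1) n])
      have k2: "kobayashi_metric (mdom (cs k)) x X = norm X * kobayashi_metric (mdom (cs k)) x Y"
        by (subst X) (rule kobayashi_metric_scale[OF open_mdom D(2) n])
      have "(x, Y) \<in> L \<times> sphere 0 1" using x nY by simp
      with elim(1) have "(1 - e) * kobayashi_metric (mdom c) x Y \<le> kobayashi_metric (mdom (cs k)) x Y"
        "kobayashi_metric (mdom (cs k)) x Y \<le> (1 + e) * kobayashi_metric (mdom c) x Y" by force+
      from mult_left_mono[OF this(1), of "norm X"] mult_left_mono[OF this(2), of "norm X"] show ?thesis
        unfolding k1 k2 by (simp add: mult.left_commute)
    qed
  qed
qed

section \<open>Confinement of curves of bounded length\<close>

text \<open>The bounds come in the order of their dependence: the logarithm of the depth, with it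
  the coordinates other than \<open>z\<^sub>0\<close>, and with these \<open>z\<^sub>0\<close>. The
  depth measured by \<open>mfun (cs k)\<close> is then transferred to \<open>mfun c\<close>,
  uniformly on a box fixed before \<open>k\<close>.\<close>

lemma paths_confined:
  assumes cv: "admissible_limit cs c" and K0: "compact K0" "K0 \<subseteq> mdom c" and R: "0 \<le> R"
  shows "\<exists>L. compact L \<and> L \<subseteq> mdom c \<and> (\<forall>\<^sub>F k in sequentially. \<forall>\<gamma>. valid_path \<gamma> \<longrightarrow> path_image \<gamma> \<subseteq> mdom (cs k) \<longrightarrow>
     pathstart \<gamma> \<in> K0 \<longrightarrow> kobayashi_length (mdom (cs k)) \<gamma> \<le> ennreal R \<longrightarrow> path_image \<gamma> \<subseteq> L)"
proof -
  have ad: "admissible (cs k)" for k using cv by (simp add: admissible_limit_def)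
  obtain C1 where C1: "C1 > 0" "\<forall>c p X. admissible c \<longrightarrow> p \<in> mdom c \<longrightarrow>
    (\<forall>i. i \<noteq> i0 \<longrightarrow> cmod (X $ i) \<le> C1 * polyradius (- mfun c p) * kobayashi_metric (mdom c) p X)
    \<and> cmod (dmfun c p X) \<le> C1 * (- mfun c p) * kobayashi_metric (mdom c) p X"
    using kobayashi_estimate by (elim exE conjE) (rule that)
  obtain K where K: "\<forall>k x. cmod (cs k x) \<le> K" using admissible_limit_bounded[OF cv] by blast
  obtain B0 where B0: "\<forall>z\<in>K0. norm z \<le> B0" using K0(1) compact_imp_bounded bounded_iff by blast
  obtain m1 m2 where m: "0 < m1" "\<And>z. z \<in> K0 \<Longrightarrow> m1 \<le> - mfun c z" "\<And>z. z \<in> K0 \<Longrightarrow> - mfun c z \<le> m2"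
  proof (cases "K0 = {}")
    case True
    then show thesis using that[of 1 1] by simp
  next
    case False
    have cont: "continuous_on K0 (\<lambda>z. - mfun c z)" by (intro continuous_intros continuous_on_mfun)
    obtain x where x: "x \<in> K0" "\<forall>y\<in>K0. - mfun c x \<le> - mfun c y" using continuous_attains_inf[OF K0(1) False cont] by blast
    obtain y where y: "y \<in> K0" "\<forall>z\<in>K0. - mfun c z \<le> - mfun c y" using continuous_attains_sup[OF K0(1) False cont] by blast
    have "0 < - mfun c x" using x K0 by (auto simp: mdom_def)
    then show thesis using that[of "- mfun c x" "- mfun c y"] x y by blast
  qed
  have unif: "\<forall>\<^sub>F k in sequentially. \<forall>z\<in>Q. \<bar>mfun (cs k) z - mfun c z\<bar> \<le> \<eta>" if "compact Q" "0 < \<eta>" for Q \<eta>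
  proof (rule eventually_ball_compactI[OF that(1)])
    fix z \<zeta> and r :: "nat \<Rightarrow> nat"
    assume z: "z \<in> Q" "\<zeta> \<longlonglongrightarrow> z" "strict_mono r"
    have "(\<lambda>k. mfun (cs (r k)) (\<zeta> k) - mfun c (\<zeta> k)) \<longlonglongrightarrow> mfun c z - mfun c z"
      by (intro tendsto_diff tendsto_mfun_limit[OF admissible_limit_subseq[OF cv z(3)] z(2)] tendsto_mfun z(2) tendsto_const)
    then have "(\<lambda>k. \<bar>mfun (cs (r k)) (\<zeta> k) - mfun c (\<zeta> k)\<bar>) \<longlonglongrightarrow> 0" by (simp add: tendsto_rabs_zero_iff)
    from order_tendstoD(2)[OF this that(2)] obtain k where "\<bar>mfun (cs (r k)) (\<zeta> k) - mfun c (\<zeta> k)\<bar> < \<eta>"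
      using eventually_happens[of _ sequentially] by auto
    then show "\<exists>k. \<bar>mfun (cs (r k)) (\<zeta> k) - mfun c (\<zeta> k)\<bar> \<le> \<eta>" by (auto intro: less_imp_le)
  qed
  \<comment> \<open>For large \<open>k\<close> the depth at the start lies between
    \<open>m1 / 2\<close> and \<open>m2 + m1 / 2\<close>, and along the curve it changes at most by
    the factor \<open>exp (C1 * R)\<close>; \<open>\<Delta>\<close> and \<open>\<eta>\<close> are
    the resulting extremes.\<close>
  define \<Delta> where "\<Delta> = (m2 + m1 / 2) * exp (C1 * R)"
  define \<eta> where "\<eta> = (m1 / 2) * exp (- (C1 * R))"
  define M where "M = C1 * polyradius \<Delta>"
  \<comment> \<open>The factor 2 adds up real and imaginary parts. The absolute value is there
    because \<open>M > 0\<close> is derived only later, from the depth at the start of a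
    curve.\<close>
  define B where "B = B0 + 2 * \<bar>M\<bar> * R"
  obtain C2 where C2: "C2 > 0" "\<forall>c p X i. admissible c \<longrightarrow> (\<forall>x. cmod (c x) \<le> K) \<longrightarrow> p \<in> mdom c \<longrightarrow> - mfun c p \<le> \<Delta> \<longrightarrow> (\<forall>i. i \<noteq> i0 \<longrightarrow> cmod (p $ i) \<le> B) \<longrightarrow>
    cmod (X $ i) \<le> C2 * kobayashi_metric (mdom c) p X"
    using kobayashi_lower[of K \<Delta> B] by (elim exE conjE) (rule that)
  define B' where "B' = max B (B0 + 2 * C2 * R)"
  define L where "L = {z. \<forall>i. cmod (z $ i) \<le> B'} \<inter> {z. mfun c z \<le> - (\<eta> / 2)}"
  have eta: "\<eta> > 0" using m by (simp add: \<eta>_def)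
  have "closed {z. mfun c z \<le> - (\<eta> / 2)}" by (intro closed_Collect_le continuous_on_mfun continuous_on_const)
  then have "compact L" unfolding L_def by (rule compact_Int_closed[OF compact_polybox])
  moreover have "L \<subseteq> mdom c" using eta by (auto simp: L_def mdom_def)
  moreover have "\<forall>\<^sub>F k in sequentially. \<forall>\<gamma>. valid_path \<gamma> \<longrightarrow> path_image \<gamma> \<subseteq> mdom (cs k) \<longrightarrow>
     pathstart \<gamma> \<in> K0 \<longrightarrow> kobayashi_length (mdom (cs k)) \<gamma> \<le> ennreal R \<longrightarrow> path_image \<gamma> \<subseteq> L"
  proof -
    have "\<forall>\<^sub>F k in sequentially. \<forall>z\<in>K0. \<bar>mfun (cs k) z - mfun c z\<bar> \<le> m1 / 2"
      using m(1) by (intro unif[OF K0(1)]) simp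
    moreover have "\<forall>\<^sub>F k in sequentially. \<forall>z\<in>{z. \<forall>i. cmod (z $ i) \<le> B'}. \<bar>mfun (cs k) z - mfun c z\<bar> \<le> \<eta> / 2"
      using eta by (intro unif[OF compact_polybox]) simp
    ultimately have "\<forall>\<^sub>F k in sequentially. (\<forall>z\<in>K0. \<bar>mfun (cs k) z - mfun c z\<bar> \<le> m1 / 2) \<and>
       (\<forall>z\<in>{z. \<forall>i. cmod (z $ i) \<le> B'}. \<bar>mfun (cs k) z - mfun c z\<bar> \<le> \<eta> / 2)" by (rule eventually_conj)
    then show ?thesis
    proof (rule eventually_mono, intro allI impI)
      fix k and \<gamma> :: "real \<Rightarrow> complex ^ 'n"
      assume u: "(\<forall>z\<in>K0. \<bar>mfun (cs k) z - mfun c z\<bar> \<le> m1 / 2) \<and>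
         (\<forall>z\<in>{z. \<forall>i. cmod (z $ i) \<le> B'}. \<bar>mfun (cs k) z - mfun c z\<bar> \<le> \<eta> / 2)"
        and vp: "valid_path \<gamma>" and im: "path_image \<gamma> \<subseteq> mdom (cs k)" and st: "pathstart \<gamma> \<in> K0"
        and len: "kobayashi_length (mdom (cs k)) \<gamma> \<le> ennreal R"
      note u1 = u[THEN conjunct1] and u2 = u[THEN conjunct2]
      let ?d = "\<lambda>z. - mfun (cs k) z"
      let ?F = "kobayashi_metric (mdom (cs k))"
      have inD: "\<gamma> s \<in> mdom (cs k)" if "s \<in> {0..1}" for s using im that by (auto simp: path_image_def)
      have dpos: "?d z > 0" if "z \<in> mdom (cs k)" for z using that by (simp add: mdom_def)
      have g0: "\<gamma> 0 \<in> K0" using st by (simp add: pathstart_def)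
      have d0: "m1 / 2 \<le> ?d (\<gamma> 0)" "?d (\<gamma> 0) \<le> m2 + m1 / 2"
        using u1[rule_format, OF g0] m(2,3)[OF g0] unfolding abs_le_iff by linarith+
      have lnv: "\<bar>ln (?d (\<gamma> s)) - ln (?d (\<gamma> 0))\<bar> \<le> C1 * R" if s: "s \<in> {0..1}" for s
      proof (rule path_variation[where \<phi> = "\<lambda>z. ln (?d z)" and \<phi>' = "\<lambda>z X. - Re (dmfun (cs k) z X) / ?d z", OF vp _ _ len C1(1) R s])
        fix z X assume "z \<in> path_image \<gamma>"
        then have zD: "z \<in> mdom (cs k)" using im by auto
        show "((\<lambda>z. ln (?d z)) has_derivative (\<lambda>X. - Re (dmfun (cs k) z X) / ?d z)) (at z)"
          using dpos[OF zD] by (auto intro!: derivative_eq_intros mfun_has_derivative simp: field_simps)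
        have "\<bar>- Re (dmfun (cs k) z X) / ?d z\<bar> \<le> cmod (dmfun (cs k) z X) / ?d z"
        proof -
          have "\<bar>- Re (dmfun (cs k) z X) / ?d z\<bar> = \<bar>Re (dmfun (cs k) z X)\<bar> / ?d z"
            using abs_div_pos[OF dpos[OF zD], of "- Re (dmfun (cs k) z X)"] by (simp only: abs_minus_cancel)
          then show ?thesis using dpos[OF zD] abs_Re_le_cmod[of "dmfun (cs k) z X"] by (metis divide_right_mono less_imp_le)
        qed
        also have "\<dots> \<le> C1 * ?F z X"
        proof -
          have "cmod (dmfun (cs k) z X) \<le> C1 * ?d z * ?F z X" using C1(2)[rule_format, OF ad zD] by blast
          then show ?thesis using dpos[OF zD] by (subst pos_divide_le_eq) (simp_all add: mult_ac)
        qed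
        finally show "\<bar>- Re (dmfun (cs k) z X) / ?d z\<bar> \<le> C1 * ?F z X" .
      qed
      have dup: "?d (\<gamma> s) \<le> \<Delta>" and dlow: "\<eta> \<le> ?d (\<gamma> s)" if s: "s \<in> {0..1}" for s
      proof -
        have p0: "?d (\<gamma> 0) > 0" and ps: "?d (\<gamma> s) > 0" using dpos inD[of 0] inD[OF s] by auto
        have "ln (?d (\<gamma> s)) \<le> ln (?d (\<gamma> 0)) + C1 * R" using lnv[OF s] by linarith
        then have "exp (ln (?d (\<gamma> s))) \<le> exp (ln (?d (\<gamma> 0)) + C1 * R)" by simp
        then have "?d (\<gamma> s) \<le> ?d (\<gamma> 0) * exp (C1 * R)" using p0 ps by (simp only: exp_add exp_ln)
        also have "\<dots> \<le> \<Delta>" unfolding \<Delta>_def using d0 by (intro mult_right_mono) auto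
        finally show "?d (\<gamma> s) \<le> \<Delta>" .
        have "ln (?d (\<gamma> 0)) + - (C1 * R) \<le> ln (?d (\<gamma> s))" using lnv[OF s] by linarith
        then have "exp (ln (?d (\<gamma> 0)) + - (C1 * R)) \<le> exp (ln (?d (\<gamma> s)))" by simp
        then have "?d (\<gamma> 0) * exp (- (C1 * R)) \<le> ?d (\<gamma> s)" using p0 ps by (simp only: exp_add exp_ln)
        moreover have "\<eta> \<le> ?d (\<gamma> 0) * exp (- (C1 * R))" unfolding \<eta>_def using d0 by (intro mult_right_mono) auto
        ultimately show "\<eta> \<le> ?d (\<gamma> s)" by linarith
      qed
      have comp: "cmod (\<gamma> s $ i - \<gamma> 0 $ i) \<le> 2 * V * R"
        if s: "s \<in> {0..1}" and V: "0 < V" and Vb: "\<And>z X. z \<in> path_image \<gamma> \<Longrightarrow> cmod (X $ i) \<le> V * ?F z X" for s i V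
      proof -
        have re: "\<bar>Re (\<gamma> s $ i) - Re (\<gamma> 0 $ i)\<bar> \<le> V * R"
        proof (rule path_variation[where \<phi> = "\<lambda>z. Re (z $ i)" and \<phi>' = "\<lambda>z X. Re (X $ i)", OF vp _ _ len V R s])
          fix z X assume z: "z \<in> path_image \<gamma>"
          show "((\<lambda>z. Re (z $ i)) has_derivative (\<lambda>X. Re (X $ i))) (at z)"
            by (intro bounded_linear_imp_has_derivative bounded_linear_compose[OF bounded_linear_Re bounded_linear_vec_nth])
          show "\<bar>Re (X $ i)\<bar> \<le> V * ?F z X" using Vb[OF z, of X] abs_Re_le_cmod[of "X $ i"] by linarith
        qed
        have im: "\<bar>Im (\<gamma> s $ i) - Im (\<gamma> 0 $ i)\<bar> \<le> V * R"
        proof (rule path_variation[where \<phi> = "\<lambda>z. Im (z $ i)" and \<phi>' = "\<lambda>z X. Im (X $ i)", OF vp _ _ len V R s])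
          fix z X assume z: "z \<in> path_image \<gamma>"
          show "((\<lambda>z. Im (z $ i)) has_derivative (\<lambda>X. Im (X $ i))) (at z)"
            by (intro bounded_linear_imp_has_derivative bounded_linear_compose[OF bounded_linear_Im bounded_linear_vec_nth])
          show "\<bar>Im (X $ i)\<bar> \<le> V * ?F z X" using Vb[OF z, of X] abs_Im_le_cmod[of "X $ i"] by linarith
        qed
        have "cmod (\<gamma> s $ i - \<gamma> 0 $ i) \<le> \<bar>Re (\<gamma> s $ i - \<gamma> 0 $ i)\<bar> + \<bar>Im (\<gamma> s $ i - \<gamma> 0 $ i)\<bar>" by (rule cmod_le)
        then show ?thesis using re im by (simp add: mult.assoc)
      qed
      have b0: "cmod (\<gamma> 0 $ i) \<le> B0" for i using B0 g0 Finite_Cartesian_Product.norm_nth_le[of "\<gamma> 0" i] order_trans by blast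
      have tri: "cmod (\<gamma> s $ i) \<le> B0 + cmod (\<gamma> s $ i - \<gamma> 0 $ i)" for s i
        using norm_triangle_ineq[of "\<gamma> s $ i - \<gamma> 0 $ i" "\<gamma> 0 $ i"] b0[of i] by simp
      have "\<Delta> > 0" using dup[of 0] dpos[OF inD[of 0]] by simp
      then have M: "M > 0" unfolding M_def using C1(1) polyradius_pos by simp
      have bi: "cmod (\<gamma> s $ i) \<le> B" if s: "s \<in> {0..1}" and i: "i \<noteq> i0" for s i
      proof -
        have "cmod (\<gamma> s $ i - \<gamma> 0 $ i) \<le> 2 * M * R"
        proof (rule comp[OF s M])
          fix z X assume z: "z \<in> path_image \<gamma>"
          then have zD: "z \<in> mdom (cs k)" using im by auto
          obtain t where t: "t \<in> {0..1}" "z = \<gamma> t" using z by (auto simp: path_image_def)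
          have "cmod (X $ i) \<le> C1 * polyradius (?d z) * ?F z X" using C1(2)[rule_format, OF ad zD] i by blast
          also have "\<dots> \<le> M * ?F z X" unfolding M_def
            using dup[OF t(1)] t(2) C1(1) kobayashi_metric_nonneg[OF open_mdom zD]
            by (intro mult_right_mono mult_left_mono polyradius_mono) auto
          finally show "cmod (X $ i) \<le> M * ?F z X" .
        qed
        then show ?thesis using tri[of s i] M by (simp add: B_def)
      qed
      have b00: "cmod (\<gamma> s $ i0) \<le> B0 + 2 * C2 * R" if s: "s \<in> {0..1}" for s
      proof -
        have "cmod (\<gamma> s $ i0 - \<gamma> 0 $ i0) \<le> 2 * C2 * R"
        proof (rule comp[OF s C2(1)])
          fix z X assume z: "z \<in> path_image \<gamma>"
          then have zD: "z \<in> mdom (cs k)" using im by auto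
          obtain t where t: "t \<in> {0..1}" "z = \<gamma> t" using z by (auto simp: path_image_def)
          show "cmod (X $ i0) \<le> C2 * ?F z X"
            by (rule C2(2)[rule_format, OF ad K[rule_format] zD]) (use dup bi t in auto)
        qed
        then show ?thesis using tri[of s i0] by linarith
      qed
      show "path_image \<gamma> \<subseteq> L"
      proof
        fix z assume "z \<in> path_image \<gamma>"
        then obtain s where s: "s \<in> {0..1}" "z = \<gamma> s" by (auto simp: path_image_def)
        have box: "z \<in> {z. \<forall>i. cmod (z $ i) \<le> B'}"
        proof (rule CollectI, rule allI)
          fix i show "cmod (z $ i) \<le> B'" using bi[OF s(1), of i] b00[OF s(1)] s(2) by (cases "i = i0") (auto simp: B'_def)
        qed
        have "mfun c z \<le> - (\<eta> / 2)" using u2[rule_format, OF box] dlow[OF s(1)] unfolding s(2) abs_le_iff by linarith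
        then show "z \<in> L" using box by (simp add: L_def)
      qed
    qed
  qed
  ultimately show ?thesis by blast
qed

end

section \<open>Limits of the Kobayashi distance\<close>

text \<open>Kept in \<open>ennreal\<close>, where an infinite value remains visible;
  \<open>enn2real\<close> would send it to 0.\<close>

definition path_inf :: "(complex ^ 'n) set \<Rightarrow> complex ^ 'n \<Rightarrow> complex ^ 'n \<Rightarrow> ennreal" where
  "path_inf D p q = (INF g \<in> {g. valid_path g \<and> path_image g \<subseteq> D \<and> pathstart g = p \<and> pathfinish g = q}. kobayashi_length D g)"

lemma kobayashi_dist_eq: "kobayashi_dist D p q = enn2real (path_inf D p q)"
  by (simp add: kobayashi_dist_def path_inf_def)

lemma path_inf_le:
  assumes "valid_path g" "path_image g \<subseteq> D" "pathstart g = p" "pathfinish g = q"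
  shows "path_inf D p q \<le> kobayashi_length D g"
  unfolding path_inf_def by (rule INF_lower) (use assms in simp)

lemma path_inf_near:
  assumes "path_inf D p q \<le> ennreal R" "0 < e"
  obtains g where "valid_path g" "path_image g \<subseteq> D" "pathstart g = p" "pathfinish g = q"
    "kobayashi_length D g < ennreal (enn2real (path_inf D p q) + e)"
proof -
  have "path_inf D p q < top" using assms(1) by (rule le_less_trans) simp
  then have "path_inf D p q = ennreal (enn2real (path_inf D p q))" by simp
  also have "\<dots> < ennreal (enn2real (path_inf D p q) + e)" using assms(2) by (intro ennreal_lessI) (auto intro: add_nonneg_pos)
  finally have "path_inf D p q < ennreal (enn2real (path_inf D p q) + e)" .
  then obtain g where "g \<in> {g. valid_path g \<and> path_image g \<subseteq> D \<and> pathstart g = p \<and> pathfinish g = q}"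
    "kobayashi_length D g < ennreal (enn2real (path_inf D p q) + e)"
    using INF_less_iff[of "kobayashi_length D" "{g. valid_path g \<and> path_image g \<subseteq> D \<and> pathstart g = p \<and> pathfinish g = q}"]
    unfolding path_inf_def by blast
  then show thesis using that by blast
qed

lemma kobayashi_length_le_ball:
  fixes D :: "(complex ^ 'n) set"
  assumes "0 < r" "\<And>t. t \<in> {0..1} \<Longrightarrow> cball (g t) r \<subseteq> D" "\<And>t. t \<in> {0..1} \<Longrightarrow> norm (vector_derivative g (at t)) \<le> V"
  shows "kobayashi_length D g \<le> ennreal (V / r)"
proof -
  have "kobayashi_length D g \<le> (\<integral>\<^sup>+t. ennreal (V / r) * indicator {0..1::real} t \<partial>lborel)"
    unfolding kobayashi_length_def
  proof (rule nn_integral_mono)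
    fix t :: real
    show "ennreal (kobayashi_metric D (g t) (vector_derivative g (at t))) * indicator {0..1} t \<le> ennreal (V / r) * indicator {0..1} t"
    proof (cases "t \<in> {0..1}")
      case True
      have "kobayashi_metric D (g t) (vector_derivative g (at t)) \<le> norm (vector_derivative g (at t)) / r"
        by (rule kobayashi_metric_le_ball[OF assms(2)[OF True] assms(1)])
      also have "\<dots> \<le> V / r" using assms(1) assms(3)[OF True] by (intro divide_right_mono) auto
      finally show ?thesis using True by (simp add: ennreal_leI)
    qed simp
  qed
  also have "\<dots> = ennreal (V / r)" by (simp add: nn_integral_cmult_indicator)
  finally show ?thesis .
qed

context model_family
begin

text \<open>The dip in the direction \<open>- e\<^sub>0\<close> lowers the defining function, so for large \<open>M\<close> the arc stays
  in the domain although the segment from \<open>p\<close> to \<open>q\<close> may leave it.\<close>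

definition arc :: "real \<Rightarrow> complex ^ 'n \<Rightarrow> complex ^ 'n \<Rightarrow> real \<Rightarrow> complex ^ 'n" where
  "arc M p q t = (1 - t) *\<^sub>R p + t *\<^sub>R q - (M * (t * (1 - t))) *\<^sub>R axis i0 1"

lemma mfun_arc: "mfun c (arc M p q t) = mfun c ((1 - t) *\<^sub>R p + t *\<^sub>R q) - M * (t * (1 - t))"
proof -
  have n: "arc M p q t $ i = ((1 - t) *\<^sub>R p + t *\<^sub>R q) $ i" if "i \<noteq> i0" for i using that by (simp add: arc_def axis_def)
  have "(\<Sum>\<alpha>\<in>- {i0, i1}. (cmod (arc M p q t $ \<alpha>))\<^sup>2) = (\<Sum>\<alpha>\<in>- {i0, i1}. (cmod (((1 - t) *\<^sub>R p + t *\<^sub>R q) $ \<alpha>))\<^sup>2)"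
    by (intro sum.cong refl) (metis n Compl_iff insertI1)
  moreover have "arc M p q t $ i1 = ((1 - t) *\<^sub>R p + t *\<^sub>R q) $ i1" using n[of i1] i01 by auto
  moreover have "Re (arc M p q t $ i0) = Re (((1 - t) *\<^sub>R p + t *\<^sub>R q) $ i0) - M * (t * (1 - t))"
    by (simp add: arc_def axis_def)
  ultimately show ?thesis unfolding mfun_def by simp
qed

lemma arc_vector_derivative:
  "(arc M p q has_vector_derivative (q - p - (M * (1 - 2 * t)) *\<^sub>R axis i0 1)) (at t)"
proof -
  have "((\<lambda>t. (1 - t) *\<^sub>R p + t *\<^sub>R q - (M * (t * (1 - t))) *\<^sub>R axis i0 1) has_vector_derivative
     ((- 1) *\<^sub>R p + 1 *\<^sub>R q - (M * (1 - 2 * t)) *\<^sub>R axis i0 1)) (at t)"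
  proof (intro has_vector_derivative_diff has_vector_derivative_add)
    have "((\<lambda>t::real. 1 - t) has_real_derivative - 1) (at t)" by (auto intro!: derivative_eq_intros)
    then show "((\<lambda>t. (1 - t) *\<^sub>R p) has_vector_derivative (- 1) *\<^sub>R p) (at t)"
      using has_vector_derivative_scaleR[of "\<lambda>t. 1 - t" "- 1" t UNIV "\<lambda>_. p" 0] by simp
    show "((\<lambda>t. t *\<^sub>R q) has_vector_derivative 1 *\<^sub>R q) (at t)"
      using has_vector_derivative_scaleR[of "\<lambda>t. t" 1 t UNIV "\<lambda>_. q" 0] by simp
    have "((\<lambda>t. M * (t * (1 - t))) has_real_derivative M * (1 - 2 * t)) (at t)"
      by (auto intro!: derivative_eq_intros simp: algebra_simps)
    then show "((\<lambda>t. (M * (t * (1 - t))) *\<^sub>R axis i0 1) has_vector_derivative (M * (1 - 2 * t)) *\<^sub>R axis i0 (1::complex)) (at t)"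
      using has_vector_derivative_scaleR[of "\<lambda>t. M * (t * (1 - t))" "M * (1 - 2 * t)" t UNIV "\<lambda>_. axis i0 1" 0] by simp
  qed
  then show ?thesis unfolding arc_def[abs_def] by simp
qed

lemma valid_path_arc: "valid_path (arc M p q)"
  unfolding valid_path_def
proof (rule C1_differentiable_imp_piecewise)
  show "arc M p q C1_differentiable_on {0..1}"
    unfolding C1_differentiable_on_def
    by (intro exI[of _ "\<lambda>t. q - p - (M * (1 - 2 * t)) *\<^sub>R axis i0 1"] conjI ballI arc_vector_derivative continuous_intros)
qed

text \<open>Near the ends of the parameter interval the segment is inside by continuity; in between
  \<open>t * (1 - t)\<close> is bounded below and a large dip wins. Compactness yields one
  \<open>M\<close>.\<close>

lemma arcs_inside:
  assumes K: "compact K" "K \<subseteq> mdom c \<times> mdom c"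
  shows "\<exists>M\<ge>0. \<forall>p q t. (p, q) \<in> K \<longrightarrow> t \<in> {0..1} \<longrightarrow> arc M p q t \<in> mdom c"
proof -
  have "\<forall>\<^sub>F k in sequentially. \<forall>x\<in>K \<times> {0..1}. arc (real k) (fst (fst x)) (snd (fst x)) (snd x) \<in> mdom c"
  proof (rule eventually_ball_compactI)
    show "compact (K \<times> {0..1::real})" by (intro compact_Times K) simp
    fix x \<zeta> and r :: "nat \<Rightarrow> nat"
    assume x: "x \<in> K \<times> {0..1::real}" and xk: "\<And>k. \<zeta> k \<in> K \<times> {0..1::real}" and lim: "\<zeta> \<longlonglongrightarrow> x" and r: "strict_mono r"
    define \<psi> where "\<psi> y = mfun c ((1 - snd y) *\<^sub>R fst (fst y) + snd y *\<^sub>R snd (fst y))" for y :: "((complex ^ 'n) \<times> (complex ^ 'n)) \<times> real"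
    have limpsi: "(\<lambda>k. \<psi> (\<zeta> k)) \<longlonglongrightarrow> \<psi> x"
      unfolding \<psi>_def by (intro tendsto_mfun tendsto_const tendsto_intros lim)
    have limt: "(\<lambda>k. snd (\<zeta> k)) \<longlonglongrightarrow> snd x" by (intro tendsto_intros lim)
    have "\<exists>k. \<psi> (\<zeta> k) - real (r k) * (snd (\<zeta> k) * (1 - snd (\<zeta> k))) < 0"
    proof (cases "snd x = 0 \<or> snd x = 1")
      case True
      then have "\<psi> x < 0" using x K by (auto simp: \<psi>_def mdom_def)
      from order_tendstoD(2)[OF limpsi this] obtain k where k: "\<psi> (\<zeta> k) < 0" using eventually_happens[of _ sequentially] by auto
      have "0 \<le> real (r k) * (snd (\<zeta> k) * (1 - snd (\<zeta> k)))"
        using xk[of k] by (intro mult_nonneg_nonneg) (auto simp: mem_Times_iff)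
      then show ?thesis using k by (intro exI[of _ k]) linarith
    next
      case False
      then have t: "0 < snd x * (1 - snd x)" using x by (auto simp: mem_Times_iff)
      define \<tau> where "\<tau> = snd x * (1 - snd x)"
      have "(\<lambda>k. snd (\<zeta> k) * (1 - snd (\<zeta> k))) \<longlonglongrightarrow> \<tau>" unfolding \<tau>_def by (intro tendsto_intros limt)
      then have e1: "\<forall>\<^sub>F k in sequentially. \<tau> / 2 < snd (\<zeta> k) * (1 - snd (\<zeta> k))" using t by (intro order_tendstoD(1)) (auto simp: \<tau>_def)
      have e2: "\<forall>\<^sub>F k in sequentially. \<psi> (\<zeta> k) < \<psi> x + 1" using order_tendstoD(2)[OF limpsi] by simp
      obtain k0 :: nat where k0: "(\<psi> x + 1) / (\<tau> / 2) \<le> real k0" using real_arch_simple by blast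
      have e3: "\<forall>\<^sub>F k in sequentially. k0 \<le> k" by (rule eventually_ge_at_top)
      obtain k where k: "\<tau> / 2 < snd (\<zeta> k) * (1 - snd (\<zeta> k))" "\<psi> (\<zeta> k) < \<psi> x + 1" "k0 \<le> k"
        using eventually_happens[OF eventually_conj[OF e1 eventually_conj[OF e2 e3]]] by auto
      have "real k0 \<le> real (r k)" using k(3) seq_suble[OF r, of k] by linarith
      then have "(\<psi> x + 1) / (\<tau> / 2) \<le> real (r k)" using k0 by linarith
      then have "\<psi> x + 1 \<le> real (r k) * (\<tau> / 2)" using t unfolding \<tau>_def[symmetric] by (simp add: pos_divide_le_eq field_simps)
      also have "\<dots> \<le> real (r k) * (snd (\<zeta> k) * (1 - snd (\<zeta> k)))" using k(1) by (intro mult_left_mono) auto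
      finally show ?thesis using k(2) by (intro exI[of _ k]) linarith
    qed
    then show "\<exists>k. arc (real (r k)) (fst (fst (\<zeta> k))) (snd (fst (\<zeta> k))) (snd (\<zeta> k)) \<in> mdom c"
      unfolding mdom_def mem_Collect_eq mfun_arc \<psi>_def .
  qed
  then obtain k where "\<forall>x\<in>K \<times> {0..1}. arc (real k) (fst (fst x)) (snd (fst x)) (snd x) \<in> mdom c"
    unfolding eventually_sequentially by blast
  then show ?thesis by (intro exI[of _ "real k"]) force
qed

text \<open>The arcs sweep out a compact subset of the domain, so balls of one radius fit around all
  their points and bound the metric along them.\<close>

lemma path_inf_bounded:
  assumes K: "compact K" "K \<subseteq> mdom c \<times> mdom c"
  shows "\<exists>R\<ge>0. \<forall>p q. (p, q) \<in> K \<longrightarrow> path_inf (mdom c) p q \<le> ennreal R"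
proof -
  obtain M where M: "M \<ge> 0" "\<forall>p q t. (p, q) \<in> K \<longrightarrow> t \<in> {0..1} \<longrightarrow> arc M p q t \<in> mdom c" using arcs_inside[OF K] by blast
  define L where "L = (\<lambda>x. arc M (fst (fst x)) (snd (fst x)) (snd x)) ` (K \<times> {0..1})"
  have "compact L" unfolding L_def arc_def
    by (intro compact_continuous_image continuous_intros compact_Times K) simp
  moreover have "L \<subseteq> mdom c" using M(2) by (auto simp: L_def)
  ultimately obtain r where r: "r > 0" "(\<Union>x\<in>L. cball x r) \<subseteq> mdom c"
    using compact_subset_open_imp_cball_epsilon_subset[OF _ open_mdom] by blast
  obtain B where B: "\<forall>x\<in>K. norm x \<le> B" using K(1) compact_imp_bounded bounded_iff by blast
  \<comment> \<open>The absolute value keeps the bound nonnegative even for empty \<open>K\<close>,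
    where \<open>B\<close> is arbitrary.\<close>
  have "path_inf (mdom c) p q \<le> ennreal \<bar>(2 * B + M) / r\<bar>" if pq: "(p, q) \<in> K" for p q
  proof -
    have inL: "arc M p q t \<in> L" if "t \<in> {0..1}" for t unfolding L_def using pq that by (intro image_eqI[of _ _ "((p, q), t)"]) auto
    have nb: "norm p \<le> B" "norm q \<le> B"
      using B[rule_format, OF pq] norm_fst_le[of p q] norm_snd_le[of q p] by linarith+
    have "kobayashi_length (mdom c) (arc M p q) \<le> ennreal ((2 * B + M) / r)"
    proof (rule kobayashi_length_le_ball[OF r(1)])
      fix t :: real assume t: "t \<in> {0..1}"
      show "cball (arc M p q t) r \<subseteq> mdom c" using inL[OF t] r(2) by blast
      have "norm (q - p - (M * (1 - 2 * t)) *\<^sub>R axis i0 (1::complex)) \<le> norm (q - p) + norm ((M * (1 - 2 * t)) *\<^sub>R axis i0 (1::complex))"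
        by (rule norm_triangle_ineq4)
      also have "norm (q - p) \<le> 2 * B" using nb norm_triangle_ineq4[of q p] by linarith
      also have "norm ((M * (1 - 2 * t)) *\<^sub>R axis i0 (1::complex)) = M * \<bar>1 - 2 * t\<bar>" using M(1) by (simp add: abs_mult)
      also have "M * \<bar>1 - 2 * t\<bar> \<le> M * 1" using t M(1) by (intro mult_left_mono) auto
      finally show "norm (vector_derivative (arc M p q) (at t)) \<le> 2 * B + M"
        using vector_derivative_at[OF arc_vector_derivative] by simp
    qed
    moreover have "path_inf (mdom c) p q \<le> kobayashi_length (mdom c) (arc M p q)"
    proof (rule path_inf_le[OF valid_path_arc])
      show "path_image (arc M p q) \<subseteq> mdom c" using M(2) pq by (auto simp: path_image_def)
    qed (simp_all add: pathstart_def pathfinish_def arc_def)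
    ultimately show ?thesis by (meson abs_ge_self ennreal_leI order_trans)
  qed
  then show ?thesis by (intro exI[of _ "\<bar>(2 * B + M) / r\<bar>"]) auto
qed

text \<open>For each inequality a nearly minimal curve of one domain, which confinement places in a
  compact set fixed in advance, is measured by the other metric. The upper bound comes first, since
  it limits the lengths that occur in the lower one.\<close>

theorem kobayashi_dist_limit:
  assumes cv: "admissible_limit cs c" and K: "compact K" "K \<subseteq> mdom c \<times> mdom c"
  shows "uniform_limit K (\<lambda>k (p, q). kobayashi_dist (mdom (cs k)) p q) (\<lambda>(p, q). kobayashi_dist (mdom c) p q) sequentially"
proof (rule uniform_limitI)
  fix \<epsilon> :: real assume eps: "\<epsilon> > 0"
  have ad: "admissible c" using cv by (simp add: admissible_limit_def)
  obtain R where R: "R \<ge> 0" "\<forall>p q. (p, q) \<in> K \<longrightarrow> path_inf (mdom c) p q \<le> ennreal R" using path_inf_bounded[OF K] by blast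
  \<comment> \<open>Both differences of distances will be at most
    \<open>e * (R + 3)\<close>.\<close>
  define e where "e = min (1 / 2) (\<epsilon> / (2 * (R + 3)))"
  have e: "0 < e" "e < 1" "e \<le> 1 / 2" "e * (R + 3) < \<epsilon>"
  proof -
    show "0 < e" using eps R(1) by (simp add: e_def)
    show le: "e \<le> 1 / 2" unfolding e_def by (rule min.cobounded1)
    then show "e < 1" by simp
    have "e * (R + 3) \<le> \<epsilon> / (2 * (R + 3)) * (R + 3)" using R(1) by (intro mult_right_mono) (auto simp: e_def)
    also have "\<dots> = \<epsilon> / 2"
    proof -
      have "x / (2 * y) * y = x / 2" if "y \<noteq> 0" for x y :: real using that by simp
      moreover have "R + 3 \<noteq> 0" using R(1) by linarith
      ultimately show ?thesis by blast
    qed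
    also have "\<dots> < \<epsilon>" using eps by simp
    finally show "e * (R + 3) < \<epsilon>" .
  qed
  define K0 where "K0 = fst ` K"
  have K0: "compact K0" "K0 \<subseteq> mdom c" unfolding K0_def using K by (auto intro!: compact_continuous_image continuous_intros)
  \<comment> \<open>Nearly minimal curves of the varying domains have length at most
    \<open>(1 + e) * (d + e) + e\<close>, hence at most \<open>2 * (R + 1) + 1\<close>.\<close>
  define R2 where "R2 = 2 * (R + 1) + 1"
  have R12: "0 \<le> R + 1" "0 \<le> R2" using R(1) by (auto simp: R2_def)
  obtain L1 where L1: "compact L1" "L1 \<subseteq> mdom c" "\<forall>\<^sub>F k in sequentially. \<forall>\<gamma>. valid_path \<gamma> \<longrightarrow> path_image \<gamma> \<subseteq> mdom c \<longrightarrow>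
     pathstart \<gamma> \<in> K0 \<longrightarrow> kobayashi_length (mdom c) \<gamma> \<le> ennreal (R + 1) \<longrightarrow> path_image \<gamma> \<subseteq> L1"
    using paths_confined[OF admissible_limit_const[OF ad] K0 R12(1)] by blast
  then have conf1: "path_image \<gamma> \<subseteq> L1" if "valid_path \<gamma>" "path_image \<gamma> \<subseteq> mdom c" "pathstart \<gamma> \<in> K0" "kobayashi_length (mdom c) \<gamma> \<le> ennreal (R + 1)" for \<gamma>
    using that by (auto simp: eventually_const)
  obtain L2 where L2: "compact L2" "L2 \<subseteq> mdom c" "\<forall>\<^sub>F k in sequentially. \<forall>\<gamma>. valid_path \<gamma> \<longrightarrow> path_image \<gamma> \<subseteq> mdom (cs k) \<longrightarrow>
     pathstart \<gamma> \<in> K0 \<longrightarrow> kobayashi_length (mdom (cs k)) \<gamma> \<le> ennreal R2 \<longrightarrow> path_image \<gamma> \<subseteq> L2"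
    using paths_confined[OF cv K0 R12(2)] by blast
  show "\<forall>\<^sub>F k in sequentially. \<forall>x\<in>K. dist (case x of (p, q) \<Rightarrow> kobayashi_dist (mdom (cs k)) p q) (case x of (p, q) \<Rightarrow> kobayashi_dist (mdom c) p q) < \<epsilon>"
    using L2(3) metric_ratio[OF cv L1(1,2) e(1,2)] metric_ratio[OF cv L2(1,2) e(1,2)] eventually_subset_mdom[OF cv L1(1,2)]
  proof eventually_elim
    case (elim k)
    note conf2 = elim(1) and rat1 = elim(2) and rat2 = elim(3) and sub1 = elim(4)
    show ?case
    proof clarify
      fix p q assume pq: "(p, q) \<in> K"
      let ?D = "mdom c" and ?Dk = "mdom (cs k)"
      have p0: "p \<in> K0" using pq by (force simp: K0_def)
      define d where "d = enn2real (path_inf ?D p q)"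
      define dk where "dk = enn2real (path_inf ?Dk p q)"
      have d0: "0 \<le> d" "0 \<le> dk" by (auto simp: d_def dk_def)
      have I: "path_inf ?D p q \<le> ennreal R" using R(2) pq by blast
      have dR: "d \<le> R" unfolding d_def using enn2real_mono[OF I] R(1) by simp
      have eqI: "path_inf ?D p q = ennreal d" unfolding d_def using le_less_trans[OF I ennreal_less_top] by simp
      obtain g where g: "valid_path g" "path_image g \<subseteq> ?D" "pathstart g = p" "pathfinish g = q" "kobayashi_length ?D g < ennreal (d + e)"
        unfolding d_def by (rule path_inf_near[OF I e(1)])
      have "ennreal (d + e) \<le> ennreal (R + 1)" using dR e(2) by (intro ennreal_leI) simp
      then have g1: "path_image g \<subseteq> L1" using g p0 by (intro conf1) auto
      have "ennreal (1 / (1 + e)) * kobayashi_length ?Dk g \<le> kobayashi_length ?D g"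
      proof (rule kobayashi_length_scale)
        fix z X assume "z \<in> path_image g"
        then have "kobayashi_metric ?Dk z X \<le> (1 + e) * kobayashi_metric ?D z X" using rat1 g1 by blast
        then show "1 / (1 + e) * kobayashi_metric ?Dk z X \<le> kobayashi_metric ?D z X" using e by (simp add: field_simps)
      qed (use e in auto)
      \<comment> \<open>By \<open>sub1\<close> the curve \<open>g\<close> is a competitor in the
        varying domain as well.\<close>
      moreover have "path_inf ?Dk p q \<le> kobayashi_length ?Dk g"
        using g g1 sub1 by (intro path_inf_le) auto
      ultimately have "ennreal (1 / (1 + e)) * path_inf ?Dk p q \<le> ennreal (d + e)"
        using g(5) by (meson less_imp_le mult_left_mono order_trans zero_le)
      then have "ennreal (1 + e) * (ennreal (1 / (1 + e)) * path_inf ?Dk p q) \<le> ennreal (1 + e) * ennreal (d + e)"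
        by (rule mult_left_mono) simp
      moreover have "ennreal (1 + e) * (ennreal (1 / (1 + e)) * path_inf ?Dk p q) = path_inf ?Dk p q"
      proof -
        have "ennreal (1 + e) * ennreal (1 / (1 + e)) = 1" using e by (subst ennreal_mult[symmetric]) auto
        then show ?thesis by (metis mult.assoc mult_1)
      qed
      ultimately have Ik: "path_inf ?Dk p q \<le> ennreal ((1 + e) * (d + e))" using e d0 by (simp add: ennreal_mult)
      then have up: "dk \<le> (1 + e) * (d + e)" unfolding dk_def using enn2real_mono[OF Ik] e d0 by simp
      obtain h where h: "valid_path h" "path_image h \<subseteq> ?Dk" "pathstart h = p" "pathfinish h = q" "kobayashi_length ?Dk h < ennreal (dk + e)"
        unfolding dk_def by (rule path_inf_near[OF Ik e(1)])
      have "(1 + e) * (d + e) \<le> 2 * (R + 1)" using e dR d0 by (intro mult_mono) auto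
      then have "ennreal (dk + e) \<le> ennreal R2" using up e by (intro ennreal_leI) (simp add: R2_def)
      then have h1: "path_image h \<subseteq> L2" using h p0 conf2 by (meson less_imp_le order_trans)
      have "ennreal (1 - e) * kobayashi_length ?D h \<le> kobayashi_length ?Dk h"
        by (rule kobayashi_length_scale) (use rat2 h1 e in auto)
      moreover have "path_inf ?D p q \<le> kobayashi_length ?D h" using h h1 L2(2) by (intro path_inf_le) auto
      ultimately have "ennreal (1 - e) * ennreal d \<le> ennreal (dk + e)"
        using h(5) unfolding eqI by (meson less_imp_le mult_left_mono order_trans zero_le)
      then have "ennreal ((1 - e) * d) \<le> ennreal (dk + e)" using e d0 by (simp add: ennreal_mult)
      then have low: "(1 - e) * d \<le> dk + e" by (subst (asm) ennreal_le_iff) (use d0 e in linarith)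
      have ed: "e * d \<le> e * R" using e dR by (intro mult_left_mono) auto
      have ee: "e * e \<le> e * 1" using e by (intro mult_left_mono) auto
      have u: "(1 + e) * (d + e) = d + e + e * d + e * e" "(1 - e) * d = d - e * d" "e * (R + 3) = e * R + 3 * e"
        by (simp_all add: algebra_simps)
      have "dk - d \<le> e * (R + 3)" using up ed ee e(1) unfolding u by linarith
      moreover have "d - dk \<le> e * (R + 3)" using low ed e(1) unfolding u by linarith
      ultimately have "\<bar>dk - d\<bar> < \<epsilon>" using e(4) by (simp add: abs_less_iff)
      then show "dist (kobayashi_dist ?Dk p q) (kobayashi_dist ?D p q) < \<epsilon>"
        by (simp add: kobayashi_dist_eq dk_def d_def dist_real_def)
    qed
  qed
qed

end

section \<open>The dilations at infinity\<close>

lemma zzbar_eval_eq_pev: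
  assumes "\<And>j k. (j, k) \<in> Poly_Mapping.keys P \<Longrightarrow> j \<le> N \<and> k \<le> N"
  shows "zzbar_eval P z = pev N (Poly_Mapping.lookup P) z"
proof -
  have "zzbar_eval P z = (\<Sum>(j, k)\<in>{..N} \<times> {..N}. Poly_Mapping.lookup P (j, k) * z ^ j * cnj z ^ k)"
    unfolding zzbar_eval_def
    by (rule sum.mono_neutral_left) (use assms in \<open>auto simp: in_keys_iff\<close>)
  then show ?thesis unfolding pev_def by (simp add: sum.cartesian_product)
qed

lemma lookup_homogeneous_part:
  "Poly_Mapping.lookup (homogeneous_part D P) (j, k) = (if j + k = D then Poly_Mapping.lookup P (j, k) else 0)"
proof -
  let ?S = "{(j, k) \<in> Poly_Mapping.keys P. j + k = D}"
  have fin: "finite ?S" by (rule finite_subset[of _ "Poly_Mapping.keys P"]) auto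
  have "Poly_Mapping.lookup (homogeneous_part D P) (j, k) = (\<Sum>x\<in>?S. if x = (j, k) then Poly_Mapping.lookup P x else 0)"
    unfolding homogeneous_part_def lookup_sum by (intro sum.cong refl) (simp add: lookup_single when_def)
  also have "\<dots> = (if (j, k) \<in> ?S then Poly_Mapping.lookup P (j, k) else 0)" using fin by (simp add: sum.delta)
  finally show ?thesis by (auto simp: in_keys_iff)
qed

lemma anisotropic_dilation_image:
  assumes "i0 \<noteq> i1" "s0 \<noteq> 0" "s1 \<noteq> 0" "s \<noteq> 0"
  shows "anisotropic_dilation i0 i1 s0 s1 s ` A = {z. anisotropic_dilation i0 i1 (1 / s0) (1 / s1) (1 / s) z \<in> A}"
proof -
  have 1: "anisotropic_dilation i0 i1 s0 s1 s (anisotropic_dilation i0 i1 (1 / s0) (1 / s1) (1 / s) z) = z" for z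
    using assms by (auto simp: anisotropic_dilation_def vec_eq_iff)
  have 2: "anisotropic_dilation i0 i1 (1 / s0) (1 / s1) (1 / s) (anisotropic_dilation i0 i1 s0 s1 s z) = z" for z
    using assms by (auto simp: anisotropic_dilation_def vec_eq_iff)
  show ?thesis
  proof (intro equalityI subsetI)
    fix z assume "z \<in> {z. anisotropic_dilation i0 i1 (1 / s0) (1 / s1) (1 / s) z \<in> A}"
    then show "z \<in> anisotropic_dilation i0 i1 s0 s1 s ` A" using 1[of z] by (metis image_eqI mem_Collect_eq)
  qed (auto simp: 2)
qed

definition scaled_coeffs :: "nat \<Rightarrow> (nat \<times> nat \<Rightarrow> complex) \<Rightarrow> real \<Rightarrow> nat \<times> nat \<Rightarrow> complex" where
  "scaled_coeffs N c \<nu> = (\<lambda>(j, k). c (j, k) * of_real ((\<nu> powr (1 / real N)) ^ (j + k) / \<nu>))"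

lemma pev_scaled_coeffs:
  "pev N (scaled_coeffs N c \<nu>) z = pev N c (of_real (\<nu> powr (1 / real N)) * z) / of_real \<nu>"
  unfolding pev_def scaled_coeffs_def sum_divide_distrib
  by (intro sum.cong refl) (simp add: power_mult_distrib power_add)

text \<open>The factor is \<open>\<nu>^((j + k) / N - 1)\<close>, identically 1 in degree
  \<open>N\<close> and tending to 0 in lower degrees.\<close>

lemma scaled_coeffs_limit:
  assumes "1 \<le> N" "\<And>j k. c (j, k) \<noteq> 0 \<Longrightarrow> j + k \<le> N" "filterlim \<nu> at_top F"
  shows "((\<lambda>n. scaled_coeffs N c (\<nu> n) (j, k)) \<longlongrightarrow> (if j + k = N then c (j, k) else 0)) F"
proof -
  have pos: "\<forall>\<^sub>F n in F. 0 < \<nu> n" using assms(3) by (simp add: filterlim_at_top_dense)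
  have eq: "(x powr (1 / real N)) ^ i / x = x powr (real i / real N - 1)" if "0 < x" for x i
  proof -
    have "(x powr (1 / real N)) ^ i = x powr (real i / real N)"
      using that by (simp add: powr_powr flip: powr_realpow)
    then show ?thesis using that by (simp add: powr_diff)
  qed
  consider "j + k = N" | "j + k < N" | "c (j, k) = 0" "j + k \<noteq> N" using assms(2)[of j k] by linarith
  then show ?thesis
  proof cases
    case 1
    have "\<forall>\<^sub>F n in F. scaled_coeffs N c (\<nu> n) (j, k) = c (j, k)"
      using pos
    proof eventually_elim
      case (elim n)
      have "(\<nu> n powr (1 / real N)) ^ N / \<nu> n = 1" using eq[OF elim, of N] elim assms(1) by simp
      then show ?case by (simp only: scaled_coeffs_def split 1 of_real_1 mult_1_right)
    qed
    then show ?thesis using 1 by (simp add: tendsto_eventually)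
  next
    case 2
    have "((\<lambda>n. \<nu> n powr (real (j + k) / real N - 1)) \<longlongrightarrow> 0) F"
      using 2 assms(1) by (intro tendsto_neg_powr assms(3)) (simp add: field_simps)
    moreover have "\<forall>\<^sub>F n in F. \<nu> n powr (real (j + k) / real N - 1) = (\<nu> n powr (1 / real N)) ^ (j + k) / \<nu> n"
      using pos by eventually_elim (simp only: eq)
    ultimately have "((\<lambda>n. (\<nu> n powr (1 / real N)) ^ (j + k) / \<nu> n) \<longlongrightarrow> 0) F"
      by (rule Lim_transform_eventually)
    then have "((\<lambda>n. c (j, k) * of_real ((\<nu> n powr (1 / real N)) ^ (j + k) / \<nu> n)) \<longlongrightarrow> c (j, k) * of_real 0) F"
      by (intro tendsto_intros)
    then show ?thesis using 2 by (simp add: scaled_coeffs_def)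
  next
    case 3
    then show ?thesis by (simp add: scaled_coeffs_def)
  qed
qed

text \<open>The dilates of the limit domain are model domains with rescaled coefficients. One
  \<open>\<kappa>\<close>, read off from \<open>P\<close>, serves them all, and the coefficients
  tend to those of the homogeneous part, so \<open>kobayashi_dist_limit\<close> applies.\<close>

theorem proposition8p8:
  fixes \<Omega> W :: "(complex ^ 'n) set"
    and i0 i1 :: 'n
    and r :: "complex ^ 'n \<Rightarrow> real"
    and u :: "nat \<Rightarrow> complex ^ 'n"
    and \<epsilon> :: "nat \<Rightarrow> real"
    and \<Phi> :: "complex ^ 'n \<Rightarrow> complex ^ 'n \<Rightarrow> complex ^ 'n"
    and a :: "complex ^ 'n \<Rightarrow> nat \<Rightarrow> nat \<Rightarrow> complex"
    and b :: "complex ^ 'n \<Rightarrow> 'n \<Rightarrow> nat \<Rightarrow> nat \<Rightarrow> complex"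
    and \<sigma> :: "nat \<Rightarrow> nat"
    and m m' :: nat
    and P :: zzbar_poly
  defines "\<Omega>_hat \<equiv> model_domain i0 i1 P"
    and "\<Omega>_tilde \<equiv> model_domain i0 i1 (homogeneous_part (2 * m') P)"
    and "\<chi>n \<equiv> dilation_at_infinity i0 i1 m'"
  assumes coordinates: "i0 \<noteq> i1"
    and domain: "open \<Omega>" "connected \<Omega>" "\<Omega> \<noteq> {}" "bounded \<Omega>"
    and boundary: "smooth_boundary \<Omega>" "pseudoconvex \<Omega>" "finite_type \<Omega>"
    and rank: "levi_rank_at_least \<Omega> (CARD('n) - 2)"
    and sequence: "\<And>n. u n \<in> \<Omega>" "u \<longlonglongrightarrow> 0" "0 \<in> frontier \<Omega>"
    and defining: "0 \<in> W" "local_defining_function \<Omega> W r"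
    and type_at_limit: "dangelo_type r 0 = ereal (2 * real m)"
    and adapted: "adapted_coordinates i0 i1 r W"
    and cho: "cho_coordinates i0 i1 m r W \<Phi> a b"
    and projections: "\<forall>\<^sub>F n in sequentially. 0 < \<epsilon> n \<and> scaling_point i0 u \<epsilon> n \<in> frontier \<Omega>"
      "\<epsilon> \<longlonglongrightarrow> 0"
    and subsequence: "strict_mono \<sigma>"
    and limit: "exhausting_uniform_limit
        (\<lambda>n. scaling_map i0 i1 m \<Phi> a u \<epsilon> (\<sigma> n) ` W)
        (\<lambda>n. scaled_function i0 i1 m r \<Phi> a u \<epsilon> (\<sigma> n))
        (model_function i0 i1 P)"
    and polynomial: "P \<noteq> 0" "real_polynomial P" "subharmonic (\<lambda>z. Re (zzbar_eval P z))"
      "no_harmonic_terms P" "zzbar_eval P 0 = 0" "zzbar_degree P = 2 * m'" "m' \<le> m"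
  shows "(\<forall>p\<in>\<Omega>_tilde. \<forall>q\<in>\<Omega>_tilde.
            (\<lambda>n. kobayashi_dist (\<chi>n n ` \<Omega>_hat) p q) \<longlonglongrightarrow> kobayashi_dist \<Omega>_tilde p q)
         \<and> (\<forall>K. compact K \<and> K \<subseteq> \<Omega>_tilde \<times> \<Omega>_tilde \<longrightarrow>
              uniform_limit K (\<lambda>n (p, q). kobayashi_dist (\<chi>n n ` \<Omega>_hat) p q)
                (\<lambda>(p, q). kobayashi_dist \<Omega>_tilde p q) sequentially)"
proof -
  define N where "N = 2 * m'"
  define c0 where "c0 = Poly_Mapping.lookup P"
  have ne: "Poly_Mapping.keys P \<noteq> {}" using polynomial(1) by simp
  define degs where "degs = (\<lambda>(j, k). j + k) ` Poly_Mapping.keys P"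
  have degs: "finite degs" "degs \<noteq> {}" "Max degs = N"
    using ne polynomial(6) by (auto simp: degs_def N_def zzbar_degree_def)
  have deg: "j + k \<le> N" if "(j, k) \<in> Poly_Mapping.keys P" for j k
  proof -
    have "j + k \<in> degs" using that unfolding degs_def by force
    then show ?thesis using Max_ge[OF degs(1)] degs(3) by blast
  qed
  have supp: "j + k \<le> N" if "c0 (j, k) \<noteq> 0" for j k
    using that deg[of j k] by (simp add: c0_def in_keys_iff)
  obtain j0 k0 where top: "(j0, k0) \<in> Poly_Mapping.keys P" "j0 + k0 = N"
    using Max_in[OF degs(1,2)] unfolding degs(3) by (auto simp: degs_def)
  \<comment> \<open>The absence of harmonic terms makes a monomial of top degree mixed, as the
    locale demands.\<close>
  have pos: "1 \<le> j0" "1 \<le> k0" using polynomial(4) top(1) by (auto simp: no_harmonic_terms_def)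
  define \<kappa> where "\<kappa> = cmod (c0 (j0, k0))"
  have kappa: "\<kappa> > 0" using top by (simp add: \<kappa>_def c0_def in_keys_iff)
  interpret M: model_family i0 i1 N j0 k0 \<kappa>
    by unfold_locales (use coordinates pos top kappa in auto)
  have N2: "2 \<le> N" by (rule M.N2)
  have eval: "zzbar_eval P z = pev N c0 z" for z
    unfolding c0_def by (rule zzbar_eval_eq_pev) (use deg in force)
  define c where "c = (\<lambda>(j, k). if j + k = N then c0 (j, k) else 0)"
  have lookup_c: "Poly_Mapping.lookup (homogeneous_part N P) = c"
    by (rule ext) (auto simp: c_def c0_def lookup_homogeneous_part)
  have eval_c: "zzbar_eval (homogeneous_part N P) z = pev N c z" for z
    unfolding lookup_c[symmetric]
    by (rule zzbar_eval_eq_pev) (auto simp: in_keys_iff lookup_homogeneous_part split: if_splits)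
  have hat: "\<Omega>_hat = M.mdom c0"
    by (simp add: \<Omega>_hat_def model_domain_def model_function_def M.mdom_def M.mfun_def eval)
  have tilde: "\<Omega>_tilde = M.mdom c"
    unfolding \<Omega>_tilde_def N_def[symmetric]
    by (simp add: model_domain_def model_function_def M.mdom_def M.mfun_def eval_c)
  \<comment> \<open>for \<open>n = 0\<close> the dilation degenerates, so that index is replaced by \<open>1\<close>\<close>
  define \<nu> where "\<nu> n = real (max 1 n)" for n :: nat
  have nu: "1 \<le> \<nu> n" for n by (simp add: \<nu>_def)
  define cs where "cs n = scaled_coeffs N c0 (\<nu> n)" for n
  have lim_nu: "filterlim \<nu> at_top sequentially"
    unfolding \<nu>_def by (rule filterlim_at_top_mono[OF filterlim_real_sequentially]) auto
  have lim: "(\<lambda>n. cs n x) \<longlonglongrightarrow> c x" for x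
  proof (cases x)
    case (Pair j k)
    show ?thesis unfolding Pair cs_def c_def split
      by (rule scaled_coeffs_limit[OF _ supp lim_nu]) (use N2 in auto)
  qed
  have real0: "pev N c0 z \<in> \<real>" for z using polynomial(2) by (simp add: real_polynomial_def eval)
  have lam0: "0 \<le> levi N c0 z" for z
    using subharmonic_levi_nonneg[OF N2] polynomial(3) by (simp add: eval)
  have adm_cs: "M.admissible (cs n)" for n
    unfolding M.admissible_def
  proof (intro conjI allI impI)
    have npos: "0 < \<nu> n" using nu[of n] by linarith
    show "j + k \<le> N" if "cs n (j, k) \<noteq> 0" for j k using that supp[of j k] by (auto simp: cs_def scaled_coeffs_def)
    \<comment> \<open>Top-degree coefficients are invariant under the dilation, which gives the
      common lower bound.\<close>
    have "(\<nu> n powr (1 / real N)) ^ N = \<nu> n"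
      using npos N2 by (simp add: powr_powr flip: powr_realpow)
    then have "(\<nu> n powr (1 / real N)) ^ N / \<nu> n = 1" using npos by simp
    then have "cs n (j0, k0) = c0 (j0, k0)" by (simp only: cs_def scaled_coeffs_def split top(2) of_real_1 mult_1_right)
    then show "\<kappa> \<le> cmod (cs n (j0, k0))" by (simp add: \<kappa>_def)
    show "pev N (cs n) z \<in> \<real>" for z
      unfolding cs_def pev_scaled_coeffs by (intro Reals_divide real0 Reals_of_real)
    fix z
    have e: "Re (pev N (cs n) x) = 1 / \<nu> n * Re (pev N c0 (of_real (\<nu> n powr (1 / real N)) * x))" for x
      unfolding cs_def pev_scaled_coeffs by simp
    have "sub_at (\<lambda>x. Re (pev N c0 x)) w" for w using lam0 by (simp add: sub_at_pev_iff[OF N2])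
    then have "sub_at (\<lambda>x. Re (pev N c0 (of_real (\<nu> n powr (1 / real N)) * x))) z"
      by (rule sub_at_compose[where k = "\<lambda>x. Re (pev N c0 x)" and g = "\<lambda>x. of_real (\<nu> n powr (1 / real N)) * x" and S = UNIV])
        (auto intro!: holomorphic_intros)
    then have "sub_at (\<lambda>x. 1 / \<nu> n * Re (pev N c0 (of_real (\<nu> n powr (1 / real N)) * x))) z"
      by (rule sub_at_cmult) (use npos in simp)
    then show "0 \<le> levi N (cs n) z" unfolding e[symmetric] sub_at_pev_iff[OF N2] .
  qed
  have adm_c: "M.admissible c"
    unfolding M.admissible_def
  proof (intro conjI allI impI)
    show "j + k \<le> N" if "c (j, k) \<noteq> 0" for j k using that by (auto simp: c_def split: if_splits)
    show "\<kappa> \<le> cmod (c (j0, k0))" by (simp add: c_def top(2) \<kappa>_def)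
    \<comment> \<open>Being real valued and having nonnegative Laplacian are closed conditions under
      convergence of coefficients.\<close>
    have real_cs: "pev N (cs n) z \<in> \<real>" and lam_cs: "0 \<le> levi N (cs n) z" for n z
      using adm_cs unfolding M.admissible_def by blast+
    have "(\<lambda>n. pev N (cs n) z) \<longlonglongrightarrow> pev N c z" for z unfolding pev_def by (intro tendsto_intros lim)
    from closed_sequentially[OF closed_complex_Reals real_cs this] show "pev N c z \<in> \<real>" for z .
    have "(\<lambda>n. levi N (cs n) z) \<longlonglongrightarrow> levi N c z" for z
      unfolding levi_def shift_def split by (intro tendsto_intros lim)
    then show "0 \<le> levi N c z" for z
      by (rule LIMSEQ_le_const) (use lam_cs in blast)
  qed
  have cv: "M.admissible_limit cs c" using adm_cs adm_c lim by (simp add: M.admissible_limit_def)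
  have image: "\<chi>n n ` \<Omega>_hat = M.mdom (cs n)" if n: "1 \<le> n" for n
  proof -
    define \<nu>' where "\<nu>' = real n"
    have v: "\<nu> n = \<nu>'" "0 < \<nu>'" using n by (auto simp: \<nu>_def \<nu>'_def max_def)
    define A where "A = anisotropic_dilation i0 i1 \<nu>' (\<nu>' powr (1 / real N)) (\<nu>' powr (1 / 2))"
    have "\<chi>n n ` \<Omega>_hat = {z. A z \<in> \<Omega>_hat}"
      unfolding \<chi>n_def dilation_at_infinity_def \<nu>'_def[symmetric]
      by (subst anisotropic_dilation_image)
        (use coordinates v in \<open>auto simp: A_def N_def powr_minus_divide\<close>)
    \<comment> \<open>The weights of the dilation multiply each of the three kinds of terms by
      \<open>\<nu>'\<close>, so the sign of the defining function, and with it membership, is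
      preserved.\<close>
    moreover have "M.mfun c0 (A z) = \<nu>' * M.mfun (cs n) z" for z
    proof -
      have A0: "A z $ i0 = of_real \<nu>' * z $ i0" by (simp add: A_def anisotropic_dilation_def)
      have A1: "A z $ i1 = of_real (\<nu>' powr (1 / real N)) * z $ i1" using coordinates by (simp add: A_def anisotropic_dilation_def)
      have "(cmod (A z $ \<alpha>))\<^sup>2 = \<nu>' * (cmod (z $ \<alpha>))\<^sup>2" if "\<alpha> \<in> - {i0, i1}" for \<alpha>
      proof -
        have "(\<nu>' powr (1 / 2))\<^sup>2 = \<nu>'" using v(2) by (simp add: powr_half_sqrt)
        moreover have "A z $ \<alpha> = of_real (\<nu>' powr (1 / 2)) * z $ \<alpha>" using that by (simp add: A_def anisotropic_dilation_def)
        ultimately show ?thesis by (simp add: norm_mult power_mult_distrib)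
      qed
      then have "(\<Sum>\<alpha>\<in>- {i0, i1}. (cmod (A z $ \<alpha>))\<^sup>2) = \<nu>' * (\<Sum>\<alpha>\<in>- {i0, i1}. (cmod (z $ \<alpha>))\<^sup>2)"
        unfolding sum_distrib_left by (intro sum.cong refl)
      then show ?thesis unfolding M.mfun_def A0 A1 cs_def v(1) pev_scaled_coeffs
        using v(2) by (simp add: distrib_left)
    qed
    ultimately show ?thesis using v(2) by (auto simp: hat M.mdom_def mult_less_0_iff)
  qed
  have unif: "uniform_limit K (\<lambda>n (p, q). kobayashi_dist (\<chi>n n ` \<Omega>_hat) p q) (\<lambda>(p, q). kobayashi_dist \<Omega>_tilde p q) sequentially"
    if K: "compact K" "K \<subseteq> \<Omega>_tilde \<times> \<Omega>_tilde" for K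
  proof (rule uniform_limitI)
    fix e :: real assume "e > 0"
    from uniform_limitD[OF M.kobayashi_dist_limit[OF cv K[unfolded tilde]] this] eventually_ge_at_top[of 1]
    show "\<forall>\<^sub>F n in sequentially. \<forall>x\<in>K. dist (case x of (p, q) \<Rightarrow> kobayashi_dist (\<chi>n n ` \<Omega>_hat) p q)
       (case x of (p, q) \<Rightarrow> kobayashi_dist \<Omega>_tilde p q) < e"
      by eventually_elim (simp only: image tilde)
  qed
  show ?thesis
  proof (intro conjI ballI allI impI)
    fix p q assume "p \<in> \<Omega>_tilde" "q \<in> \<Omega>_tilde"
    then have "uniform_limit {(p, q)} (\<lambda>n (p, q). kobayashi_dist (\<chi>n n ` \<Omega>_hat) p q) (\<lambda>(p, q). kobayashi_dist \<Omega>_tilde p q) sequentially"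
      by (intro unif) auto
    from tendsto_uniform_limitI[OF this, of "(p, q)"]
    show "(\<lambda>n. kobayashi_dist (\<chi>n n ` \<Omega>_hat) p q) \<longlonglongrightarrow> kobayashi_dist \<Omega>_tilde p q" by simp
  qed (use unif in blast)
qed

end
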